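(* Let $R$ be a finitely generated commutative algebra over a field $\Bbbk$ of characteristic zero. Let $\mathcal F^\bullet$ be a filtration on $D_{R|\Bbbk}$ that is linearly dominated by the order filtration. Suppose that $(D_{R|\Bbbk},\mathcal F^\bullet)$ is linearly simple with finite dimension and finite positive multiplicity. If $R$ is holonomic as a $D_{R|\Bbbk}$-module, then every nonzero element $f\in R$ admits a Bernstein--Sato polynomial; that is, there exist $\delta\in D_{R|\Bbbk}[s]$ and a nonzero polynomial $b(s)\in\Bbbk[s]$ such that $\delta\cdot f\boldsymbol{f^s}=b(s)\boldsymbol{f^s}$ in $R_f[s]\boldsymbol{f^s}$.
   Context: Differential operators: $D^0_{R|\Bbbk}$ is the set of multiplications by elements of $R$; $D^i_{R|\Bbbk}=\{\delta\in\operatorname{End}_\Bbbk(R):[\delta,r]\in D^{i-1}_{R|\Bbbk}\ \forall r\in R\}$; $D_{R|\Bbbk}=\bigcup_iD^i_{R|\Bbbk}$. A filtration on a $\Bbbk$-algebra $A$ is an ascending exhaustive sequence $(\mathcal F^i)_{i\in\mathbb N}$ of finite-dimensional $\Bbbk$-subspaces with $\mathcal F^0=\Bbbk$ and $\mathcal F^i\mathcal F^j\subseteq\mathcal F^{i+j}$. A filtration $\mathcal F^\bullet$ on $D_{R|\Bbbk}$ is linearly dominated by the order filtration if there is a positive integer $C$ with $\mathcal F^i\subseteq D^{Ci}_{R|\Bbbk}$ for all $i$. A compatible filtration on a left $A$-module is an ascending exhaustive sequence of finite-dimensional subspaces $\mathcal G^i$ with $\mathcal F^i\mathcal G^j\subseteq\mathcal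 G^{i+j}$. $\operatorname{Dim}(\mathcal G^\bullet)=\inf\{t\ge0:\exists C,\ \dim_\Bbbk\mathcal G^i\le Ci^t\ \forall i\gg0\}$; if $d=\operatorname{Dim}(\mathcal G^\bullet)<\infty$, the multiplicity is $\operatorname e(\mathcal G^\bullet)=\limsup_i\dim_\Bbbk\mathcal G^i/i^d$. $(A,\mathcal F^\bullet)$ is linearly simple if there is a positive integer $C$ such that $1\in\mathcal F^{Ci}\delta\mathcal F^{Ci}$ for all $i\in\mathbb N$ and all nonzero $\delta\in\mathcal F^i$. For linearly simple $(A,\mathcal F^\bullet)$ of finite dimension and positive finite multiplicity, a nonzero $A$-module is holonomic if it admits a compatible filtration of dimension $\frac12\operatorname{Dim}(\mathcal F^\bullet)$ and finite multiplicity; the zero module is holonomic. $s$ is an indeterminate and $R_f[s]\boldsymbol{f^s}$ is the free $R_f[s]$-module of rank one on the formal symbol $\boldsymbol{f^s}$, with the $D_{R|\Bbbk}[s]$-action (for $\delta\in D^n_{R|\Bbbk}[s]$) $\delta\cdot a(s)\boldsymbol{f^s}=\sum_{i=0}^{n}\binom si f^{-i}\delta^{(i)}(a(s))\boldsymbol{f^s}$, where $\delta^{(0)}=\delta$, $\delta^{(i)}=[\delta^{(i-1)},f]$, $\binom si=s(s-1)\cdots(s-i+1)/i!$, operators of $D_{R|\Bbbk}$ act on $R_f$ by the standard extension and $s$ commutes with everything. Equivalently, $(\delta\cdot a(s)\boldsymbol{f^s})|_{s\mapsto t}=\delta|_{s\mapsto t}(a(t)f^t)$ for all $t\in\mathbb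 Z$. The Bernstein--Sato polynomial of $f$ is the monic polynomial $b(s)$ of least degree satisfying such a functional equation. *)

theory Defs
  imports
    Complex_Main
    "HOL-Library.Extended_Real"
    "HOL-Algebra.UnivPoly"
    "HOL-Algebra.Generated_Rings"
    "Jordan_Normal_Form.Missing_VectorSpace"
begin

section \<open>Algebras over a field\<close>

definition has_char_zero :: "'k ring \<Rightarrow> bool" where
  "has_char_zero K \<longleftrightarrow> (\<forall>n::nat. n > 0 \<longrightarrow> [n] \<cdot>\<^bsub>K\<^esub> \<one>\<^bsub>K\<^esub> \<noteq> \<zero>\<^bsub>K\<^esub>)"

definition scalars :: "'k ring \<Rightarrow> ('k, 'a) module \<Rightarrow> 'a set" where
  "scalars K A = (\<lambda>c. c \<odot>\<^bsub>A\<^esub> \<one>\<^bsub>A\<^esub>) ` carrier K"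

text \<open>The \<open>K\<close>-subalgebra generated by \<open>S\<close> is the subring generated by \<open>S\<close> and the scalars.\<close>

definition fin_gen_algebra :: "'k ring \<Rightarrow> ('k, 'r) module \<Rightarrow> bool" where
  "fin_gen_algebra K R \<longleftrightarrow>
     (\<exists>S. finite S \<and> S \<subseteq> carrier R \<and> generate_ring R (S \<union> scalars K R) = carrier R)"


section \<open>Differential operators\<close>

text \<open>Endomorphisms are extensional functions (undefined outside the carrier), so that equality
  of operators is equality of functions.\<close>

definition End_algebra :: "'k ring \<Rightarrow> ('k, 'r) module \<Rightarrow> ('k, 'r \<Rightarrow> 'r) module" where
  "End_algebra K R = \<lparr>
     carrier = module_hom K R R \<inter> extensional (carrier R),
     mult = compose (carrier R),
     one = (\<lambda>x\<in>carrier R. x),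
     zero = (\<lambda>x\<in>carrier R. \<zero>\<^bsub>R\<^esub>),
     add = (\<lambda>\<phi> \<psi>. \<lambda>x\<in>carrier R. \<phi> x \<oplus>\<^bsub>R\<^esub> \<psi> x),
     smult = (\<lambda>c \<phi>. \<lambda>x\<in>carrier R. c \<odot>\<^bsub>R\<^esub> \<phi> x)\<rparr>"

definition mult_op :: "('k, 'r) module \<Rightarrow> 'r \<Rightarrow> 'r \<Rightarrow> 'r" where
  "mult_op R r = (\<lambda>x\<in>carrier R. r \<otimes>\<^bsub>R\<^esub> x)"

definition commutator :: "('a, 'x) ring_scheme \<Rightarrow> 'a \<Rightarrow> 'a \<Rightarrow> 'a" where
  "commutator A a b = a \<otimes>\<^bsub>A\<^esub> b \<ominus>\<^bsub>A\<^esub> b \<otimes>\<^bsub>A\<^esub> a"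

primrec diff_ops_upto :: "'k ring \<Rightarrow> ('k, 'r) module \<Rightarrow> nat \<Rightarrow> ('r \<Rightarrow> 'r) set" where
  "diff_ops_upto K R 0 = mult_op R ` carrier R"
| "diff_ops_upto K R (Suc n) =
     {\<delta> \<in> carrier (End_algebra K R).
        \<forall>r\<in>carrier R. commutator (End_algebra K R) \<delta> (mult_op R r) \<in> diff_ops_upto K R n}"

definition diff_ops :: "'k ring \<Rightarrow> ('k, 'r) module \<Rightarrow> ('k, 'r \<Rightarrow> 'r) module" where
  "diff_ops K R = (End_algebra K R)\<lparr>carrier := (\<Union>n. diff_ops_upto K R n)\<rparr>"

text \<open>\<open>R\<close> as a left module over its ring of differential operators.\<close>

definition diff_ops_module :: "('k, 'r) module \<Rightarrow> ('r \<Rightarrow> 'r, 'r) module" where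
  "diff_ops_module R = \<lparr>carrier = carrier R, mult = mult R, one = one R, zero = zero R,
     add = add R, smult = (\<lambda>\<delta> r. \<delta> r)\<rparr>"


section \<open>Filtrations, dimension and multiplicity\<close>

definition fin_dim_subspace :: "'k ring \<Rightarrow> ('k, 'v) module \<Rightarrow> 'v set \<Rightarrow> bool" where
  "fin_dim_subspace K V W \<longleftrightarrow>
     VectorSpace.subspace K W V \<and> vectorspace.fin_dim K (V\<lparr>carrier := W\<rparr>)"

definition filtration :: "'k ring \<Rightarrow> ('k, 'a) module \<Rightarrow> (nat \<Rightarrow> 'a set) \<Rightarrow> bool" where
  "filtration K A F \<longleftrightarrow>
     (\<forall>i. fin_dim_subspace K A (F i)) \<and>
     (\<forall>i. F i \<subseteq> F (Suc i)) \<and>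
     (\<Union>i. F i) = carrier A \<and>
     F 0 = scalars K A \<and>
     (\<forall>i j. \<forall>a\<in>F i. \<forall>b\<in>F j. a \<otimes>\<^bsub>A\<^esub> b \<in> F (i + j))"

definition linearly_dominated ::
  "'k ring \<Rightarrow> ('k, 'r) module \<Rightarrow> (nat \<Rightarrow> ('r \<Rightarrow> 'r) set) \<Rightarrow> bool" where
  "linearly_dominated K R F \<longleftrightarrow> (\<exists>C>0. \<forall>i. F i \<subseteq> diff_ops_upto K R (C * i))"

text \<open>The underlying \<open>K\<close>-vector space of a left module over a \<open>K\<close>-algebra \<open>A\<close>. (The locale
  \<^locale>\<open>module\<close> of the library asks for commutative scalars, so left \<open>A\<close>-modules are only
  represented by the record type.)\<close>

definition restrict_scalars ::
  "'k ring \<Rightarrow> ('k, 'a) module \<Rightarrow> ('a, 'm) module \<Rightarrow> ('k, 'm) module" where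
  "restrict_scalars K A M = \<lparr>carrier = carrier M, mult = mult M, one = one M, zero = zero M,
     add = add M, smult = (\<lambda>c m. (c \<odot>\<^bsub>A\<^esub> \<one>\<^bsub>A\<^esub>) \<odot>\<^bsub>M\<^esub> m)\<rparr>"

definition compatible_filtration ::
  "'k ring \<Rightarrow> ('k, 'a) module \<Rightarrow> (nat \<Rightarrow> 'a set) \<Rightarrow> ('a, 'm) module \<Rightarrow> (nat \<Rightarrow> 'm set) \<Rightarrow> bool"
  where
  "compatible_filtration K A F M G \<longleftrightarrow>
     (\<forall>i. fin_dim_subspace K (restrict_scalars K A M) (G i)) \<and>
     (\<forall>i. G i \<subseteq> G (Suc i)) \<and>
     (\<Union>i. G i) = carrier M \<and>
     (\<forall>i j. \<forall>a\<in>F i. \<forall>m\<in>G j. a \<odot>\<^bsub>M\<^esub> m \<in> G (i + j))"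

definition subspace_dim :: "'k ring \<Rightarrow> ('k, 'v) module \<Rightarrow> 'v set \<Rightarrow> nat" where
  "subspace_dim K V W = vectorspace.dim K (V\<lparr>carrier := W\<rparr>)"

text \<open>The value is \<open>\<infinity>\<close> if there is no polynomial bound, because the infimum of the empty set
  in \<^typ>\<open>ereal\<close> is \<open>\<infinity>\<close>.\<close>

definition filt_dim :: "'k ring \<Rightarrow> ('k, 'v) module \<Rightarrow> (nat \<Rightarrow> 'v set) \<Rightarrow> ereal" where
  "filt_dim K V G = Inf {ereal t | t. t \<ge> 0 \<and>
     (\<exists>C::real. \<forall>\<^sub>F i in sequentially. real (subspace_dim K V (G i)) \<le> C * real i powr t)}"

text \<open>Meaningful only if \<^term>\<open>filt_dim K V G < \<infinity>\<close>.\<close>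

definition filt_mult :: "'k ring \<Rightarrow> ('k, 'v) module \<Rightarrow> (nat \<Rightarrow> 'v set) \<Rightarrow> ereal" where
  "filt_mult K V G = limsup (\<lambda>i.
     ereal (real (subspace_dim K V (G i)) / real i powr real_of_ereal (filt_dim K V G)))"

text \<open>As usual for products of subspaces, \<open>F\<^sup>m \<delta> F\<^sup>m\<close> is the linear span of the products
  \<open>u \<delta> v\<close>.\<close>

definition linearly_simple :: "'k ring \<Rightarrow> ('k, 'a) module \<Rightarrow> (nat \<Rightarrow> 'a set) \<Rightarrow> bool" where
  "linearly_simple K A F \<longleftrightarrow>
     (\<exists>C>0. \<forall>i. \<forall>\<delta>\<in>F i - {\<zero>\<^bsub>A\<^esub>}.
        \<one>\<^bsub>A\<^esub> \<in> LinearCombinations.module.span K A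
          {u \<otimes>\<^bsub>A\<^esub> \<delta> \<otimes>\<^bsub>A\<^esub> v | u v. u \<in> F (C * i) \<and> v \<in> F (C * i)})"

definition holonomic ::
  "'k ring \<Rightarrow> ('k, 'a) module \<Rightarrow> (nat \<Rightarrow> 'a set) \<Rightarrow> ('a, 'm) module \<Rightarrow> bool" where
  "holonomic K A F M \<longleftrightarrow>
     carrier M = {\<zero>\<^bsub>M\<^esub>} \<or>
     (\<exists>G. compatible_filtration K A F M G \<and>
          filt_dim K (restrict_scalars K A M) G = filt_dim K A F / 2 \<and>
          filt_mult K (restrict_scalars K A M) G < \<infinity>)"


section \<open>The localization of \<open>R\<close> at the powers of \<open>f\<close>\<close>

text \<open>The pair \<open>(a, m)\<close> stands for \<open>a / f\<^sup>m\<close>. The ring \<open>R\<close> may have zero divisors and \<open>f\<close> may be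
  nilpotent.\<close>

definition loc_rel :: "('k, 'r) module \<Rightarrow> 'r \<Rightarrow> (('r \<times> nat) \<times> ('r \<times> nat)) set" where
  "loc_rel R f = {((a, m), (b, n)). a \<in> carrier R \<and> b \<in> carrier R \<and>
     (\<exists>l::nat. f [^]\<^bsub>R\<^esub> l \<otimes>\<^bsub>R\<^esub> (f [^]\<^bsub>R\<^esub> n \<otimes>\<^bsub>R\<^esub> a) = f [^]\<^bsub>R\<^esub> l \<otimes>\<^bsub>R\<^esub> (f [^]\<^bsub>R\<^esub> m \<otimes>\<^bsub>R\<^esub> b))}"

definition loc_frac :: "('k, 'r) module \<Rightarrow> 'r \<Rightarrow> 'r \<Rightarrow> nat \<Rightarrow> ('r \<times> nat) set" where
  "loc_frac R f a m = loc_rel R f `` {(a, m)}"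

definition localization :: "('k, 'r) module \<Rightarrow> 'r \<Rightarrow> ('k, ('r \<times> nat) set) module" where
  "localization R f = \<lparr>
     carrier = (carrier R \<times> UNIV) // loc_rel R f,
     mult = (\<lambda>X Y. \<Union>(a, m)\<in>X. \<Union>(b, n)\<in>Y. loc_frac R f (a \<otimes>\<^bsub>R\<^esub> b) (m + n)),
     one = loc_frac R f \<one>\<^bsub>R\<^esub> 0,
     zero = loc_frac R f \<zero>\<^bsub>R\<^esub> 0,
     add = (\<lambda>X Y. \<Union>(a, m)\<in>X. \<Union>(b, n)\<in>Y.
              loc_frac R f (f [^]\<^bsub>R\<^esub> n \<otimes>\<^bsub>R\<^esub> a \<oplus>\<^bsub>R\<^esub> f [^]\<^bsub>R\<^esub> m \<otimes>\<^bsub>R\<^esub> b) (m + n)),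
     smult = (\<lambda>c X. \<Union>(a, m)\<in>X. loc_frac R f (c \<odot>\<^bsub>R\<^esub> a) m)\<rparr>"

text \<open>A differential operator on \<open>R\<close> has exactly one extension to a differential operator on the
  localization.\<close>

definition loc_extension :: "'k ring \<Rightarrow> ('k, 'r) module \<Rightarrow> 'r \<Rightarrow> ('r \<Rightarrow> 'r) \<Rightarrow>
    ('r \<times> nat) set \<Rightarrow> ('r \<times> nat) set" where
  "loc_extension K R f \<delta> = (THE \<delta>'. \<delta>' \<in> carrier (diff_ops K (localization R f)) \<and>
     (\<forall>r\<in>carrier R. \<delta>' (loc_frac R f r 0) = loc_frac R f (\<delta> r) 0))"


section \<open>The \<open>D[s]\<close>-module \<open>R\<^sub>f[s] f\<^sup>s\<close>\<close>

text \<open>\<open>UP A\<close> is \<open>A[s]\<close>, also for the noncommutative ring of differential operators; \<open>s\<close> is central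
  in it.\<close>

definition scalar_poly :: "('k, 'a) module \<Rightarrow> (nat \<Rightarrow> 'k) \<Rightarrow> (nat \<Rightarrow> 'a)" where
  "scalar_poly A p = (\<lambda>n. p n \<odot>\<^bsub>A\<^esub> \<one>\<^bsub>A\<^esub>)"

definition binom_poly :: "'k ring \<Rightarrow> nat \<Rightarrow> (nat \<Rightarrow> 'k)" where
  "binom_poly K i =
     inv\<^bsub>K\<^esub> ([(fact i :: nat)] \<cdot>\<^bsub>K\<^esub> \<one>\<^bsub>K\<^esub>) \<odot>\<^bsub>UP K\<^esub>
       (\<Otimes>\<^bsub>UP K\<^esub>j\<in>{..<i}. monom (UP K) \<one>\<^bsub>K\<^esub> 1 \<ominus>\<^bsub>UP K\<^esub> [j] \<cdot>\<^bsub>UP K\<^esub> \<one>\<^bsub>UP K\<^esub>)"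

text \<open>The \<open>i\<close>-fold iterated commutator with \<open>f\<close>, taken in \<open>D[s]\<close>.\<close>

primrec iter_commutator ::
  "'k ring \<Rightarrow> ('k, 'r) module \<Rightarrow> 'r \<Rightarrow> (nat \<Rightarrow> 'r \<Rightarrow> 'r) \<Rightarrow> nat \<Rightarrow> (nat \<Rightarrow> 'r \<Rightarrow> 'r)" where
  "iter_commutator K R f \<delta> 0 = \<delta>"
| "iter_commutator K R f \<delta> (Suc i) =
     commutator (UP (diff_ops K R)) (iter_commutator K R f \<delta> i)
       (monom (UP (diff_ops K R)) (mult_op R f) 0)"

text \<open>\<open>(\<Sum>j. \<delta>\<^sub>j s\<^sup>j) (\<Sum>k. a\<^sub>k s\<^sup>k) = \<Sum>j k. \<delta>\<^sub>j(a\<^sub>k) s\<^sup>j\<^sup>+\<^sup>k\<close>\<close>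

definition poly_apply :: "'k ring \<Rightarrow> ('k, 'r) module \<Rightarrow> 'r \<Rightarrow>
    (nat \<Rightarrow> 'r \<Rightarrow> 'r) \<Rightarrow> (nat \<Rightarrow> ('r \<times> nat) set) \<Rightarrow> (nat \<Rightarrow> ('r \<times> nat) set)" where
  "poly_apply K R f \<delta> a =
     (\<lambda>n. \<Oplus>\<^bsub>localization R f\<^esub>j\<in>{..n}. loc_extension K R f (\<delta> j) (a (n - j)))"

definition poly_order :: "'k ring \<Rightarrow> ('k, 'r) module \<Rightarrow> (nat \<Rightarrow> 'r \<Rightarrow> 'r) \<Rightarrow> nat" where
  "poly_order K R \<delta> = (LEAST n. \<forall>j. \<delta> j \<in> diff_ops_upto K R n)"

text \<open>The element \<open>a(s) f\<^sup>s\<close> of the free module on the symbol \<open>f\<^sup>s\<close> is represented by its coordinate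
  \<open>a(s)\<close>; \<open>fs_action K R f \<delta> a\<close> is the coordinate of \<open>\<delta> \<cdot> a(s) f\<^sup>s\<close>. Taking the least \<open>n\<close> as upper
  summation bound is no restriction, since the iterated commutators vanish beyond the order of
  \<open>\<delta>\<close>.\<close>

definition fs_action :: "'k ring \<Rightarrow> ('k, 'r) module \<Rightarrow> 'r \<Rightarrow>
    (nat \<Rightarrow> 'r \<Rightarrow> 'r) \<Rightarrow> (nat \<Rightarrow> ('r \<times> nat) set) \<Rightarrow> (nat \<Rightarrow> ('r \<times> nat) set)" where
  "fs_action K R f \<delta> a =
     (\<Oplus>\<^bsub>UP (localization R f)\<^esub>i\<in>{..poly_order K R \<delta>}.
        scalar_poly (localization R f) (binom_poly K i) \<otimes>\<^bsub>UP (localization R f)\<^esub>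
          (loc_frac R f \<one>\<^bsub>R\<^esub> i \<odot>\<^bsub>UP (localization R f)\<^esub>
             poly_apply K R f (iter_commutator K R f \<delta> i) a))"

end

theory Submission
  imports Defs
begin

text \<open>Put $D = D_{R|\Bbbk}$, let $d$ be the dimension of $\mathcal F^\bullet$, and let $\mathcal G^\bullet$ be a filtration
of $R$ of dimension $d/2$ and finite multiplicity, which exists since $R$ is holonomic. The functional equation is
first proved at integers and then interpolated.

\<^item> \<^emph>\<open>At integers.\<close> For $t \in \mathbb N$ and a level $p$ consider the subspaces $\mathcal F^p f^t$ of $R$. A
differential operator of order $N \le t$ maps $f^t$ into $f^{t-N} R$, and the Leibniz rule refines this to
$\mathcal F^p f^t \subseteq f^{t-N} \mathcal G^q$, where $q$ is linear in $p$ because the filtration is linearly dominated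
(\<open>operator_on_power\<close>). So $\dim \mathcal F^p f^t \le \dim \mathcal G^q$ \<^emph>\<open>uniformly in\<close> $t$
(\<open>indep_orb_power_bound\<close>). Now compare $f^t, f^{t+1}, \ldots, f^{t+n}$. The spaces
$\mathcal F^{p_k} f^{t+k}$ decrease with $k$ if the levels $p_k$ decrease fast enough. If $f^{t+k}$ is not obtained from
$f^{t+k+1}$ by an operator of bounded level, then linear simplicity shows that no nonzero $\delta \in \mathcal F^i$ maps the
$k$-th layer of one such chain to zero in the $k$-th layer of a second chain, and therefore
$\dim \mathcal F^i \le a_k b_k$ for the dimensions $a_k$, $b_k$ of the two layers (\<open>operator_into_subspace\<close>,
\<open>simple_recovers_vector\<close>). This is Bernstein's inequality applied to a subquotient, at one fixed
level. As $\sum_k a_k$ and $\sum_k b_k$ are at most $\dim \mathcal G^q$, failure for all $k < n$ gives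
$n \sqrt{\dim \mathcal F^i} \le \dim \mathcal G^q$ (\<open>descent\<close>). Here $q \le A i$ for a constant $A$ that does not depend
on $n$, the right hand side grows at most like $i^{d/2}$, and $\dim \mathcal F^i$ grows at least like $i^d$ along a sequence
of levels $i$. So $n$ is bounded: there is a level $M$ such that $f^t \in \mathcal F^M f^{t+1}$ for infinitely many
$t$ (\<open>infinitely_many_descents\<close>).

\<^item> \<^emph>\<open>Interpolation.\<close> Let $\delta_1, \ldots, \delta_r$ span $\mathcal F^M$. The vectors
$v_a(s) = \sum_i \binom s i f^{-i} \delta_a^{(i)}(f)$ lie in $H[s]$ for a finite-dimensional subspace $H$ of $R_f$ that
contains $1$, and $v_a(t) f^t = \delta_a(f^{t+1})$. Hence the linear system $\sum_a x_a v_a(s) = 1$ becomes solvable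
over $\Bbbk$ when $s$ is replaced by one of infinitely many integers. Fraction-free Gaussian elimination
turns this into polynomials $c_a(s)$ and $b(s) \ne 0$ such that $\sum_a c_a(s) v_a(s) = b(s)$ (\<open>generic_solution\<close>), which is the functional equation for
$\delta = \sum_a c_a(s) \delta_a$ (\<open>functional_equation_from_infinitely_many_integers\<close>).

The action on $R_f[s] \boldsymbol{f^s}$ is defined by means of the extension of differential operators to $R_f$, which
is constructed by induction on the order (\<open>extension_exists\<close>) and determined by its restriction to $R$
(\<open>vanishing_on_R\<close>).\<close>

section \<open>Linear algebra over a field\<close>

lemma (in abelian_monoid) finsum_lessThan_Suc:
  assumes "\<And>i. i < Suc n \<Longrightarrow> g i \<in> carrier G"
  shows "(\<Oplus>i\<in>{..<Suc n}. g i) = (\<Oplus>i\<in>{..<n}. g i) \<oplus> g n"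
  using assms by (simp add: lessThan_Suc finsum_insert Pi_def a_comm)

lemma (in abelian_monoid) finsum_in_closed:
  assumes "finite A" "\<zero> \<in> W" "W \<subseteq> carrier G" "\<And>x y. x \<in> W \<Longrightarrow> y \<in> W \<Longrightarrow> x \<oplus> y \<in> W"
    and "\<And>a. a \<in> A \<Longrightarrow> g a \<in> W"
  shows "finsum G g A \<in> W"
  using assms(1,5)
proof (induction A rule: finite_induct)
  case empty then show ?case using assms(2) by simp
next
  case (insert x A)
  have "g \<in> A \<rightarrow> carrier G" "g x \<in> carrier G" using insert(4) assms(3) by auto
  then show ?case using insert assms(4) by (simp add: finsum_insert)
qed

text \<open>By induction on the number of equations. A nonzero coefficient \<open>p\<close> of the last equation serves as a
pivot to eliminate one unknown from the other equations. The solution of the smaller system is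
multiplied by \<open>p\<close> instead of dividing the eliminated unknown by it, so that a domain suffices.\<close>

lemma (in domain) homogeneous_system_nontrivial_solution:
  assumes "finite S" "q < card S" "\<And>l s. l < (q::nat) \<Longrightarrow> s \<in> S \<Longrightarrow> m l s \<in> carrier R"
  shows "\<exists>x \<in> S \<rightarrow> carrier R. (\<exists>s\<in>S. x s \<noteq> \<zero>) \<and> (\<forall>l<q. (\<Oplus>s\<in>S. m l s \<otimes> x s) = \<zero>)"
  using assms
proof (induction q arbitrary: S m)
  case 0
  then obtain s where "s \<in> S" by fastforce
  then show ?case by (intro bexI[of _ "\<lambda>_. \<one>"]) auto
next
  case (Suc q)
  show ?case
  proof (cases "\<forall>s\<in>S. m q s = \<zero>")
    case True
    obtain x where x: "x \<in> S \<rightarrow> carrier R" "\<exists>s\<in>S. x s \<noteq> \<zero>" "\<forall>l<q. (\<Oplus>s\<in>S. m l s \<otimes> x s) = \<zero>"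
      using Suc.IH[of S m] Suc.prems by (auto simp: less_Suc_eq)
    have "(\<Oplus>s\<in>S. m q s \<otimes> x s) = (\<Oplus>s\<in>S. \<zero>)"
      using True x by (intro finsum_cong') (auto simp: Pi_iff)
    then show ?thesis using x by (intro bexI[of _ x]) (auto simp: less_Suc_eq)
  next
    case False
    then obtain s0 where s0: "s0 \<in> S" "m q s0 \<noteq> \<zero>" by blast
    define T where "T = S - {s0}"
    have T: "finite T" "q < card T" "S = insert s0 T" "s0 \<notin> T"
      using Suc.prems s0 by (auto simp: T_def card_Diff_singleton)
    have mc: "m l s \<in> carrier R" if "l < Suc q" "s \<in> S" for l s using Suc.prems that by blast
    define p where "p = m q s0"
    have p: "p \<in> carrier R" "p \<noteq> \<zero>" using s0 mc p_def by auto
    define m' where "m' l s = p \<otimes> m l s \<ominus> m l s0 \<otimes> m q s" for l s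
    obtain x where x: "x \<in> T \<rightarrow> carrier R" "\<exists>s\<in>T. x s \<noteq> \<zero>" "\<forall>l<q. (\<Oplus>s\<in>T. m' l s \<otimes> x s) = \<zero>"
    proof -
      have "m' l s \<in> carrier R" if "l < q" "s \<in> T" for l s
        using that T mc p s0 unfolding m'_def by auto
      then show thesis using Suc.IH[of T m'] T that by blast
    qed
    have xT: "x s \<in> carrier R" if "s \<in> T" for s using x(1) that by (rule funcset_mem)
    define x0 where "x0 = \<ominus> (\<Oplus>s\<in>T. m q s \<otimes> x s)"
    have x0: "x0 \<in> carrier R" using xT mc T unfolding x0_def by (auto intro!: finsum_closed)
    define y where "y s = (if s = s0 then x0 else p \<otimes> x s)" for s
    have y: "y \<in> S \<rightarrow> carrier R" using xT x0 p T by (auto simp: y_def)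
    have sum: "(\<Oplus>s\<in>S. m l s \<otimes> y s) = (\<Oplus>s\<in>T. m' l s \<otimes> x s)" if l: "l < Suc q" for l
    proof -
      have ml: "m l s0 \<in> carrier R" "\<And>s. s \<in> T \<Longrightarrow> m l s \<in> carrier R" "\<And>s. s \<in> T \<Longrightarrow> m q s \<in> carrier R"
        using mc l T by auto
      have "(\<Oplus>s\<in>S. m l s \<otimes> y s) = m l s0 \<otimes> x0 \<oplus> (\<Oplus>s\<in>T. m l s \<otimes> y s)"
        using T y ml unfolding T(3) by (subst finsum_insert) (auto simp: y_def Pi_def)
      also have "(\<Oplus>s\<in>T. m l s \<otimes> y s) = (\<Oplus>s\<in>T. m' l s \<otimes> x s \<oplus> m l s0 \<otimes> (m q s \<otimes> x s))"
      proof (intro finsum_cong')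
        fix s assume s: "s \<in> T"
        show "m l s \<otimes> y s = m' l s \<otimes> x s \<oplus> m l s0 \<otimes> (m q s \<otimes> x s)"
          using s T ml(1) ml(2,3)[OF s] xT[OF s] p(1) by (auto simp: y_def m'_def) algebra
      qed (use ml xT p(1) in \<open>auto simp: m'_def\<close>)
      also have "\<dots> = (\<Oplus>s\<in>T. m' l s \<otimes> x s) \<oplus> (\<Oplus>s\<in>T. m l s0 \<otimes> (m q s \<otimes> x s))"
        using ml xT p by (intro finsum_addf) (auto simp: m'_def)
      also have "(\<Oplus>s\<in>T. m l s0 \<otimes> (m q s \<otimes> x s)) = m l s0 \<otimes> (\<Oplus>s\<in>T. m q s \<otimes> x s)"
        using T ml xT by (intro finsum_rdistr[symmetric]) auto
      finally have e: "(\<Oplus>s\<in>S. m l s \<otimes> y s) = m l s0 \<otimes> x0 \<oplus> ((\<Oplus>s\<in>T. m' l s \<otimes> x s) \<oplus> m l s0 \<otimes> (\<Oplus>s\<in>T. m q s \<otimes> x s))" .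
      have c: "(\<Oplus>s\<in>T. m' l s \<otimes> x s) \<in> carrier R" "(\<Oplus>s\<in>T. m q s \<otimes> x s) \<in> carrier R"
        using ml xT p by (auto intro!: finsum_closed simp: m'_def)
      have "\<And>u v. u \<in> carrier R \<Longrightarrow> v \<in> carrier R \<Longrightarrow> m l s0 \<otimes> (\<ominus> v) \<oplus> (u \<oplus> m l s0 \<otimes> v) = u"
        using ml(1) by algebra
      then show ?thesis unfolding e x0_def using c by blast
    qed
    have "(\<Oplus>s\<in>T. m' q s \<otimes> x s) = (\<Oplus>s\<in>T. \<zero>)"
    proof (intro finsum_cong')
      fix s assume s: "s \<in> T"
      have c: "m q s \<in> carrier R" "x s \<in> carrier R" using mc T s xT by auto
      show "m' q s \<otimes> x s = \<zero>" using c p(1) unfolding m'_def p_def by algebra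
    qed auto
    then have "\<forall>l<Suc q. (\<Oplus>s\<in>S. m l s \<otimes> y s) = \<zero>" using sum x(3) by (auto simp: less_Suc_eq)
    moreover have "\<exists>s\<in>S. y s \<noteq> \<zero>"
      proof -
      obtain s where s: "s \<in> T" "x s \<noteq> \<zero>" using x(2) by blast
      then have "y s \<noteq> \<zero>" using xT[OF s(1)] p T(4) by (auto simp: y_def integral_iff)
      then show ?thesis using s T(3) by blast
    qed
    ultimately show ?thesis using y by blast
  qed
qed

context vectorspace begin

text \<open>Linear combinations of families indexed by an initial segment of the natural numbers. Compared with
combinations over sets of vectors, such families may have repetitions, they can be mapped by
operators, and they can be concatenated.\<close>

definition lin_sum :: "(nat \<Rightarrow> 'a) \<Rightarrow> (nat \<Rightarrow> 'c) \<Rightarrow> nat \<Rightarrow> 'c" where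
  "lin_sum c v n = (\<Oplus>\<^bsub>V\<^esub>i\<in>{..<n}. c i \<odot>\<^bsub>V\<^esub> v i)"

lemma lin_sum_0 [simp]: "lin_sum c v 0 = \<zero>\<^bsub>V\<^esub>" by (simp add: lin_sum_def)

lemma lin_sum_Suc:
  assumes "\<And>i. i < Suc n \<Longrightarrow> c i \<in> carrier K" "\<And>i. i < Suc n \<Longrightarrow> v i \<in> carrier V"
  shows "lin_sum c v (Suc n) = lin_sum c v n \<oplus>\<^bsub>V\<^esub> c n \<odot>\<^bsub>V\<^esub> v n"
  unfolding lin_sum_def using assms by (intro M.finsum_lessThan_Suc) auto

lemma lin_sum_closed:
  assumes "\<And>i. i < n \<Longrightarrow> c i \<in> carrier K" "\<And>i. i < n \<Longrightarrow> v i \<in> carrier V"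
  shows "lin_sum c v n \<in> carrier V"
  unfolding lin_sum_def using assms by (auto intro!: M.finsum_closed)

lemma lin_sum_cong:
  assumes "\<And>i. i < n \<Longrightarrow> c i = d i" "\<And>i. i < n \<Longrightarrow> v i = w i"
    "\<And>i. i < n \<Longrightarrow> d i \<in> carrier K" "\<And>i. i < n \<Longrightarrow> w i \<in> carrier V"
  shows "lin_sum c v n = lin_sum d w n"
  unfolding lin_sum_def using assms by (intro M.finsum_cong') auto

lemma lin_sum_smult:
  assumes "\<And>i. i < n \<Longrightarrow> c i \<in> carrier K" "\<And>i. i < n \<Longrightarrow> v i \<in> carrier V" "a \<in> carrier K"
  shows "lin_sum (\<lambda>i. a \<otimes>\<^bsub>K\<^esub> c i) v n = a \<odot>\<^bsub>V\<^esub> lin_sum c v n"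
  using assms
proof (induction n)
  case 0 then show ?case by simp
next
  case (Suc n)
  then show ?case
    by (simp add: lin_sum_Suc lin_sum_closed smult_r_distr smult_assoc1)
qed

lemma lin_sum_zero:
  assumes "\<And>i. i < n \<Longrightarrow> c i = \<zero>\<^bsub>K\<^esub>" "\<And>i. i < n \<Longrightarrow> v i \<in> carrier V"
  shows "lin_sum c v n = \<zero>\<^bsub>V\<^esub>"
  using assms
proof (induction n)
  case (Suc n)
  then show ?case by (simp add: lin_sum_Suc)
qed simp

lemma lin_sum_add:
  assumes "\<And>i. i < n \<Longrightarrow> c i \<in> carrier K" "\<And>i. i < n \<Longrightarrow> d i \<in> carrier K" "\<And>i. i < n \<Longrightarrow> v i \<in> carrier V"
  shows "lin_sum (\<lambda>i. c i \<oplus>\<^bsub>K\<^esub> d i) v n = lin_sum c v n \<oplus>\<^bsub>V\<^esub> lin_sum d v n"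
proof -
  have "lin_sum (\<lambda>i. c i \<oplus>\<^bsub>K\<^esub> d i) v n = (\<Oplus>\<^bsub>V\<^esub>i\<in>{..<n}. c i \<odot>\<^bsub>V\<^esub> v i \<oplus>\<^bsub>V\<^esub> d i \<odot>\<^bsub>V\<^esub> v i)"
    unfolding lin_sum_def using assms by (intro M.finsum_cong') (auto simp: smult_l_distr)
  also have "\<dots> = lin_sum c v n \<oplus>\<^bsub>V\<^esub> lin_sum d v n"
    unfolding lin_sum_def using assms by (intro M.finsum_addf) auto
  finally show ?thesis .
qed

lemma lin_sum_minus_right:
  assumes "\<And>i. i < n \<Longrightarrow> c i \<in> carrier K" "\<And>i. i < n \<Longrightarrow> v i \<in> carrier V" "\<And>i. i < n \<Longrightarrow> w i \<in> carrier V"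
  shows "lin_sum c (\<lambda>i. v i \<ominus>\<^bsub>V\<^esub> w i) n = lin_sum c v n \<ominus>\<^bsub>V\<^esub> lin_sum c w n"
  using assms
proof (induction n)
  case (Suc n)
  have "lin_sum c (\<lambda>i. v i \<ominus>\<^bsub>V\<^esub> w i) (Suc n) = (lin_sum c v n \<ominus>\<^bsub>V\<^esub> lin_sum c w n) \<oplus>\<^bsub>V\<^esub> c n \<odot>\<^bsub>V\<^esub> (v n \<ominus>\<^bsub>V\<^esub> w n)"
    using Suc by (simp add: lin_sum_Suc)
  moreover have "c n \<odot>\<^bsub>V\<^esub> (v n \<ominus>\<^bsub>V\<^esub> w n) = c n \<odot>\<^bsub>V\<^esub> v n \<ominus>\<^bsub>V\<^esub> c n \<odot>\<^bsub>V\<^esub> w n"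
    using Suc.prems by (simp add: a_minus_def smult_r_distr smult_r_minus)
  moreover have "lin_sum c v n \<in> carrier V" "lin_sum c w n \<in> carrier V" using Suc.prems by (auto intro!: lin_sum_closed)
  ultimately show ?case using Suc.prems
    by (simp add: lin_sum_Suc a_minus_def M.minus_add M.a_ac)
qed (metis M.r_neg M.zero_closed a_minus_def lin_sum_0)

text \<open>Substituting coordinates: if the \<open>s\<close>-th vector of a family has the coordinates \<open>m s\<close> with respect to
\<open>y\<close>, the coordinates of a combination are given by the vector-matrix product.\<close>

lemma lin_sum_lin_sum:
  assumes "\<And>s. s < r \<Longrightarrow> c s \<in> carrier K" "\<And>s j. s < r \<Longrightarrow> j < b \<Longrightarrow> m s j \<in> carrier K" "\<And>j. j < b \<Longrightarrow> y j \<in> carrier V"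
  shows "lin_sum c (\<lambda>s. lin_sum (m s) y b) r = lin_sum (\<lambda>j. \<Oplus>\<^bsub>K\<^esub>s\<in>{..<r}. m s j \<otimes>\<^bsub>K\<^esub> c s) y b"
  using assms
proof (induction r)
  case 0
  then show ?case using lin_sum_zero[of b "\<lambda>j. \<zero>\<^bsub>K\<^esub>" y] by simp
next
  case (Suc r)
  have mc: "(\<Oplus>\<^bsub>K\<^esub>s\<in>{..<Suc r}. m s j \<otimes>\<^bsub>K\<^esub> c s) = (\<Oplus>\<^bsub>K\<^esub>s\<in>{..<r}. m s j \<otimes>\<^bsub>K\<^esub> c s) \<oplus>\<^bsub>K\<^esub> c r \<otimes>\<^bsub>K\<^esub> m r j" if "j < b" for j
    using Suc.prems that by (subst R.finsum_lessThan_Suc) (auto simp: R.m_comm)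
  have c: "(\<Oplus>\<^bsub>K\<^esub>s\<in>{..<r}. m s j \<otimes>\<^bsub>K\<^esub> c s) \<in> carrier K" if "j < b" for j
    using Suc.prems that by (auto intro!: R.finsum_closed)
  have "lin_sum (\<lambda>j. \<Oplus>\<^bsub>K\<^esub>s\<in>{..<Suc r}. m s j \<otimes>\<^bsub>K\<^esub> c s) y b =
      lin_sum (\<lambda>j. (\<Oplus>\<^bsub>K\<^esub>s\<in>{..<r}. m s j \<otimes>\<^bsub>K\<^esub> c s) \<oplus>\<^bsub>K\<^esub> c r \<otimes>\<^bsub>K\<^esub> m r j) y b"
    using Suc.prems c by (intro lin_sum_cong) (auto simp: mc)
  also have "\<dots> = lin_sum (\<lambda>j. \<Oplus>\<^bsub>K\<^esub>s\<in>{..<r}. m s j \<otimes>\<^bsub>K\<^esub> c s) y b \<oplus>\<^bsub>V\<^esub> lin_sum (\<lambda>j. c r \<otimes>\<^bsub>K\<^esub> m r j) y b"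
    using Suc.prems c by (intro lin_sum_add) auto
  also have "lin_sum (\<lambda>j. c r \<otimes>\<^bsub>K\<^esub> m r j) y b = c r \<odot>\<^bsub>V\<^esub> lin_sum (m r) y b"
    using Suc.prems by (intro lin_sum_smult) auto
  also have "lin_sum (\<lambda>j. \<Oplus>\<^bsub>K\<^esub>s\<in>{..<r}. m s j \<otimes>\<^bsub>K\<^esub> c s) y b = lin_sum c (\<lambda>s. lin_sum (m s) y b) r"
    using Suc by simp
  finally show ?case using Suc.prems by (subst lin_sum_Suc) (auto intro!: lin_sum_closed)
qed

lemma lin_sum_append:
  assumes "\<And>i. i < n + m \<Longrightarrow> c i \<in> carrier K" "\<And>i. i < n + m \<Longrightarrow> v i \<in> carrier V"
  shows "lin_sum c v (n + m) = lin_sum c v n \<oplus>\<^bsub>V\<^esub> lin_sum (\<lambda>i. c (n + i)) (\<lambda>i. v (n + i)) m"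
  using assms
proof (induction m)
  case 0 then show ?case by (simp add: lin_sum_closed)
next
  case (Suc m)
  have "lin_sum (\<lambda>i. c (n + i)) (\<lambda>i. v (n + i)) (Suc m) =
      lin_sum (\<lambda>i. c (n + i)) (\<lambda>i. v (n + i)) m \<oplus>\<^bsub>V\<^esub> c (n+m) \<odot>\<^bsub>V\<^esub> v (n+m)"
    using Suc.prems by (subst lin_sum_Suc) auto
  moreover have "lin_sum c v (n + Suc m) = lin_sum c v (n + m) \<oplus>\<^bsub>V\<^esub> c (n+m) \<odot>\<^bsub>V\<^esub> v (n+m)"
    using Suc.prems by (simp add: lin_sum_Suc)
  moreover have "lin_sum c v (n + m) = lin_sum c v n \<oplus>\<^bsub>V\<^esub> lin_sum (\<lambda>i. c (n + i)) (\<lambda>i. v (n + i)) m"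
    using Suc by simp
  ultimately show ?case using Suc.prems
    by (simp add: lin_sum_closed M.a_assoc)
qed

lemma lin_sum_in_subspace:
  assumes "subspace K W V" "\<And>i. i < n \<Longrightarrow> c i \<in> carrier K" "\<And>i. i < n \<Longrightarrow> v i \<in> W"
  shows "lin_sum c v n \<in> W"
proof -
  interpret W: submodule K W V using assms(1) by (simp add: subspace_def)
  show ?thesis unfolding lin_sum_def
    by (rule M.finsum_in_closed) (use W.subset assms in auto)
qed

lemma subspace_minus:
  assumes "subspace K W V" "x \<in> W" "y \<in> W"
  shows "x \<ominus>\<^bsub>V\<^esub> y \<in> W"
proof -
  interpret W: submodule K W V using assms(1) by (simp add: subspace_def)
  have "\<ominus>\<^bsub>V\<^esub> y = (\<ominus>\<^bsub>K\<^esub> \<one>\<^bsub>K\<^esub>) \<odot>\<^bsub>V\<^esub> y" using W.subset assms(3) by (simp add: smult_minus_1 subset_iff)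
  then show ?thesis using assms W.subset by (simp add: a_minus_def)
qed

text \<open>Independence and generation in the quotient \<open>U / W\<close>, expressed by representatives.\<close>

definition indep_mod :: "'c set \<Rightarrow> (nat \<Rightarrow> 'c) \<Rightarrow> nat \<Rightarrow> bool" where
  "indep_mod W v n \<longleftrightarrow> (\<forall>i<n. v i \<in> carrier V) \<and>
     (\<forall>c. (\<forall>i<n. c i \<in> carrier K) \<longrightarrow> lin_sum c v n \<in> W \<longrightarrow> (\<forall>i<n. c i = \<zero>\<^bsub>K\<^esub>))"

definition spans_mod :: "'c set \<Rightarrow> 'c set \<Rightarrow> (nat \<Rightarrow> 'c) \<Rightarrow> nat \<Rightarrow> bool" where
  "spans_mod W U v n \<longleftrightarrow> (\<forall>u\<in>U. \<exists>c. (\<forall>i<n. c i \<in> carrier K) \<and> u \<ominus>\<^bsub>V\<^esub> lin_sum c v n \<in> W)"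

lemma indep_modD:
  "indep_mod W v n \<Longrightarrow> (\<And>i. i < n \<Longrightarrow> c i \<in> carrier K) \<Longrightarrow> lin_sum c v n \<in> W \<Longrightarrow> i < n \<Longrightarrow> c i = \<zero>\<^bsub>K\<^esub>"
  unfolding indep_mod_def by blast

lemma indep_mod_antimono: "indep_mod W v n \<Longrightarrow> W' \<subseteq> W \<Longrightarrow> indep_mod W' v n"
  unfolding indep_mod_def by blast

text \<open>If \<open>v\<close> has maximal length and \<open>u\<close> is appended to it, the resulting relation modulo \<open>W\<close> has a nonzero
coefficient at \<open>u\<close> and can be solved for \<open>u\<close>.\<close>

lemma maximal_indep_mod_spans:
  assumes W: "subspace K W V" and U: "U \<subseteq> carrier V"
    and bound: "\<forall>v n. indep_mod W v n \<longrightarrow> (\<forall>i<n. v i \<in> U) \<longrightarrow> n \<le> N"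
  shows "\<exists>v n. (\<forall>i<n. v i \<in> U) \<and> indep_mod W v n \<and> spans_mod W U v n"
proof -
  interpret W: submodule K W V using assms(1) by (simp add: subspace_def)
  define P where "P n \<longleftrightarrow> (\<exists>v. (\<forall>i<n. v i \<in> U) \<and> indep_mod W v n)" for n
  have "P 0" by (auto simp: P_def indep_mod_def)
  moreover have "\<And>n. P n \<Longrightarrow> n \<le> N" unfolding P_def using bound by blast
  ultimately obtain n where n: "P n" "\<And>m. P m \<Longrightarrow> m \<le> n"
    by (metis Nat.ex_has_greatest_nat)
  then obtain v where v: "\<forall>i<n. v i \<in> U" "indep_mod W v n" unfolding P_def by blast
  have "spans_mod W U v n"
    unfolding spans_mod_def
  proof
    fix u assume u: "u \<in> U"
    define w where "w = v(n := u)"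
    have wU: "\<forall>i<Suc n. w i \<in> U" using v u by (auto simp: w_def less_Suc_eq)
    have "\<not> P (Suc n)" using n(2)[of "Suc n"] by auto
    then have "\<not> indep_mod W w (Suc n)" using wU unfolding P_def by blast
    then obtain c i where c: "\<forall>i<Suc n. c i \<in> carrier K" "lin_sum c w (Suc n) \<in> W"
      and i: "i < Suc n" "c i \<noteq> \<zero>\<^bsub>K\<^esub>"
      using wU U unfolding indep_mod_def by blast
    have vc: "\<And>i. i < n \<Longrightarrow> v i \<in> carrier V" and uc: "u \<in> carrier V" using v u U by auto
    have e: "lin_sum c w (Suc n) = lin_sum c v n \<oplus>\<^bsub>V\<^esub> c n \<odot>\<^bsub>V\<^esub> u"
    proof -
      have "lin_sum c w n = lin_sum c v n"
        using c vc by (intro lin_sum_cong) (auto simp: w_def)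
      then show ?thesis using c wU U by (subst lin_sum_Suc) (auto simp: w_def)
    qed
    have cn: "c n \<noteq> \<zero>\<^bsub>K\<^esub>"
    proof
      assume "c n = \<zero>\<^bsub>K\<^esub>"
      then have "lin_sum c v n \<in> W" using e c vc uc by (simp add: lin_sum_closed)
      then have "\<forall>i<n. c i = \<zero>\<^bsub>K\<^esub>" using v(2) c unfolding indep_mod_def by auto
      then show False using i \<open>c n = _\<close> by (auto simp: less_Suc_eq)
    qed
    define a where "a = inv\<^bsub>K\<^esub> (c n)"
    have a: "a \<in> carrier K" "a \<otimes>\<^bsub>K\<^esub> c n = \<one>\<^bsub>K\<^esub>" using cn c field_Units by (auto simp: a_def)
    define d where "d i = (\<ominus>\<^bsub>K\<^esub> a) \<otimes>\<^bsub>K\<^esub> c i" for i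
    have "a \<odot>\<^bsub>V\<^esub> lin_sum c w (Suc n) = a \<odot>\<^bsub>V\<^esub> lin_sum c v n \<oplus>\<^bsub>V\<^esub> u"
      unfolding e using c a uc vc by (simp add: smult_r_distr lin_sum_closed smult_assoc1[symmetric])
    moreover have "lin_sum d v n = (\<ominus>\<^bsub>K\<^esub> a) \<odot>\<^bsub>V\<^esub> lin_sum c v n"
      unfolding d_def using c a vc by (intro lin_sum_smult) auto
    ultimately have "a \<odot>\<^bsub>V\<^esub> lin_sum c w (Suc n) = u \<ominus>\<^bsub>V\<^esub> lin_sum d v n"
      using c a uc vc by (simp add: smult_l_minus lin_sum_closed a_minus_def M.a_comm)
    moreover have "a \<odot>\<^bsub>V\<^esub> lin_sum c w (Suc n) \<in> W" using a c(2) by simp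
    ultimately show "\<exists>c. (\<forall>i<n. c i \<in> carrier K) \<and> u \<ominus>\<^bsub>V\<^esub> lin_sum c v n \<in> W"
      using c a by (intro exI[of _ d]) (auto simp: d_def)
  qed
  then show ?thesis using v by blast
qed

text \<open>The dimensions of the layers \<open>U k / U (k + 1)\<close> of a descending chain add up to at most the dimension of
\<open>U 0\<close>, because representatives of bases of all the layers form one independent family.\<close>

lemma chain_families:
  assumes sub: "\<And>k. k \<le> n \<Longrightarrow> subspace K (U k) V"
    and dec: "\<And>k. k < n \<Longrightarrow> U (Suc k) \<subseteq> U k"
    and bound: "\<forall>v r. indep_mod {\<zero>\<^bsub>V\<^esub>} v r \<longrightarrow> (\<forall>i<r. v i \<in> U 0) \<longrightarrow> r \<le> N"
  shows "\<exists>a v. (\<forall>k<n. (\<forall>i<a k. v k i \<in> U k) \<and> spans_mod (U (Suc k)) (U k) (v k) (a k)) \<and>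
    (\<Sum>k<n. a k) \<le> N"
proof -
  have zero: "\<zero>\<^bsub>V\<^esub> \<in> U k" and Uc: "U k \<subseteq> carrier V" if "k \<le> n" for k
    using sub[OF that] by (auto simp: subspace_def submodule_def)
  have U0: "U k \<subseteq> U 0" if "k \<le> n" for k using that
    by (induction k) (use dec in \<open>auto simp: Suc_le_eq\<close>)
  have "\<exists>r v. (\<forall>i<r. v i \<in> U k) \<and> indep_mod (U (Suc k)) v r \<and> spans_mod (U (Suc k)) (U k) v r" if k: "k < n" for k
  proof -
    have "\<forall>v r. indep_mod (U (Suc k)) v r \<longrightarrow> (\<forall>i<r. v i \<in> U k) \<longrightarrow> r \<le> N"
    proof (intro allI impI)
      fix v r assume "indep_mod (U (Suc k)) v r" "\<forall>i<r. v i \<in> U k"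
      then have "indep_mod {\<zero>\<^bsub>V\<^esub>} v r" "\<forall>i<r. v i \<in> U 0"
        using indep_mod_antimono[of "U (Suc k)" v r "{\<zero>\<^bsub>V\<^esub>}"] zero[of "Suc k"] U0[of k] k by auto
      then show "r \<le> N" using bound by blast
    qed
    moreover have "subspace K (U (Suc k)) V" "U k \<subseteq> carrier V" using sub[of "Suc k"] Uc[of k] k by auto
    ultimately show ?thesis using maximal_indep_mod_spans[of "U (Suc k)" "U k" N] by blast
  qed
  then obtain a v where av: "\<And>k. k < n \<Longrightarrow> (\<forall>i<a k. v k i \<in> U k) \<and> indep_mod (U (Suc k)) (v k) (a k)
      \<and> spans_mod (U (Suc k)) (U k) (v k) (a k)"
    by metis
  have "\<exists>w. (\<forall>i<(\<Sum>j<k. a j). w i \<in> U 0) \<and> indep_mod (U k) w (\<Sum>j<k. a j)" if "k \<le> n" for k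
    using that
  proof (induction k)
    case 0 then show ?case by (auto simp: indep_mod_def)
  next
    case (Suc k)
    define s where "s = (\<Sum>j<k. a j)"
    obtain w where w: "\<forall>i<s. w i \<in> U 0" "indep_mod (U k) w s" using Suc s_def by auto
    define w' where "w' i = (if i < s then w i else v k (i - s))" for i
    have vk: "\<forall>i<a k. v k i \<in> U k" "indep_mod (U (Suc k)) (v k) (a k)" using av[of k] Suc.prems by auto
    have w'U: "\<forall>i<s + a k. w' i \<in> U 0" using w vk U0[of k] Suc.prems by (auto simp: w'_def)
    have "indep_mod (U (Suc k)) w' (s + a k)"
      unfolding indep_mod_def
    proof (intro conjI impI allI)
      show "w' i \<in> carrier V" if "i < s + a k" for i using that w'U Uc[of 0] by auto
      fix c i assume c: "\<forall>i<s + a k. c i \<in> carrier K" and lin: "lin_sum c w' (s + a k) \<in> U (Suc k)" and i: "i < s + a k"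
      have wc: "\<And>i. i < s \<Longrightarrow> w i \<in> carrier V" "\<And>i. i < a k \<Longrightarrow> v k i \<in> carrier V"
        using w vk Uc[of 0] Uc[of k] Suc.prems by auto
      have "lin_sum c w' (s + a k) = lin_sum c w' s \<oplus>\<^bsub>V\<^esub> lin_sum (\<lambda>i. c (s + i)) (\<lambda>i. w' (s + i)) (a k)"
        using c w'U Uc[of 0] by (intro lin_sum_append) auto
      also have "lin_sum c w' s = lin_sum c w s" using c wc by (intro lin_sum_cong) (auto simp: w'_def)
      also have "(\<lambda>i. w' (s + i)) = v k" by (auto simp: w'_def)
      finally have e: "lin_sum c w' (s + a k) = lin_sum c w s \<oplus>\<^bsub>V\<^esub> lin_sum (\<lambda>i. c (s + i)) (v k) (a k)" .
      have m1: "lin_sum (\<lambda>i. c (s + i)) (v k) (a k) \<in> U k"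
        using c vk sub[of k] Suc.prems by (intro lin_sum_in_subspace) auto
      have "lin_sum c w s = lin_sum c w' (s + a k) \<ominus>\<^bsub>V\<^esub> lin_sum (\<lambda>i. c (s + i)) (v k) (a k)"
        unfolding e using c wc by (simp add: lin_sum_closed a_minus_def M.a_assoc M.r_neg)
      moreover have "\<dots> \<in> U k" using subspace_minus[OF sub[of k] _ m1] lin dec[of k] Suc.prems by auto
      ultimately have c1: "\<forall>i<s. c i = \<zero>\<^bsub>K\<^esub>" using w(2) c unfolding indep_mod_def by auto
      then have "lin_sum c w s = \<zero>\<^bsub>V\<^esub>" using wc by (intro lin_sum_zero) auto
      then have "lin_sum (\<lambda>i. c (s + i)) (v k) (a k) \<in> U (Suc k)" using e lin c wc by (simp add: lin_sum_closed)
      then have c2: "c (s + i) = \<zero>\<^bsub>K\<^esub>" if "i < a k" for i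
        using indep_modD[OF vk(2), of "\<lambda>i. c (s + i)" i] that c by auto
      show "c i = \<zero>\<^bsub>K\<^esub>"
      proof (cases "i < s")
        case False
        then show ?thesis using c2[of "i - s"] i by simp
      qed (use c1 in blast)
    qed
    then show ?case using w'U s_def by auto
  qed
  from this[of n] obtain w where w: "\<forall>i<(\<Sum>j<n. a j). w i \<in> U 0" "indep_mod (U n) w (\<Sum>j<n. a j)" by auto
  then have "(\<Sum>j<n. a j) \<le> N"
    using bound indep_mod_antimono[of "U n" w _ "{\<zero>\<^bsub>V\<^esub>}"] zero[of n] by auto
  then show ?thesis using av by blast
qed

lemma indep_mod_inj:
  assumes v: "indep_mod {\<zero>\<^bsub>V\<^esub>} v n"
  shows "inj_on v {..<n}"
proof (rule inj_onI, rule ccontr)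
  have vc: "\<And>i. i < n \<Longrightarrow> v i \<in> carrier V" using v by (auto simp: indep_mod_def)
  have ind: "\<And>c. (\<And>i. i < n \<Longrightarrow> c i \<in> carrier K) \<Longrightarrow> lin_sum c v n = \<zero>\<^bsub>V\<^esub> \<Longrightarrow> \<forall>i<n. c i = \<zero>\<^bsub>K\<^esub>"
    using v unfolding indep_mod_def by simp
  fix i j assume ij: "i \<in> {..<n}" "j \<in> {..<n}" "v i = v j" "i \<noteq> j"
  define c where "c k = (if k = i then \<one>\<^bsub>K\<^esub> else if k = j then \<ominus>\<^bsub>K\<^esub> \<one>\<^bsub>K\<^esub> else \<zero>\<^bsub>K\<^esub>)" for k
  have "lin_sum c v n = (\<Oplus>\<^bsub>V\<^esub>k\<in>insert i (insert j ({..<n} - {i,j})). c k \<odot>\<^bsub>V\<^esub> v k)"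
    unfolding lin_sum_def using ij by (intro arg_cong[where f = "finsum V _"]) auto
  also have "\<dots> = \<one>\<^bsub>K\<^esub> \<odot>\<^bsub>V\<^esub> v i \<oplus>\<^bsub>V\<^esub> ((\<ominus>\<^bsub>K\<^esub> \<one>\<^bsub>K\<^esub>) \<odot>\<^bsub>V\<^esub> v j \<oplus>\<^bsub>V\<^esub> (\<Oplus>\<^bsub>V\<^esub>k\<in>{..<n} - {i,j}. c k \<odot>\<^bsub>V\<^esub> v k))"
    using ij vc by (subst M.finsum_insert; (subst M.finsum_insert)?) (auto simp: c_def)
  also have "(\<Oplus>\<^bsub>V\<^esub>k\<in>{..<n} - {i,j}. c k \<odot>\<^bsub>V\<^esub> v k) = (\<Oplus>\<^bsub>V\<^esub>k\<in>{..<n} - {i,j}. \<zero>\<^bsub>V\<^esub>)"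
    using vc by (intro M.finsum_cong') (auto simp: c_def)
  also have "\<one>\<^bsub>K\<^esub> \<odot>\<^bsub>V\<^esub> v i \<oplus>\<^bsub>V\<^esub> ((\<ominus>\<^bsub>K\<^esub> \<one>\<^bsub>K\<^esub>) \<odot>\<^bsub>V\<^esub> v j \<oplus>\<^bsub>V\<^esub> (\<Oplus>\<^bsub>V\<^esub>k\<in>{..<n} - {i,j}. \<zero>\<^bsub>V\<^esub>)) = \<zero>\<^bsub>V\<^esub>"
    using ij vc by (simp add: smult_minus_1 M.r_neg)
  finally have "lin_sum c v n = \<zero>\<^bsub>V\<^esub>" .
  moreover have "\<And>k. c k \<in> carrier K" by (simp add: c_def)
  ultimately have "\<forall>i<n. c i = \<zero>\<^bsub>K\<^esub>" using ind[of c] by blast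
  then show False using ij by (auto simp: c_def)
qed

lemma indep_coefficients_unique:
  assumes e: "indep_mod {\<zero>\<^bsub>V\<^esub>} e h" and c: "\<And>j. j < h \<Longrightarrow> c j \<in> carrier K" and d: "\<And>j. j < h \<Longrightarrow> d j \<in> carrier K"
    and eq: "lin_sum c e h = lin_sum d e h" and j: "j < h"
  shows "c j = d j"
proof -
  have ec: "\<And>i. i < h \<Longrightarrow> e i \<in> carrier V" using e by (auto simp: indep_mod_def)
  have "lin_sum (\<lambda>j. c j \<oplus>\<^bsub>K\<^esub> (\<ominus>\<^bsub>K\<^esub> \<one>\<^bsub>K\<^esub>) \<otimes>\<^bsub>K\<^esub> d j) e h = lin_sum c e h \<oplus>\<^bsub>V\<^esub> lin_sum (\<lambda>j. (\<ominus>\<^bsub>K\<^esub> \<one>\<^bsub>K\<^esub>) \<otimes>\<^bsub>K\<^esub> d j) e h"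
    using c d ec by (intro lin_sum_add) auto
  also have "lin_sum (\<lambda>j. (\<ominus>\<^bsub>K\<^esub> \<one>\<^bsub>K\<^esub>) \<otimes>\<^bsub>K\<^esub> d j) e h = (\<ominus>\<^bsub>K\<^esub> \<one>\<^bsub>K\<^esub>) \<odot>\<^bsub>V\<^esub> lin_sum d e h"
    using d ec by (intro lin_sum_smult) auto
  also have "lin_sum c e h \<oplus>\<^bsub>V\<^esub> (\<ominus>\<^bsub>K\<^esub> \<one>\<^bsub>K\<^esub>) \<odot>\<^bsub>V\<^esub> lin_sum d e h = \<zero>\<^bsub>V\<^esub>"
    using d ec by (simp add: eq smult_minus_1 lin_sum_closed M.r_neg)
  finally have "c j \<oplus>\<^bsub>K\<^esub> (\<ominus>\<^bsub>K\<^esub> \<one>\<^bsub>K\<^esub>) \<otimes>\<^bsub>K\<^esub> d j = \<zero>\<^bsub>K\<^esub>"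
    using indep_modD[OF e, of "\<lambda>j. c j \<oplus>\<^bsub>K\<^esub> (\<ominus>\<^bsub>K\<^esub> \<one>\<^bsub>K\<^esub>) \<otimes>\<^bsub>K\<^esub> d j" j] c d j by simp
  then have "c j \<ominus>\<^bsub>K\<^esub> d j = \<zero>\<^bsub>K\<^esub>" using c[OF j] d[OF j] by (simp add: a_minus_def R.l_minus)
  then show ?thesis using c[OF j] d[OF j] by simp
qed

text \<open>A finite set of vectors has coordinates with respect to a maximal independent family in it.\<close>

lemma finite_set_coordinates:
  assumes Y: "finite Y" "Y \<subseteq> carrier V"
  shows "\<exists>e h. (\<forall>j<h. e j \<in> carrier V) \<and> indep_mod {\<zero>\<^bsub>V\<^esub>} e h \<and>
    (\<forall>y\<in>Y. \<exists>c. (\<forall>j<h. c j \<in> carrier K) \<and> y = lin_sum c e h)"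
proof -
  have z: "subspace K {\<zero>\<^bsub>V\<^esub>} V"
    by (simp add: subspace_def submodule_def vectorspace_axioms module_axioms)
  have "\<forall>v n. indep_mod {\<zero>\<^bsub>V\<^esub>} v n \<longrightarrow> (\<forall>i<n. v i \<in> Y) \<longrightarrow> n \<le> card Y"
  proof (intro allI impI)
    fix v n assume "indep_mod {\<zero>\<^bsub>V\<^esub>} v n" "\<forall>i<n. v i \<in> Y"
    then show "n \<le> card Y" using card_inj_on_le[OF indep_mod_inj, of v n Y] Y by auto
  qed
  then obtain e h where e: "\<forall>j<h. e j \<in> Y" "indep_mod {\<zero>\<^bsub>V\<^esub>} e h" "spans_mod {\<zero>\<^bsub>V\<^esub>} Y e h"
    using maximal_indep_mod_spans[OF z Y(2)] by blast
  have ec: "\<forall>j<h. e j \<in> carrier V" using e Y by auto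
  have "\<exists>c. (\<forall>j<h. c j \<in> carrier K) \<and> y = lin_sum c e h" if y: "y \<in> Y" for y
  proof -
    obtain c where c: "\<forall>j<h. c j \<in> carrier K" "y \<ominus>\<^bsub>V\<^esub> lin_sum c e h = \<zero>\<^bsub>V\<^esub>"
      using e(3) y unfolding spans_mod_def by blast
    have "lin_sum c e h \<in> carrier V" using c ec by (intro lin_sum_closed) auto
    then have "y = lin_sum c e h" using c(2) y Y(2) by (auto simp: subset_iff)
    then show ?thesis using c by blast
  qed
  then show ?thesis using e ec by blast
qed

end

text \<open>The link to the dimension of the library: the dimension of a finite-dimensional subspace is the
maximal length of an independent family in it.\<close>

context
  fixes K :: "'k ring" and V :: "('k, 'v) module"
  assumes vs: "vectorspace K V"
begin

interpretation vectorspace K V by (rule vs)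

lemma indep_card_le_dim:
  assumes W: "fin_dim_subspace K V W" and v: "\<And>i. i < n \<Longrightarrow> v i \<in> W" "indep_mod {\<zero>\<^bsub>V\<^esub>} v n"
  shows "n \<le> subspace_dim K V W"
proof -
  have sub: "subspace K W V" and fd: "vectorspace.fin_dim K (vs W)" using W by (auto simp: fin_dim_subspace_def)
  interpret W: vectorspace K "vs W" using subspace_is_vs[OF sub] .
  interpret Ws: submodule K W V using sub by (simp add: subspace_def)
  have vc: "\<And>i. i < n \<Longrightarrow> v i \<in> carrier V" using v Ws.subset by auto
  have ind: "\<And>c. (\<And>i. i < n \<Longrightarrow> c i \<in> carrier K) \<Longrightarrow> lin_sum c v n = \<zero>\<^bsub>V\<^esub> \<Longrightarrow> \<forall>i<n. c i = \<zero>\<^bsub>K\<^esub>"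
    using v(2) unfolding indep_mod_def by simp
  have inj: "inj_on v {..<n}" by (rule indep_mod_inj[OF v(2)])
  define A where "A = v ` {..<n}"
  have "lin_indpt A"
  proof (rule finite_lin_indpt2)
    fix a assume a: "a \<in> A \<rightarrow> carrier K" "lincomb a A = \<zero>\<^bsub>V\<^esub>"
    have "lincomb a A = lin_sum (\<lambda>i. a (v i)) v n"
      unfolding lincomb_def lin_sum_def A_def
      using inj a vc by (subst M.finsum_reindex) (auto simp: A_def)
    then have "\<forall>i<n. a (v i) = \<zero>\<^bsub>K\<^esub>" using ind[of "\<lambda>i. a (v i)"] a by (auto simp: A_def)
    then show "\<forall>x\<in>A. a x = \<zero>\<^bsub>K\<^esub>" by (auto simp: A_def)
  qed (use vc in \<open>auto simp: A_def\<close>)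
  moreover have AW: "A \<subseteq> W" using v by (auto simp: A_def)
  ultimately have "W.lin_indpt A" using span_li_not_depend(2)[OF AW is_module[OF sub]] by simp
  moreover have "A \<subseteq> carrier (vs W)" using AW by simp
  ultimately have "card A \<le> W.dim" using W.li_le_dim(2)[OF fd] by blast
  then show ?thesis using inj by (simp add: A_def card_image subspace_dim_def)
qed

lemma exists_indep_dim:
  assumes W: "fin_dim_subspace K V W"
  shows "\<exists>v. (\<forall>i<subspace_dim K V W. v i \<in> W) \<and> indep_mod {\<zero>\<^bsub>V\<^esub>} v (subspace_dim K V W) \<and>
    spans_mod {\<zero>\<^bsub>V\<^esub>} W v (subspace_dim K V W)"
proof -
  have sub: "subspace K W V" and fd: "vectorspace.fin_dim K (vs W)" using W by (auto simp: fin_dim_subspace_def)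
  interpret Ws: submodule K W V using sub by (simp add: subspace_def)
  have "module K V" by (rule module_axioms)
  have z: "subspace K {\<zero>\<^bsub>V\<^esub>} V"
    by (simp add: subspace_def submodule_def vectorspace_axioms module_axioms)
  have b: "\<forall>v n. indep_mod {\<zero>\<^bsub>V\<^esub>} v n \<longrightarrow> (\<forall>i<n. v i \<in> W) \<longrightarrow> n \<le> subspace_dim K V W"
    using indep_card_le_dim[OF W] by blast
  obtain v n where v: "\<forall>i<n. v i \<in> W" "indep_mod {\<zero>\<^bsub>V\<^esub>} v n" "spans_mod {\<zero>\<^bsub>V\<^esub>} W v n"
    using maximal_indep_mod_spans[OF z Ws.subset b] by blast
  have vc: "\<And>i. i < n \<Longrightarrow> v i \<in> carrier V" using v Ws.subset by auto
  interpret W: vectorspace K "vs W" using subspace_is_vs[OF sub] .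
  define A where "A = v ` {..<n}"
  have AW: "A \<subseteq> W" "finite A" using v by (auto simp: A_def)
  have "W \<subseteq> span A"
  proof
    fix u assume u: "u \<in> W"
    then obtain c where c: "\<forall>i<n. c i \<in> carrier K" "u \<ominus>\<^bsub>V\<^esub> lin_sum c v n = \<zero>\<^bsub>V\<^esub>"
      using v(3) unfolding spans_mod_def by auto
    then have "u = lin_sum c v n" using u Ws.subset vc by (auto simp: lin_sum_closed)
    moreover have "subspace K (span A) V" using span_is_subspace[of A] AW Ws.subset by auto
    moreover have "A \<subseteq> span A" using in_own_span AW Ws.subset by auto
    ultimately show "u \<in> span A"
      using lin_sum_in_subspace[of "span A" n c v] c(1) by (auto simp: A_def)
  qed
  moreover have "W.span A = span A" by (rule span_li_not_depend(1)[OF AW(1) is_module[OF sub]])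
  moreover have A': "A \<subseteq> carrier (vs W)" using AW by simp
  moreover have "W.span A \<subseteq> carrier (vs W)" by (rule W.span_is_subset2[OF A'])
  ultimately have "W.gen_set A" by (simp add: subset_antisym)
  then have "W.dim \<le> card A" by (rule W.gen_ge_dim[OF AW(2) A'])
  also have "\<dots> \<le> n" unfolding A_def by (metis card_image_le card_lessThan finite_lessThan)
  finally have "subspace_dim K V W \<le> n" by (simp add: subspace_dim_def)
  then have "n = subspace_dim K V W" using b v by (simp add: order_antisym)
  then show ?thesis using v by blast
qed

end

section \<open>Linear systems with polynomial coefficients\<close>

text \<open>The effect of one elimination step on a linear combination \<open>x\<close> of the rows of a matrix, where \<open>p\<close> is the pivot and \<open>q\<close> the
entry of the pivot row in the column under consideration.\<close>

lemma (in cring) finsum_eliminate: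
  assumes "p \<in> carrier R" "q \<in> carrier R"
    "\<And>a. a < (n::nat) \<Longrightarrow> x a \<in> carrier R" "\<And>a. a < n \<Longrightarrow> A a \<in> carrier R" "\<And>a. a < n \<Longrightarrow> B a \<in> carrier R"
  shows "(\<Oplus>a\<in>{..<n}. x a \<otimes> (p \<otimes> A a \<ominus> B a \<otimes> q)) =
    p \<otimes> (\<Oplus>a\<in>{..<n}. x a \<otimes> A a) \<ominus> (\<Oplus>a\<in>{..<n}. x a \<otimes> B a) \<otimes> q"
  using assms(3-)
proof (induction n)
  case 0
  then show ?case using assms(1,2) by (simp add: a_minus_def)
next
  case (Suc n)
  have c: "(\<Oplus>a\<in>{..<n}. x a \<otimes> A a) \<in> carrier R" "(\<Oplus>a\<in>{..<n}. x a \<otimes> B a) \<in> carrier R"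
    "x n \<in> carrier R" "A n \<in> carrier R" "B n \<in> carrier R"
    using Suc.prems by (auto intro!: finsum_closed)
  have s: "(\<Oplus>a\<in>{..<Suc n}. x a \<otimes> (p \<otimes> A a \<ominus> B a \<otimes> q)) =
      (\<Oplus>a\<in>{..<n}. x a \<otimes> (p \<otimes> A a \<ominus> B a \<otimes> q)) \<oplus> x n \<otimes> (p \<otimes> A n \<ominus> B n \<otimes> q)"
    "(\<Oplus>a\<in>{..<Suc n}. x a \<otimes> A a) = (\<Oplus>a\<in>{..<n}. x a \<otimes> A a) \<oplus> x n \<otimes> A n"
    "(\<Oplus>a\<in>{..<Suc n}. x a \<otimes> B a) = (\<Oplus>a\<in>{..<n}. x a \<otimes> B a) \<oplus> x n \<otimes> B n"
    using Suc.prems assms(1,2) by (intro finsum_lessThan_Suc; auto)+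
  have IH: "(\<Oplus>a\<in>{..<n}. x a \<otimes> (p \<otimes> A a \<ominus> B a \<otimes> q)) =
    p \<otimes> (\<Oplus>a\<in>{..<n}. x a \<otimes> A a) \<ominus> (\<Oplus>a\<in>{..<n}. x a \<otimes> B a) \<otimes> q"
    using Suc by auto
  have "\<And>u v. u \<in> carrier R \<Longrightarrow> v \<in> carrier R \<Longrightarrow>
      (p \<otimes> u \<ominus> v \<otimes> q) \<oplus> x n \<otimes> (p \<otimes> A n \<ominus> B n \<otimes> q) = p \<otimes> (u \<oplus> x n \<otimes> A n) \<ominus> (v \<oplus> x n \<otimes> B n) \<otimes> q"
    using c(3-) assms(1,2) by algebra
  then show ?case unfolding s IH using c(1,2) by blast
qed

text \<open>A linear system over a domain \<open>P\<close>, such as a polynomial ring, has a solution up to a nonzero factor if infinitely many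
specializations of it are solvable. In other words, the system is solvable over the field of fractions
of \<open>P\<close>, because the rank of the augmented matrix drops at finitely many specializations only. The proof
avoids ranks and fractions. It eliminates the last unknown with a nonzero coefficient \<open>p\<close> of it as pivot. A solution \<open>x\<close> of a
specialized system, without its last entry, solves the specialized reduced system, even where \<open>p\<close> specializes to zero.\<close>

lemma generic_solution:
  fixes P :: "('p, 'x) ring_scheme" (structure) and K :: "('k, 'y) ring_scheme" and ev :: "'t \<Rightarrow> 'p \<Rightarrow> 'k"
  assumes P: "domain P" and K: "cring K"
    and hom: "\<And>t. t \<in> S \<Longrightarrow> ev t \<in> ring_hom P K"
    and fin: "\<And>p. p \<in> carrier P \<Longrightarrow> p \<noteq> \<zero> \<Longrightarrow> finite {t \<in> S. ev t p = \<zero>\<^bsub>K\<^esub>}"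
    and inf: "infinite S"
    and v: "\<And>a j. a < r \<Longrightarrow> j < h \<Longrightarrow> v a j \<in> carrier P"
    and w: "\<And>j. j < (h::nat) \<Longrightarrow> w j \<in> carrier P"
    and sol: "\<And>t. t \<in> S \<Longrightarrow> \<exists>x. (\<forall>a<(r::nat). x a \<in> carrier K) \<and>
       (\<forall>j<h. (\<Oplus>\<^bsub>K\<^esub>a\<in>{..<r}. x a \<otimes>\<^bsub>K\<^esub> ev t (v a j)) = ev t (w j))"
  shows "\<exists>b c. b \<in> carrier P \<and> b \<noteq> \<zero> \<and> (\<forall>a<r. c a \<in> carrier P) \<and>
      (\<forall>j<h. (\<Oplus>a\<in>{..<r}. c a \<otimes> v a j) = b \<otimes> w j)"
proof -
  interpret P: domain P by fact
  interpret K: cring K by fact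
  show ?thesis
    using v w sol
  proof (induction r arbitrary: v w)
    case 0
    have "w j = \<zero>" if "j < h" for j
    proof (rule ccontr)
      assume "w j \<noteq> \<zero>"
      then have "finite {t \<in> S. ev t (w j) = \<zero>\<^bsub>K\<^esub>}" using fin 0(2) that by blast
      moreover have "{t \<in> S. ev t (w j) = \<zero>\<^bsub>K\<^esub>} = S" using 0(3) that by fastforce
      ultimately show False using inf by simp
    qed
    then show ?case by (intro exI[of _ "\<one>"]) auto
  next
    case (Suc r)
    have vr: "v a j \<in> carrier P" if "a < Suc r" "j < h" for a j using Suc.prems that by blast
    show ?case
    proof (cases "\<forall>j<h. v r j = \<zero>")
      case True
      have "\<exists>x. (\<forall>a<r. x a \<in> carrier K) \<and>
        (\<forall>j<h. (\<Oplus>\<^bsub>K\<^esub>a\<in>{..<r}. x a \<otimes>\<^bsub>K\<^esub> ev t (v a j)) = ev t (w j))" if t: "t \<in> S" for t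
      proof -
        interpret E: ring_hom_ring P K "ev t"
          using hom[OF t] P.ring_axioms K.ring_axioms by (simp add: ring_hom_ringI2)
        obtain x where x: "\<forall>a<Suc r. x a \<in> carrier K"
          "\<forall>j<h. (\<Oplus>\<^bsub>K\<^esub>a\<in>{..<Suc r}. x a \<otimes>\<^bsub>K\<^esub> ev t (v a j)) = ev t (w j)"
          using Suc.prems(3)[OF t] by blast
        have "(\<Oplus>\<^bsub>K\<^esub>a\<in>{..<Suc r}. x a \<otimes>\<^bsub>K\<^esub> ev t (v a j)) = (\<Oplus>\<^bsub>K\<^esub>a\<in>{..<r}. x a \<otimes>\<^bsub>K\<^esub> ev t (v a j))"
          if j: "j < h" for j
        proof -
          have "(\<Oplus>\<^bsub>K\<^esub>a\<in>{..<Suc r}. x a \<otimes>\<^bsub>K\<^esub> ev t (v a j)) = (\<Oplus>\<^bsub>K\<^esub>a\<in>{..<r}. x a \<otimes>\<^bsub>K\<^esub> ev t (v a j)) \<oplus>\<^bsub>K\<^esub> x r \<otimes>\<^bsub>K\<^esub> ev t (v r j)"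
            using x vr j by (intro K.finsum_lessThan_Suc) auto
          also have "\<dots> = (\<Oplus>\<^bsub>K\<^esub>a\<in>{..<r}. x a \<otimes>\<^bsub>K\<^esub> ev t (v a j))"
            using x True j vr by (auto intro!: K.r_zero K.finsum_closed)
          finally show ?thesis .
        qed
        then show ?thesis using x by (intro exI[of _ x]) auto
      qed
      then obtain b c where bc: "b \<in> carrier P" "b \<noteq> \<zero>" "\<forall>a<r. c a \<in> carrier P"
        "\<forall>j<h. (\<Oplus>a\<in>{..<r}. c a \<otimes> v a j) = b \<otimes> w j"
        using Suc.IH[of v w] Suc.prems by auto
      define d where "d = c(r := \<zero>)"
      have dc: "\<forall>a<Suc r. d a \<in> carrier P" using bc by (auto simp: d_def less_Suc_eq)
      have "(\<Oplus>a\<in>{..<Suc r}. d a \<otimes> v a j) = b \<otimes> w j" if j: "j < h" for j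
      proof -
        have "(\<Oplus>a\<in>{..<Suc r}. d a \<otimes> v a j) = (\<Oplus>a\<in>{..<r}. d a \<otimes> v a j) \<oplus> d r \<otimes> v r j"
          using dc vr j by (intro P.finsum_lessThan_Suc) auto
        also have "(\<Oplus>a\<in>{..<r}. d a \<otimes> v a j) = (\<Oplus>a\<in>{..<r}. c a \<otimes> v a j)"
          using bc vr j by (intro P.finsum_cong') (auto simp: d_def)
        finally show ?thesis using bc vr[of r j] j Suc.prems(2) by (simp add: d_def)
      qed
      then show ?thesis using bc dc by blast
    next
      case False
      then obtain j0 where j0: "j0 < h" "v r j0 \<noteq> \<zero>" by blast
      define p where "p = v r j0"
      have p: "p \<in> carrier P" "p \<noteq> \<zero>" using j0 vr by (auto simp: p_def)
      define v' where "v' a j = p \<otimes> v a j \<ominus> v a j0 \<otimes> v r j" for a j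
      define w' where "w' j = p \<otimes> w j \<ominus> w j0 \<otimes> v r j" for j
      have "\<exists>x. (\<forall>a<r. x a \<in> carrier K) \<and>
        (\<forall>j<h. (\<Oplus>\<^bsub>K\<^esub>a\<in>{..<r}. x a \<otimes>\<^bsub>K\<^esub> ev t (v' a j)) = ev t (w' j))" if t: "t \<in> S" for t
      proof -
        interpret E: ring_hom_ring P K "ev t"
          using hom[OF t] P.ring_axioms K.ring_axioms by (simp add: ring_hom_ringI2)
        obtain x where x: "\<forall>a<Suc r. x a \<in> carrier K"
          "\<forall>j<h. (\<Oplus>\<^bsub>K\<^esub>a\<in>{..<Suc r}. x a \<otimes>\<^bsub>K\<^esub> ev t (v a j)) = ev t (w j)"
          using Suc.prems(3)[OF t] by blast
        define s where "s j = (\<Oplus>\<^bsub>K\<^esub>a\<in>{..<r}. x a \<otimes>\<^bsub>K\<^esub> ev t (v a j))" for j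
        have sc: "s j \<in> carrier K" if "j < h" for j
          unfolding s_def using x vr that by (auto intro!: K.finsum_closed)
        have ws: "ev t (w j) = s j \<oplus>\<^bsub>K\<^esub> x r \<otimes>\<^bsub>K\<^esub> ev t (v r j)" if j: "j < h" for j
          unfolding s_def x(2)[rule_format, OF j, symmetric]
          using x vr j by (intro K.finsum_lessThan_Suc) auto
        have "(\<Oplus>\<^bsub>K\<^esub>a\<in>{..<r}. x a \<otimes>\<^bsub>K\<^esub> ev t (v' a j)) = ev t (w' j)" if j: "j < h" for j
        proof -
          have "(\<Oplus>\<^bsub>K\<^esub>a\<in>{..<r}. x a \<otimes>\<^bsub>K\<^esub> ev t (v' a j)) =
            (\<Oplus>\<^bsub>K\<^esub>a\<in>{..<r}. x a \<otimes>\<^bsub>K\<^esub> (ev t p \<otimes>\<^bsub>K\<^esub> ev t (v a j) \<ominus>\<^bsub>K\<^esub> ev t (v a j0) \<otimes>\<^bsub>K\<^esub> ev t (v r j)))"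
            using x vr j j0(1) p by (intro K.finsum_cong') (auto simp: v'_def a_minus_def)
          also have "\<dots> = ev t p \<otimes>\<^bsub>K\<^esub> s j \<ominus>\<^bsub>K\<^esub> s j0 \<otimes>\<^bsub>K\<^esub> ev t (v r j)"
            unfolding s_def using x vr j j0(1) p by (intro K.finsum_eliminate) auto
          also have "\<dots> = ev t p \<otimes>\<^bsub>K\<^esub> ev t (w j) \<ominus>\<^bsub>K\<^esub> ev t (w j0) \<otimes>\<^bsub>K\<^esub> ev t (v r j)"
          proof -
            have c: "s j \<in> carrier K" "s j0 \<in> carrier K" "x r \<in> carrier K" "ev t (v r j) \<in> carrier K" "ev t p \<in> carrier K"
              using sc j j0(1) x vr p by auto
            show ?thesis unfolding ws[OF j] ws[OF j0(1)] p_def[symmetric] using c by algebra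
          qed
          also have "\<dots> = ev t (w' j)" using p Suc.prems(2) vr j j0(1) by (simp add: w'_def a_minus_def)
          finally show ?thesis .
        qed
        then show ?thesis using x by (intro exI[of _ x]) auto
      qed
      then obtain b c where bc: "b \<in> carrier P" "b \<noteq> \<zero>" "\<forall>a<r. c a \<in> carrier P"
        "\<forall>j<h. (\<Oplus>a\<in>{..<r}. c a \<otimes> v' a j) = b \<otimes> w' j"
        using Suc.IH[of v' w'] Suc.prems(2) vr p j0(1) by (force simp: v'_def w'_def)
      define s where "s j = (\<Oplus>a\<in>{..<r}. c a \<otimes> v a j)" for j
      have sc: "s j \<in> carrier P" if "j < h" for j
        unfolding s_def using bc vr that by (auto intro!: P.finsum_closed)
      define d where "d a = (if a = r then b \<otimes> w j0 \<ominus> s j0 else p \<otimes> c a)" for a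
      have dc: "\<forall>a<Suc r. d a \<in> carrier P" using bc p sc j0 Suc.prems(2) by (auto simp: d_def less_Suc_eq)
      have "(\<Oplus>a\<in>{..<Suc r}. d a \<otimes> v a j) = (b \<otimes> p) \<otimes> w j" if j: "j < h" for j
      proof -
        have "(\<Oplus>a\<in>{..<Suc r}. d a \<otimes> v a j) = (\<Oplus>a\<in>{..<r}. d a \<otimes> v a j) \<oplus> d r \<otimes> v r j"
          using dc vr j by (intro P.finsum_lessThan_Suc) auto
        also have "(\<Oplus>a\<in>{..<r}. d a \<otimes> v a j) = (\<Oplus>a\<in>{..<r}. p \<otimes> (c a \<otimes> v a j))"
          using bc vr j p by (intro P.finsum_cong') (auto simp: d_def P.m_assoc)
        also have "\<dots> = p \<otimes> s j"
          unfolding s_def using p bc vr j by (intro P.finsum_rdistr[symmetric]) auto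
        finally have e1: "(\<Oplus>a\<in>{..<Suc r}. d a \<otimes> v a j) = p \<otimes> s j \<oplus> (b \<otimes> w j0 \<ominus> s j0) \<otimes> v r j"
          by (simp add: d_def)
        have "p \<otimes> s j \<ominus> s j0 \<otimes> v r j = (\<Oplus>a\<in>{..<r}. c a \<otimes> v' a j)"
          unfolding s_def v'_def using bc vr j j0(1) p by (intro P.finsum_eliminate[symmetric]) auto
        also have "\<dots> = b \<otimes> (p \<otimes> w j \<ominus> w j0 \<otimes> v r j)" using bc(4) j by (simp add: w'_def)
        finally have e2: "p \<otimes> s j \<ominus> s j0 \<otimes> v r j = b \<otimes> (p \<otimes> w j \<ominus> w j0 \<otimes> v r j)" .
        have c: "s j \<in> carrier P" "s j0 \<in> carrier P" "w j \<in> carrier P" "w j0 \<in> carrier P" "v r j \<in> carrier P" "b \<in> carrier P"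
          using sc j j0(1) vr Suc.prems(2) bc by auto
        have "p \<otimes> s j \<oplus> (b \<otimes> w j0 \<ominus> s j0) \<otimes> v r j =
          (p \<otimes> s j \<ominus> s j0 \<otimes> v r j) \<oplus> b \<otimes> w j0 \<otimes> v r j" using c p(1) by algebra
        also have "\<dots> = (b \<otimes> p) \<otimes> w j" unfolding e2 using c p(1) by algebra
        finally show ?thesis using e1 by simp
      qed
      moreover have "b \<otimes> p \<noteq> \<zero>" "b \<otimes> p \<in> carrier P" using bc p by (auto simp: P.integral_iff)
      ultimately show ?thesis using dc by blast
    qed
  qed
qed

text \<open>A root splits off a linear factor, which lowers the degree.\<close>

lemma (in UP_domain) finite_roots:
  assumes "p \<in> carrier P" "p \<noteq> \<zero>\<^bsub>P\<^esub>"
  shows "finite {a \<in> carrier R. eval R R id a p = \<zero>}"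
  using assms
proof (induction "deg R p" arbitrary: p rule: less_induct)
  case less
  have R_not_triv: "carrier R \<noteq> {\<zero>}" by (metis R.one_zeroI R.zero_not_one)
  show ?case
  proof (cases "\<exists>a \<in> carrier R. eval R R id a p = \<zero>")
    case True
    then obtain a where a: "a \<in> carrier R" "eval R R id a p = \<zero>" by blast
    let ?l = "monom P \<one> 1 \<ominus>\<^bsub>P\<^esub> monom P a 0"
    obtain q r where q: "q \<in> carrier P" "p = ?l \<otimes>\<^bsub>P\<^esub> q \<oplus>\<^bsub>P\<^esub> monom P (eval R R id a p) 0"
      using remainder_theorem[OF less.prems(1) a(1) R_not_triv] by auto
    have p: "p = ?l \<otimes>\<^bsub>P\<^esub> q" using q a by (simp add: P.m_closed)
    have l: "?l \<in> carrier P" "deg R ?l = 1" using a deg_minus_monom[OF a(1) R_not_triv] by auto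
    have ln: "?l \<noteq> \<zero>\<^bsub>P\<^esub>" using l(2) deg_zero by fastforce
    have qn: "q \<noteq> \<zero>\<^bsub>P\<^esub>" using less.prems p l by auto
    have "deg R p = 1 + deg R q" using deg_mult[OF ln qn l(1) q(1)] p l by simp
    then have IH: "finite {a \<in> carrier R. eval R R id a q = \<zero>}" using less.hyps[of q] q qn by simp
    have "x = a \<or> eval R R id x q = \<zero>" if x: "x \<in> carrier R" "eval R R id x p = \<zero>" for x
    proof -
      interpret E: UP_univ_prop R R id P x "eval R R id x"
        using x R_cring by unfold_locales (auto simp: P_def intro: id_ring_hom)
      have "eval R R id x ?l = x \<ominus> a"
        using x a E.eval_monom1[of x] E.eval_const[of x a] by (simp add: a_minus_def)
      then have "(x \<ominus> a) \<otimes> eval R R id x q = \<zero>" using x(2) p q l E.hom_mult[OF l(1) q(1)] by simp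
      then have "x \<ominus> a = \<zero> \<or> eval R R id x q = \<zero>" using x a q by (intro R.integral) auto
      then show ?thesis using x a by auto
    qed
    then have "{a \<in> carrier R. eval R R id a p = \<zero>} \<subseteq> insert a {a \<in> carrier R. eval R R id a q = \<zero>}" by auto
    then show ?thesis using IH finite_subset by blast
  next
    case False
    then have "{a \<in> carrier R. eval R R id a p = \<zero>} = {}" by blast
    then show ?thesis by (metis finite.emptyI)
  qed
qed

section \<open>Rings of differential operators\<close>

locale k_algebra =
  fixes K :: "'k ring" and R :: "('k, 'r) module" (structure)
  assumes algebra: "algebra K R"

sublocale k_algebra \<subseteq> K: cring K
  using algebra by (simp add: algebra_def module_def)

sublocale k_algebra \<subseteq> R: cring R
  using algebra by (simp add: algebra_def)

sublocale k_algebra \<subseteq> V: module K R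
  using algebra by (simp add: algebra_def)

context k_algebra
begin

lemma smult_assoc2:
  "c \<in> carrier K \<Longrightarrow> x \<in> carrier R \<Longrightarrow> y \<in> carrier R \<Longrightarrow> (c \<odot> x) \<otimes> y = c \<odot> (x \<otimes> y)"
  using algebra by (simp add: algebra_def algebra_axioms_def)

lemma smult_assoc3:
  "c \<in> carrier K \<Longrightarrow> x \<in> carrier R \<Longrightarrow> y \<in> carrier R \<Longrightarrow> x \<otimes> (c \<odot> y) = c \<odot> (x \<otimes> y)"
  by (metis smult_assoc2 R.m_comm V.smult_closed)

abbreviation E where "E \<equiv> End_algebra K R"
abbreviation D where "D \<equiv> diff_ops K R"
abbreviation Dn where "Dn \<equiv> diff_ops_upto K R"
abbreviation lm where "lm \<equiv> mult_op R"

text \<open>Operators are extensional functions, so that an identity between operators can be proved pointwise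
(\<open>E_eqI\<close> below), where it becomes an identity in the commutative ring \<open>R\<close>.\<close>

lemma E_iff:
  "\<phi> \<in> carrier E \<longleftrightarrow> \<phi> \<in> extensional (carrier R) \<and> (\<forall>x\<in>carrier R. \<phi> x \<in> carrier R) \<and>
    (\<forall>x\<in>carrier R. \<forall>y\<in>carrier R. \<phi> (x \<oplus> y) = \<phi> x \<oplus> \<phi> y) \<and>
    (\<forall>c\<in>carrier K. \<forall>x\<in>carrier R. \<phi> (c \<odot> x) = c \<odot> \<phi> x)"
  by (auto simp: End_algebra_def module_hom_def)

lemma E_closed [simp]: "\<phi> \<in> carrier E \<Longrightarrow> x \<in> carrier R \<Longrightarrow> \<phi> x \<in> carrier R"
  and E_add: "\<phi> \<in> carrier E \<Longrightarrow> x \<in> carrier R \<Longrightarrow> y \<in> carrier R \<Longrightarrow> \<phi> (x \<oplus> y) = \<phi> x \<oplus> \<phi> y"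
  and E_smult: "\<phi> \<in> carrier E \<Longrightarrow> c \<in> carrier K \<Longrightarrow> x \<in> carrier R \<Longrightarrow> \<phi> (c \<odot> x) = c \<odot> \<phi> x"
  and E_ext: "\<phi> \<in> carrier E \<Longrightarrow> \<phi> \<in> extensional (carrier R)"
  by (auto simp: E_iff)

lemma E_eqI: "\<phi> \<in> carrier E \<Longrightarrow> \<psi> \<in> carrier E \<Longrightarrow> (\<And>x. x \<in> carrier R \<Longrightarrow> \<phi> x = \<psi> x) \<Longrightarrow> \<phi> = \<psi>"
  by (meson E_ext extensionalityI)

lemma E_zero: "\<phi> \<in> carrier E \<Longrightarrow> \<phi> \<zero> = \<zero>"
  by (metis E_add E_closed R.add.l_cancel_one R.r_zero R.zero_closed)

lemma E_uminus: "\<phi> \<in> carrier E \<Longrightarrow> x \<in> carrier R \<Longrightarrow> \<phi> (\<ominus> x) = \<ominus> \<phi> x"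
  by (metis E_add E_closed E_zero R.a_inv_closed R.l_neg R.minus_equality)

lemma E_minus: "\<phi> \<in> carrier E \<Longrightarrow> x \<in> carrier R \<Longrightarrow> y \<in> carrier R \<Longrightarrow> \<phi> (x \<ominus> y) = \<phi> x \<ominus> \<phi> y"
  by (simp add: a_minus_def E_add E_uminus)

lemma app_mult [simp]: "x \<in> carrier R \<Longrightarrow> (\<phi> \<otimes>\<^bsub>E\<^esub> \<psi>) x = \<phi> (\<psi> x)"
  and app_one [simp]: "x \<in> carrier R \<Longrightarrow> \<one>\<^bsub>E\<^esub> x = x"
  and app_zero [simp]: "x \<in> carrier R \<Longrightarrow> \<zero>\<^bsub>E\<^esub> x = \<zero>"
  and app_add [simp]: "x \<in> carrier R \<Longrightarrow> (\<phi> \<oplus>\<^bsub>E\<^esub> \<psi>) x = \<phi> x \<oplus> \<psi> x"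
  and app_smult [simp]: "x \<in> carrier R \<Longrightarrow> (c \<odot>\<^bsub>E\<^esub> \<phi>) x = c \<odot> \<phi> x"
  and app_lm [simp]: "x \<in> carrier R \<Longrightarrow> lm r x = r \<otimes> x"
  by (auto simp: End_algebra_def compose_def mult_op_def)

lemma E_mult_closed: "\<phi> \<in> carrier E \<Longrightarrow> \<psi> \<in> carrier E \<Longrightarrow> \<phi> \<otimes>\<^bsub>E\<^esub> \<psi> \<in> carrier E"
  unfolding E_iff[of "\<phi> \<otimes>\<^bsub>E\<^esub> \<psi>"]
  by (auto simp: E_add E_smult) (auto simp: End_algebra_def)

lemma E_one_closed: "\<one>\<^bsub>E\<^esub> \<in> carrier E"
  unfolding E_iff by (auto) (auto simp: End_algebra_def)

lemma E_zero_closed: "\<zero>\<^bsub>E\<^esub> \<in> carrier E"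
  unfolding E_iff by (auto) (auto simp: End_algebra_def)

lemma E_add_closed: "\<phi> \<in> carrier E \<Longrightarrow> \<psi> \<in> carrier E \<Longrightarrow> \<phi> \<oplus>\<^bsub>E\<^esub> \<psi> \<in> carrier E"
  unfolding E_iff[of "\<phi> \<oplus>\<^bsub>E\<^esub> \<psi>"]
  by (auto simp: E_add E_smult R.a_ac V.smult_r_distr) (auto simp: End_algebra_def)

lemma E_smult_closed: "c \<in> carrier K \<Longrightarrow> \<phi> \<in> carrier E \<Longrightarrow> c \<odot>\<^bsub>E\<^esub> \<phi> \<in> carrier E"
  unfolding E_iff[of "c \<odot>\<^bsub>E\<^esub> \<phi>"]
  by (auto simp: E_add E_smult V.smult_r_distr V.smult_assoc1[symmetric] K.m_comm) (auto simp: End_algebra_def)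

lemma lm_in_E: "r \<in> carrier R \<Longrightarrow> lm r \<in> carrier E"
  unfolding E_iff by (auto simp: R.r_distr smult_assoc3) (auto simp: mult_op_def)

lemma E_abelian_group: "abelian_group E"
proof (rule abelian_groupI)
  fix \<phi> assume p: "\<phi> \<in> carrier E"
  have c: "\<ominus>\<^bsub>K\<^esub> \<one>\<^bsub>K\<^esub> \<in> carrier K" by simp
  have "((\<ominus>\<^bsub>K\<^esub> \<one>\<^bsub>K\<^esub>) \<odot>\<^bsub>E\<^esub> \<phi>) \<oplus>\<^bsub>E\<^esub> \<phi> = \<zero>\<^bsub>E\<^esub>"
    by (rule E_eqI) (use p c in \<open>auto simp: E_add_closed E_smult_closed E_zero_closed V.smult_l_minus R.l_neg\<close>)
  then show "\<exists>\<psi>\<in>carrier E. \<psi> \<oplus>\<^bsub>E\<^esub> \<phi> = \<zero>\<^bsub>E\<^esub>" using p c E_smult_closed by blast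
qed (auto intro!: E_eqI simp: E_add_closed E_zero_closed R.a_ac)

lemma E_ring: "ring E"
proof (rule ringI)
  show "abelian_group E" by (rule E_abelian_group)
  show "monoid E"
    by (rule monoidI) (auto intro!: E_eqI simp: E_mult_closed E_one_closed)
qed (auto intro!: E_eqI simp: E_mult_closed E_add_closed E_add)

lemma E_module: "module K E"
  by (rule moduleI)
     (auto intro!: E_eqI simp: E_abelian_group K.is_cring E_smult_closed E_add_closed V.smult_l_distr V.smult_r_distr V.smult_assoc1)

sublocale E: ring E by (rule E_ring)

sublocale EM: module K E by (rule E_module)

lemma app_uminus [simp]: "\<phi> \<in> carrier E \<Longrightarrow> x \<in> carrier R \<Longrightarrow> (\<ominus>\<^bsub>E\<^esub> \<phi>) x = \<ominus> \<phi> x"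
  by (metis E.a_inv_closed E.l_neg E_closed R.minus_equality app_add app_zero)

lemma app_minus [simp]: "\<phi> \<in> carrier E \<Longrightarrow> \<psi> \<in> carrier E \<Longrightarrow> x \<in> carrier R \<Longrightarrow> (\<phi> \<ominus>\<^bsub>E\<^esub> \<psi>) x = \<phi> x \<ominus> \<psi> x"
  by (simp add: a_minus_def)

abbreviation ad where "ad r \<phi> \<equiv> commutator E \<phi> (lm r)"

lemma ad_in_E: "\<phi> \<in> carrier E \<Longrightarrow> r \<in> carrier R \<Longrightarrow> ad r \<phi> \<in> carrier E"
  by (simp add: commutator_def lm_in_E)

lemma app_ad [simp]:
  "\<phi> \<in> carrier E \<Longrightarrow> r \<in> carrier R \<Longrightarrow> x \<in> carrier R \<Longrightarrow> ad r \<phi> x = \<phi> (r \<otimes> x) \<ominus> r \<otimes> \<phi> x"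
  by (simp add: commutator_def lm_in_E)

lemma Dn_E: "\<phi> \<in> Dn n \<Longrightarrow> \<phi> \<in> carrier E"
  by (cases n) (auto simp: lm_in_E)

lemma Dn_Suc_iff: "\<phi> \<in> Dn (Suc n) \<longleftrightarrow> \<phi> \<in> carrier E \<and> (\<forall>r\<in>carrier R. ad r \<phi> \<in> Dn n)"
  by simp

declare diff_ops_upto.simps(2) [simp del]

lemma ad_zeroth: "\<phi> \<in> Dn 0 \<Longrightarrow> r \<in> carrier R \<Longrightarrow> ad r \<phi> = \<zero>\<^bsub>E\<^esub>"
proof (rule E_eqI)
  fix x assume "\<phi> \<in> Dn 0" "r \<in> carrier R" and x: "x \<in> carrier R"
  then obtain a where a: "a \<in> carrier R" "\<phi> = lm a" and r: "r \<in> carrier R" by auto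
  show "ad r \<phi> x = \<zero>\<^bsub>E\<^esub> x"
    using a r x by (simp add: lm_in_E R.m_lcomm)
qed (auto simp: lm_in_E intro!: ad_in_E E_zero_closed)

lemma lm_add: "r \<in> carrier R \<Longrightarrow> s \<in> carrier R \<Longrightarrow> lm r \<oplus>\<^bsub>E\<^esub> lm s = lm (r \<oplus> s)"
  by (rule E_eqI) (auto simp: lm_in_E R.l_distr)

lemma lm_zero: "lm \<zero> = \<zero>\<^bsub>E\<^esub>"
  by (rule E_eqI) (auto simp: lm_in_E)

lemma lm_mult: "r \<in> carrier R \<Longrightarrow> s \<in> carrier R \<Longrightarrow> lm r \<otimes>\<^bsub>E\<^esub> lm s = lm (r \<otimes> s)"
  by (rule E_eqI) (auto simp: lm_in_E R.m_assoc)

lemma lm_smult: "r \<in> carrier R \<Longrightarrow> c \<in> carrier K \<Longrightarrow> c \<odot>\<^bsub>E\<^esub> lm r = lm (c \<odot> r)"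
  by (rule E_eqI) (auto simp: lm_in_E smult_assoc2)

lemma lm_one: "lm \<one> = \<one>\<^bsub>E\<^esub>"
  by (rule E_eqI) (auto simp: lm_in_E)

lemma ad_add: "\<phi> \<in> carrier E \<Longrightarrow> \<psi> \<in> carrier E \<Longrightarrow> r \<in> carrier R \<Longrightarrow> ad r (\<phi> \<oplus>\<^bsub>E\<^esub> \<psi>) = ad r \<phi> \<oplus>\<^bsub>E\<^esub> ad r \<psi>"
proof (rule E_eqI)
  fix x assume a: "\<phi> \<in> carrier E" "\<psi> \<in> carrier E" "r \<in> carrier R" "x \<in> carrier R"
  have c: "\<phi> (r \<otimes> x) \<in> carrier R" "\<psi> (r \<otimes> x) \<in> carrier R" "\<phi> x \<in> carrier R" "\<psi> x \<in> carrier R" using a by auto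
  have "(\<phi> (r \<otimes> x) \<oplus> \<psi> (r \<otimes> x)) \<ominus> r \<otimes> (\<phi> x \<oplus> \<psi> x) =
    (\<phi> (r \<otimes> x) \<ominus> r \<otimes> \<phi> x) \<oplus> (\<psi> (r \<otimes> x) \<ominus> r \<otimes> \<psi> x)"
    using c a(3) by algebra
  then show "ad r (\<phi> \<oplus>\<^bsub>E\<^esub> \<psi>) x = (ad r \<phi> \<oplus>\<^bsub>E\<^esub> ad r \<psi>) x" using a by simp
qed (auto intro!: ad_in_E)

lemma ad_smult: "\<phi> \<in> carrier E \<Longrightarrow> c \<in> carrier K \<Longrightarrow> r \<in> carrier R \<Longrightarrow> ad r (c \<odot>\<^bsub>E\<^esub> \<phi>) = c \<odot>\<^bsub>E\<^esub> ad r \<phi>"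
proof (rule E_eqI)
  fix x assume a: "\<phi> \<in> carrier E" "c \<in> carrier K" "r \<in> carrier R" "x \<in> carrier R"
  show "ad r (c \<odot>\<^bsub>E\<^esub> \<phi>) x = (c \<odot>\<^bsub>E\<^esub> ad r \<phi>) x"
    using a by (simp add: a_minus_def V.smult_r_distr V.smult_r_minus smult_assoc3)
qed (auto intro!: ad_in_E)

lemma ad_mult: "\<phi> \<in> carrier E \<Longrightarrow> \<psi> \<in> carrier E \<Longrightarrow> r \<in> carrier R \<Longrightarrow>
  ad r (\<phi> \<otimes>\<^bsub>E\<^esub> \<psi>) = \<phi> \<otimes>\<^bsub>E\<^esub> ad r \<psi> \<oplus>\<^bsub>E\<^esub> ad r \<phi> \<otimes>\<^bsub>E\<^esub> \<psi>"
proof (rule E_eqI)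
  fix x assume a: "\<phi> \<in> carrier E" "\<psi> \<in> carrier E" "r \<in> carrier R" "x \<in> carrier R"
  define u v w where "u = \<phi> (\<psi> (r \<otimes> x))" and "v = \<phi> (r \<otimes> \<psi> x)" and "w = r \<otimes> \<phi> (\<psi> x)"
  have c: "u \<in> carrier R" "v \<in> carrier R" "w \<in> carrier R" using a by (auto simp: u_def v_def w_def)
  have "u \<ominus> w = (u \<ominus> v) \<oplus> (v \<ominus> w)" using c by algebra
  then show "ad r (\<phi> \<otimes>\<^bsub>E\<^esub> \<psi>) x = (\<phi> \<otimes>\<^bsub>E\<^esub> ad r \<psi> \<oplus>\<^bsub>E\<^esub> ad r \<phi> \<otimes>\<^bsub>E\<^esub> \<psi>) x"
    using a by (simp add: E_minus u_def v_def w_def)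
qed (auto intro!: ad_in_E E.m_closed E.a_closed)

lemma ad_commute: "\<phi> \<in> carrier E \<Longrightarrow> r \<in> carrier R \<Longrightarrow> s \<in> carrier R \<Longrightarrow> ad r (ad s \<phi>) = ad s (ad r \<phi>)"
proof (rule E_eqI)
  fix x assume a: "\<phi> \<in> carrier E" "r \<in> carrier R" "s \<in> carrier R" "x \<in> carrier R"
  define u v w z where "u = \<phi> (s \<otimes> (r \<otimes> x))" and "v = \<phi> (r \<otimes> x)" and "w = \<phi> (s \<otimes> x)" and "z = \<phi> x"
  have c: "u \<in> carrier R" "v \<in> carrier R" "w \<in> carrier R" "z \<in> carrier R" using a by (auto simp: u_def v_def w_def z_def)
  have "(u \<ominus> s \<otimes> v) \<ominus> r \<otimes> (w \<ominus> s \<otimes> z) = (u \<ominus> r \<otimes> w) \<ominus> s \<otimes> (v \<ominus> r \<otimes> z)"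
    using c a(2,3) by algebra
  moreover have "\<phi> (r \<otimes> (s \<otimes> x)) = u" using a by (simp add: u_def R.m_lcomm)
  ultimately show "ad r (ad s \<phi>) x = ad s (ad r \<phi>) x"
    using a by (simp add: ad_in_E u_def v_def w_def z_def)
qed (auto intro!: ad_in_E)

lemma Dn_add: "\<phi> \<in> Dn n \<Longrightarrow> \<psi> \<in> Dn n \<Longrightarrow> \<phi> \<oplus>\<^bsub>E\<^esub> \<psi> \<in> Dn n"
proof (induction n arbitrary: \<phi> \<psi>)
  case 0 then show ?case by (auto simp: lm_add)
next
  case (Suc n) then show ?case by (auto simp: Dn_Suc_iff ad_add)
qed

lemma Dn_smult: "\<phi> \<in> Dn n \<Longrightarrow> c \<in> carrier K \<Longrightarrow> c \<odot>\<^bsub>E\<^esub> \<phi> \<in> Dn n"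
proof (induction n arbitrary: \<phi>)
  case 0 then show ?case by (auto simp: lm_smult)
next
  case (Suc n) then show ?case by (auto simp: Dn_Suc_iff ad_smult)
qed

lemma Dn_uminus: "\<phi> \<in> Dn n \<Longrightarrow> \<ominus>\<^bsub>E\<^esub> \<phi> \<in> Dn n"
  using Dn_smult[of \<phi> n "\<ominus>\<^bsub>K\<^esub> \<one>\<^bsub>K\<^esub>"] Dn_E[of \<phi> n] by (simp add: EM.smult_l_minus)

lemma Dn_minus: "\<phi> \<in> Dn n \<Longrightarrow> \<psi> \<in> Dn n \<Longrightarrow> \<phi> \<ominus>\<^bsub>E\<^esub> \<psi> \<in> Dn n"
  by (simp add: a_minus_def Dn_add Dn_uminus)

lemma lm_Dn: "r \<in> carrier R \<Longrightarrow> lm r \<in> Dn n"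
proof (induction n arbitrary: r)
  case (Suc n)
  have "ad s (lm r) \<in> Dn n" if "s \<in> carrier R" for s
    using ad_zeroth[of "lm r" s] Suc that lm_zero Suc.IH[of "\<zero>"] by auto
  then show ?case using Suc by (auto simp: Dn_Suc_iff lm_in_E)
qed simp

lemma Dn_mono_Suc: "\<phi> \<in> Dn n \<Longrightarrow> \<phi> \<in> Dn (Suc n)"
proof (induction n arbitrary: \<phi>)
  case 0 then show ?case using lm_Dn by auto
next
  case (Suc n) then show ?case by (auto simp: Dn_Suc_iff)
qed

lemma Dn_mono: "\<phi> \<in> Dn n \<Longrightarrow> n \<le> m \<Longrightarrow> \<phi> \<in> Dn m"
  by (induction m) (auto simp: le_Suc_eq Dn_mono_Suc)

lemma ad_Dn: "\<phi> \<in> Dn n \<Longrightarrow> r \<in> carrier R \<Longrightarrow> ad r \<phi> \<in> Dn (n - 1)"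
proof (cases n)
  case 0
  assume "\<phi> \<in> Dn n" "r \<in> carrier R"
  then show ?thesis using 0 ad_zeroth[of \<phi> r] lm_Dn[of "\<zero>" 0] lm_zero by simp
qed (auto simp: Dn_Suc_iff)

text \<open>Orders add up: \<open>ad r\<close> is a derivation and lowers the order of one factor in each of its two summands.\<close>

lemma Dn_mult: "\<phi> \<in> Dn m \<Longrightarrow> \<psi> \<in> Dn n \<Longrightarrow> \<phi> \<otimes>\<^bsub>E\<^esub> \<psi> \<in> Dn (m + n)"
proof (induction "m + n" arbitrary: m n \<phi> \<psi>)
  case 0
  then show ?case by (auto simp: lm_mult)
next
  case (Suc k)
  have pE: "\<phi> \<in> carrier E" "\<psi> \<in> carrier E" using Suc Dn_E by blast+
  have "ad r (\<phi> \<otimes>\<^bsub>E\<^esub> \<psi>) \<in> Dn k" if r: "r \<in> carrier R" for r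
  proof -
    have 1: "\<phi> \<otimes>\<^bsub>E\<^esub> ad r \<psi> \<in> Dn k"
    proof (cases n)
      case 0
      then show ?thesis using ad_zeroth[of \<psi> r] Suc.prems r pE lm_Dn[of "\<zero>" k] lm_zero by simp
    next
      case (Suc n')
      then show ?thesis using Suc.hyps(1)[of m n'] Suc.hyps(2) Suc.prems r by (auto simp: Dn_Suc_iff)
    qed
    have 2: "ad r \<phi> \<otimes>\<^bsub>E\<^esub> \<psi> \<in> Dn k"
    proof (cases m)
      case 0
      then show ?thesis using ad_zeroth[of \<phi> r] Suc.prems r pE lm_Dn[of "\<zero>" k] lm_zero by simp
    next
      case (Suc m')
      then show ?thesis using Suc.hyps(1)[of m' n] Suc.hyps(2) Suc.prems r by (auto simp: Dn_Suc_iff)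
    qed
    show ?thesis using ad_mult[OF pE r] Dn_add[OF 1 2] by simp
  qed
  then have "\<phi> \<otimes>\<^bsub>E\<^esub> \<psi> \<in> Dn (Suc k)" using pE by (auto simp: Dn_Suc_iff)
  then show ?case using Suc.hyps(2) by simp
qed

lemma D_iff: "\<phi> \<in> carrier D \<longleftrightarrow> (\<exists>n. \<phi> \<in> Dn n)"
  by (simp add: diff_ops_def)

lemma D_E: "\<phi> \<in> carrier D \<Longrightarrow> \<phi> \<in> carrier E"
  using Dn_E D_iff by blast

lemma D_common: "\<phi> \<in> carrier D \<Longrightarrow> \<psi> \<in> carrier D \<Longrightarrow> \<exists>n. \<phi> \<in> Dn n \<and> \<psi> \<in> Dn n"
  by (metis D_iff Dn_mono nat_le_linear)

lemma D_ops [simp]: "mult D = mult E" "one D = one E" "zero D = zero E" "add D = add E" "smult D = smult E"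
  by (simp_all add: diff_ops_def)

lemma D_add_closed: "\<phi> \<in> carrier D \<Longrightarrow> \<psi> \<in> carrier D \<Longrightarrow> \<phi> \<oplus>\<^bsub>E\<^esub> \<psi> \<in> carrier D"
  by (metis D_common D_iff Dn_add)

lemma D_mult_closed: "\<phi> \<in> carrier D \<Longrightarrow> \<psi> \<in> carrier D \<Longrightarrow> \<phi> \<otimes>\<^bsub>E\<^esub> \<psi> \<in> carrier D"
  by (metis D_common D_iff Dn_mult)

lemma D_smult_closed: "c \<in> carrier K \<Longrightarrow> \<phi> \<in> carrier D \<Longrightarrow> c \<odot>\<^bsub>E\<^esub> \<phi> \<in> carrier D"
  by (metis D_iff Dn_smult)

lemma lm_D: "r \<in> carrier R \<Longrightarrow> lm r \<in> carrier D"
  using lm_Dn D_iff by blast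

lemma D_ring: "ring D"
proof (rule ringI)
  show "abelian_group D"
  proof (rule abelian_groupI)
    fix \<phi> assume "\<phi> \<in> carrier D"
    then show "\<exists>\<psi>\<in>carrier D. \<psi> \<oplus>\<^bsub>D\<^esub> \<phi> = \<zero>\<^bsub>D\<^esub>"
      using E.l_neg[OF D_E] Dn_uminus by (intro bexI[of _ "\<ominus>\<^bsub>E\<^esub> \<phi>"]) (auto simp: D_iff)
  qed (use lm_D[of "\<zero>"] lm_zero in \<open>auto simp: D_E D_add_closed E.a_ac\<close>)
  show "monoid D"
    by (rule monoidI) (use lm_D[of "\<one>"] lm_one in \<open>auto simp: D_E D_mult_closed E.m_assoc\<close>)
qed (auto simp: D_E E.l_distr E.r_distr)

sublocale D: ring D by (rule D_ring)

lemma D_module: "module K D"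
  by (rule moduleI)
     (auto simp: D.is_abelian_group K.is_cring D_smult_closed D_E EM.smult_l_distr EM.smult_r_distr EM.smult_assoc1)

lemma D_uminus: "\<phi> \<in> carrier D \<Longrightarrow> \<ominus>\<^bsub>D\<^esub> \<phi> = \<ominus>\<^bsub>E\<^esub> \<phi>"
  by (metis D.a_inv_closed D.l_neg D_E D_ops(3,4) E.minus_equality)

lemma D_minus: "\<phi> \<in> carrier D \<Longrightarrow> \<psi> \<in> carrier D \<Longrightarrow> \<phi> \<ominus>\<^bsub>D\<^esub> \<psi> = \<phi> \<ominus>\<^bsub>E\<^esub> \<psi>"
  by (simp add: a_minus_def D_uminus)

lemma D_commutator: "\<phi> \<in> carrier D \<Longrightarrow> r \<in> carrier R \<Longrightarrow> commutator D \<phi> (lm r) = ad r \<phi>"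
  by (simp add: commutator_def D_minus D_mult_closed lm_D)

lemma ad_iter_Dn: "\<phi> \<in> Dn n \<Longrightarrow> r \<in> carrier R \<Longrightarrow> (ad r ^^ i) \<phi> \<in> Dn (n - i)"
proof (induction i)
  case (Suc i)
  then show ?case using ad_Dn[of "(ad r ^^ i) \<phi>" "n - i" r] by simp
qed simp

lemma ad_iter_zero: "\<phi> \<in> Dn n \<Longrightarrow> r \<in> carrier R \<Longrightarrow> n < i \<Longrightarrow> (ad r ^^ i) \<phi> = \<zero>\<^bsub>E\<^esub>"
proof (induction i)
  case (Suc i)
  show ?case
  proof (cases "n < i")
    case True
    then show ?thesis using Suc ad_zeroth[of "\<zero>\<^bsub>E\<^esub>" r] lm_Dn[of "\<zero>" 0] lm_zero by simp
  next
    case False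
    then have "(ad r ^^ i) \<phi> \<in> Dn 0" using ad_iter_Dn[OF Suc.prems(1,2), of i] Suc.prems(3) by simp
    then show ?thesis using ad_zeroth Suc.prems by simp
  qed
qed simp

lemma ad_iter_E: "\<phi> \<in> carrier E \<Longrightarrow> r \<in> carrier R \<Longrightarrow> (ad r ^^ i) \<phi> \<in> carrier E"
  by (induction i) (auto simp: ad_in_E)

lemma ad_iter_D: "\<phi> \<in> carrier D \<Longrightarrow> r \<in> carrier R \<Longrightarrow> (ad r ^^ i) \<phi> \<in> carrier D"
  using ad_iter_Dn by (metis D_iff)

text \<open>In operator form, $\phi f^t = \sum_i \binom t i f^{t-i} \phi^{(i)}$. The upper summation bound is the order of
\<open>\<phi>\<close> instead of \<open>t\<close>, which makes the number of terms independent of \<open>t\<close>. For \<open>i > t\<close> the truncated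
exponent \<open>t - i\<close> is harmless because the binomial coefficient vanishes.\<close>

lemma leibniz_pow:
  assumes f: "f \<in> carrier R" and x: "x \<in> carrier R" and p: "\<phi> \<in> Dn N"
  shows "\<phi> (f [^] t \<otimes> x) =
    (\<Oplus>i\<in>{..N}. [(t choose i)] \<cdot> (f [^] (t - i) \<otimes> (ad f ^^ i) \<phi> x))"
  using p
proof (induction t arbitrary: \<phi>)
  case 0
  have "(\<Oplus>i\<in>{..N}. [((0::nat) choose i)] \<cdot> (f [^] (0 - i) \<otimes> (ad f ^^ i) \<phi> x)) =
     (\<Oplus>i\<in>{..N}. if i = 0 then \<phi> x else \<zero>)"
    using 0 Dn_E[OF 0] f x by (intro R.finsum_cong') (auto simp: ad_iter_E binomial_eq_0)
  also have "\<dots> = \<phi> x" using R.finsum_singleton[of 0 "{..N}" "\<lambda>_. \<phi> x"] Dn_E[OF 0] x by (simp add: eq_commute)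
  finally show ?case using x Dn_E[OF 0] by simp
next
  case (Suc t)
  have pE: "\<phi> \<in> carrier E" using Suc.prems Dn_E by blast
  have aD: "ad f \<phi> \<in> Dn N" using ad_Dn[OF Suc.prems f] Dn_mono by fastforce
  define g where "g i = (ad f ^^ i) \<phi> x" for i
  have g: "g i \<in> carrier R" for i using pE f x by (simp add: g_def ad_iter_E)
  have gN: "g (Suc N) = \<zero>" using ad_iter_zero[OF Suc.prems f, of "Suc N"] x by (simp add: g_def del: funpow.simps)
  define A where "A i = [(t choose i)] \<cdot> (f [^] (Suc t - i) \<otimes> g i)" for i
  define B where "B i = [(t choose i)] \<cdot> (f [^] (t - i) \<otimes> g (Suc i))" for i
  define T where "T i = [(Suc t choose i)] \<cdot> (f [^] (Suc t - i) \<otimes> g i)" for i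
  have ABc: "A i \<in> carrier R" "B i \<in> carrier R" "T i \<in> carrier R" for i using f g by (auto simp: A_def B_def T_def)
  have T0: "T 0 = A 0" by (simp add: T_def A_def)
  have TS: "T (Suc i) = A (Suc i) \<oplus> B i" for i
    using f g by (simp add: T_def A_def B_def R.add.nat_pow_mult add.commute)
  have BN: "B N = \<zero>" using gN f by (simp add: B_def)
  have "\<phi> (f [^] Suc t \<otimes> x) = \<phi> (f \<otimes> (f [^] t \<otimes> x))"
    using f x by (simp add: R.m_ac)
  also have "\<dots> = f \<otimes> \<phi> (f [^] t \<otimes> x) \<oplus> ad f \<phi> (f [^] t \<otimes> x)"
  proof -
    have "\<And>u v. u \<in> carrier R \<Longrightarrow> v \<in> carrier R \<Longrightarrow> u = v \<oplus> (u \<ominus> v)" by algebra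
    then show ?thesis using f x pE by simp
  qed
  also have "f \<otimes> \<phi> (f [^] t \<otimes> x) = (\<Oplus>i\<in>{..N}. f \<otimes> ([(t choose i)] \<cdot> (f [^] (t - i) \<otimes> g i)))"
    unfolding Suc.IH[OF Suc.prems] g_def[symmetric] using f g by (intro R.finsum_rdistr) auto
  also have "\<dots> = (\<Oplus>i\<in>{..N}. A i)"
  proof (intro R.finsum_cong')
    fix i
    show "f \<otimes> ([(t choose i)] \<cdot> (f [^] (t - i) \<otimes> g i)) = A i"
    proof (cases "i \<le> t")
      case True
      then have "f [^] (Suc t - i) = f \<otimes> f [^] (t - i)" using f by (simp add: Suc_diff_le R.m_comm)
      then show ?thesis using f g[of i] by (simp add: A_def R.add_pow_rdistr R.m_assoc)
    qed (use f g in \<open>simp add: A_def binomial_eq_0\<close>)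
  qed (use ABc in auto)
  also have "ad f \<phi> (f [^] t \<otimes> x) = (\<Oplus>i\<in>{..N}. B i)"
    unfolding Suc.IH[OF aD] B_def g_def by (simp only: funpow_Suc_right o_apply)
  also have "(\<Oplus>i\<in>{..N}. A i) \<oplus> (\<Oplus>i\<in>{..N}. B i) = (\<Oplus>i\<in>{..N}. T i)"
  proof (cases N)
    case 0
    then show ?thesis using ABc BN T0 by simp
  next
    case (Suc M)
    have "(\<Oplus>i\<in>{..N}. A i) = (\<Oplus>i\<in>{..M}. A (Suc i)) \<oplus> A 0"
      unfolding Suc using ABc by (intro R.finsum_Suc2) auto
    moreover have "(\<Oplus>i\<in>{..N}. B i) = (\<Oplus>i\<in>{..M}. B i)"
      unfolding Suc using ABc BN Suc by (subst R.finsum_Suc) (auto intro!: R.l_zero R.finsum_closed)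
    moreover have "(\<Oplus>i\<in>{..N}. T i) = (\<Oplus>i\<in>{..M}. A (Suc i) \<oplus> B i) \<oplus> A 0"
      unfolding Suc using ABc by (subst R.finsum_Suc2) (auto simp: TS T0)
    moreover have "(\<Oplus>i\<in>{..M}. A (Suc i) \<oplus> B i) = (\<Oplus>i\<in>{..M}. A (Suc i)) \<oplus> (\<Oplus>i\<in>{..M}. B i)"
      using ABc by (intro R.finsum_addf) auto
    moreover have "(\<Oplus>i\<in>{..M}. A (Suc i)) \<in> carrier R" "(\<Oplus>i\<in>{..M}. B i) \<in> carrier R"
      using ABc by (auto intro!: R.finsum_closed)
    ultimately show ?thesis using ABc by (simp add: R.a_ac)
  qed
  finally show ?case by (simp add: T_def g_def)
qed

end

section \<open>The localization at the powers of an element\<close>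

locale localized_algebra = k_algebra K R for K :: "'k ring" and R :: "('k, 'r) module" (structure) +
  fixes f :: 'r
  assumes f [simp]: "f \<in> carrier R"
begin

abbreviation L where "L \<equiv> localization R f"
abbreviation frac where "frac \<equiv> loc_frac R f"
abbreviation fpow where "fpow n \<equiv> f [^] (n :: nat)"

lemma fpow_add: "fpow (m + n) = fpow m \<otimes> fpow n"
  by (simp add: R.nat_pow_mult)

lemma loc_rel_iff:
  "((a, m), (b, n)) \<in> loc_rel R f \<longleftrightarrow> a \<in> carrier R \<and> b \<in> carrier R \<and>
     (\<exists>l. fpow l \<otimes> (fpow n \<otimes> a) = fpow l \<otimes> (fpow m \<otimes> b))"
  by (simp add: loc_rel_def)

lemma equiv_loc_rel: "equiv (carrier R \<times> UNIV) (loc_rel R f)"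
proof (rule equivI)
  show "loc_rel R f \<subseteq> (carrier R \<times> UNIV) \<times> (carrier R \<times> UNIV)" by (auto simp: loc_rel_def)
  show "refl_on (carrier R \<times> UNIV) (loc_rel R f)" by (auto simp: refl_on_def loc_rel_def)
  show "sym (loc_rel R f)" by (auto simp: sym_def loc_rel_def dest: sym)
  show "trans (loc_rel R f)"
  proof (rule transI)
    fix x y z assume xy: "(x, y) \<in> loc_rel R f" and yz: "(y, z) \<in> loc_rel R f"
    obtain a m b n c p where e: "x = (a, m)" "y = (b, n)" "z = (c, p)" by (metis surj_pair)
    have c: "a \<in> carrier R" "b \<in> carrier R" "c \<in> carrier R" using xy yz by (auto simp: e loc_rel_iff)
    obtain l k where lk: "fpow l \<otimes> (fpow n \<otimes> a) = fpow l \<otimes> (fpow m \<otimes> b)"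
      "fpow k \<otimes> (fpow p \<otimes> b) = fpow k \<otimes> (fpow n \<otimes> c)"
      using xy yz by (auto simp: e loc_rel_iff)
    have "fpow (l + k + n) \<otimes> (fpow p \<otimes> a) = fpow k \<otimes> fpow p \<otimes> (fpow l \<otimes> (fpow n \<otimes> a))"
      using c by (simp add: fpow_add R.m_ac)
    also have "\<dots> = fpow l \<otimes> fpow m \<otimes> (fpow k \<otimes> (fpow p \<otimes> b))"
      unfolding lk(1) using c by (simp add: R.m_ac)
    also have "\<dots> = fpow (l + k + n) \<otimes> (fpow m \<otimes> c)"
      unfolding lk(2) using c by (simp add: fpow_add R.m_ac)
    finally show "(x, z) \<in> loc_rel R f" using c unfolding e loc_rel_iff by blast
  qed
qed

lemma frac_eq_iff:
  assumes "a \<in> carrier R" "b \<in> carrier R"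
  shows "frac a m = frac b n \<longleftrightarrow> (\<exists>l. fpow l \<otimes> (fpow n \<otimes> a) = fpow l \<otimes> (fpow m \<otimes> b))"
  unfolding loc_frac_def using assms eq_equiv_class_iff[OF equiv_loc_rel, of "(a, m)" "(b, n)"]
  by (simp add: loc_rel_iff)

lemma frac_cancel:
  assumes "a \<in> carrier R"
  shows "frac (fpow p \<otimes> a) (m + p) = frac a m"
  using assms by (subst frac_eq_iff) (auto intro!: exI[of _ 0] simp: fpow_add R.m_ac)

lemma frac_memD:
  assumes "a \<in> carrier R" "(b, n) \<in> frac a m"
  shows "b \<in> carrier R" "frac b n = frac a m"
proof -
  have r: "((a, m), (b, n)) \<in> loc_rel R f" using assms(2) by (simp add: loc_frac_def)
  then show "b \<in> carrier R" by (simp add: loc_rel_iff)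
  show "frac b n = frac a m"
    using equiv_class_eq[OF equiv_loc_rel r] by (simp add: loc_frac_def)
qed

lemma frac_self: "a \<in> carrier R \<Longrightarrow> (a, m) \<in> frac a m"
  by (auto simp: loc_frac_def loc_rel_iff)

lemma frac_in_L [simp]: "a \<in> carrier R \<Longrightarrow> frac a m \<in> carrier L"
  by (auto simp: localization_def loc_frac_def intro!: quotientI)

lemma L_cases:
  assumes "X \<in> carrier L"
  obtains a m where "a \<in> carrier R" "X = frac a m"
  using assms by (auto simp: localization_def loc_frac_def elim!: quotientE)

text \<open>The operations of the localization are unions over all representatives; the union is the common
value once the value is known not to depend on the representative.\<close>

lemma UN_class:
  assumes "a \<in> carrier R" "\<And>b n. (b, n) \<in> frac a m \<Longrightarrow> g b n = c"
  shows "(\<Union>(b, n)\<in>frac a m. g b n) = c"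
  using assms frac_self[OF assms(1), of m] by fastforce

lemma L_mult:
  assumes "a \<in> carrier R" "b \<in> carrier R"
  shows "frac a m \<otimes>\<^bsub>L\<^esub> frac b n = frac (a \<otimes> b) (m + n)"
proof -
  have "frac (a' \<otimes> b') (m' + n') = frac (a \<otimes> b) (m + n)"
    if "(a', m') \<in> frac a m" "(b', n') \<in> frac b n" for a' m' b' n'
  proof -
    have c: "a' \<in> carrier R" "b' \<in> carrier R" using frac_memD that assms by blast+
    have "frac a' m' = frac a m" "frac b' n' = frac b n" using frac_memD(2) that assms by blast+
    then obtain l k where lk: "fpow l \<otimes> (fpow m \<otimes> a') = fpow l \<otimes> (fpow m' \<otimes> a)"
      "fpow k \<otimes> (fpow n \<otimes> b') = fpow k \<otimes> (fpow n' \<otimes> b)"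
      using c assms by (auto simp: frac_eq_iff)
    have "fpow (l + k) \<otimes> (fpow (m + n) \<otimes> (a' \<otimes> b')) =
      (fpow l \<otimes> (fpow m \<otimes> a')) \<otimes> (fpow k \<otimes> (fpow n \<otimes> b'))"
      using c by (simp add: fpow_add R.m_ac)
    also have "\<dots> = fpow (l + k) \<otimes> (fpow (m' + n') \<otimes> (a \<otimes> b))"
      unfolding lk using assms by (simp add: fpow_add R.m_ac)
    finally show ?thesis using c assms by (subst frac_eq_iff) auto
  qed
  then have "(\<Union>(a', m')\<in>frac a m. \<Union>(b', n')\<in>frac b n. frac (a' \<otimes> b') (m' + n')) = frac (a \<otimes> b) (m + n)"
    using assms by (intro UN_class) auto
  then show ?thesis by (simp add: localization_def)
qed

lemma L_smult:
  assumes "c \<in> carrier K" "a \<in> carrier R"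
  shows "c \<odot>\<^bsub>L\<^esub> frac a m = frac (c \<odot> a) m"
proof -
  have "frac (c \<odot> a') m' = frac (c \<odot> a) m" if "(a', m') \<in> frac a m" for a' m'
  proof -
    have ca: "a' \<in> carrier R" using frac_memD that assms by blast
    have "frac a' m' = frac a m" using frac_memD(2) that assms by blast
    then obtain l where "fpow l \<otimes> (fpow m \<otimes> a') = fpow l \<otimes> (fpow m' \<otimes> a)"
      using ca assms by (auto simp: frac_eq_iff)
    then have "fpow l \<otimes> (fpow m \<otimes> (c \<odot> a')) = fpow l \<otimes> (fpow m' \<otimes> (c \<odot> a))"
      using ca assms by (simp add: smult_assoc3)
    then show ?thesis using ca assms by (subst frac_eq_iff) auto
  qed
  then have "(\<Union>(a', m')\<in>frac a m. frac (c \<odot> a') m') = frac (c \<odot> a) m"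
    using assms by (intro UN_class) auto
  then show ?thesis by (simp add: localization_def)
qed

lemma L_add:
  assumes "a \<in> carrier R" "b \<in> carrier R"
  shows "frac a m \<oplus>\<^bsub>L\<^esub> frac b n = frac (fpow n \<otimes> a \<oplus> fpow m \<otimes> b) (m + n)"
proof -
  have "frac (fpow n' \<otimes> a' \<oplus> fpow m' \<otimes> b') (m' + n') = frac (fpow n \<otimes> a \<oplus> fpow m \<otimes> b) (m + n)"
    if "(a', m') \<in> frac a m" "(b', n') \<in> frac b n" for a' m' b' n'
  proof -
    have c: "a' \<in> carrier R" "b' \<in> carrier R" using frac_memD that assms by blast+
    have "frac a' m' = frac a m" "frac b' n' = frac b n" using frac_memD(2) that assms by blast+
    then obtain l k where lk: "fpow l \<otimes> (fpow m \<otimes> a') = fpow l \<otimes> (fpow m' \<otimes> a)"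
      "fpow k \<otimes> (fpow n \<otimes> b') = fpow k \<otimes> (fpow n' \<otimes> b)"
      using c assms by (auto simp: frac_eq_iff)
    have "fpow (l + k) \<otimes> (fpow (m + n) \<otimes> (fpow n' \<otimes> a' \<oplus> fpow m' \<otimes> b')) =
      (fpow k \<otimes> fpow n \<otimes> fpow n') \<otimes> (fpow l \<otimes> (fpow m \<otimes> a')) \<oplus>
      (fpow l \<otimes> fpow m \<otimes> fpow m') \<otimes> (fpow k \<otimes> (fpow n \<otimes> b'))"
      using c by (simp add: fpow_add R.m_ac R.r_distr)
    also have "\<dots> = fpow (l + k) \<otimes> (fpow (m' + n') \<otimes> (fpow n \<otimes> a \<oplus> fpow m \<otimes> b))"
      unfolding lk using assms by (simp add: fpow_add R.m_ac R.r_distr)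
    finally show ?thesis using c assms by (subst frac_eq_iff) auto
  qed
  then have "(\<Union>(a', m')\<in>frac a m. \<Union>(b', n')\<in>frac b n. frac (fpow n' \<otimes> a' \<oplus> fpow m' \<otimes> b') (m' + n'))
      = frac (fpow n \<otimes> a \<oplus> fpow m \<otimes> b) (m + n)"
    using assms by (intro UN_class) auto
  then show ?thesis by (simp add: localization_def)
qed

lemma L_add_same:
  assumes "a \<in> carrier R" "b \<in> carrier R"
  shows "frac a m \<oplus>\<^bsub>L\<^esub> frac b m = frac (a \<oplus> b) m"
  using assms frac_cancel[of "a \<oplus> b" m m] by (simp add: L_add R.r_distr)

lemma L_one: "\<one>\<^bsub>L\<^esub> = frac \<one> 0" and L_zero: "\<zero>\<^bsub>L\<^esub> = frac \<zero> 0"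
  by (simp_all add: localization_def)

lemma frac_zero: "frac \<zero> m = \<zero>\<^bsub>L\<^esub>"
  using frac_cancel[of "\<zero>" m 0] by (simp add: L_zero)

text \<open>With a common denominator, sums in \<open>L\<close> are sums of numerators, and the ring axioms for \<open>L\<close> reduce to
those for \<open>R\<close>.\<close>

lemma L_common_denominator2:
  assumes "X \<in> carrier L" "Y \<in> carrier L"
  obtains a b m where "a \<in> carrier R" "b \<in> carrier R" "X = frac a m" "Y = frac b m"
proof -
  obtain a m b n where e: "a \<in> carrier R" "b \<in> carrier R" "X = frac a m" "Y = frac b n"
    using assms by (metis L_cases)
  then have XY: "X = frac (fpow n \<otimes> a) (m + n)" "Y = frac (fpow m \<otimes> b) (m + n)"
    using frac_cancel[of a n m] frac_cancel[of b m n] by (simp_all add: add.commute)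
  show thesis using that[OF _ _ XY] e(1,2) by simp
qed

lemma L_common_denominator3:
  assumes "X \<in> carrier L" "Y \<in> carrier L" "Z \<in> carrier L"
  obtains a b c m where "a \<in> carrier R" "b \<in> carrier R" "c \<in> carrier R" "X = frac a m" "Y = frac b m" "Z = frac c m"
proof -
  obtain a b m where e: "a \<in> carrier R" "b \<in> carrier R" "X = frac a m" "Y = frac b m"
    using assms L_common_denominator2 by blast
  obtain c n where c: "c \<in> carrier R" "Z = frac c n" using assms L_cases by blast
  have XYZ: "X = frac (fpow n \<otimes> a) (m + n)" "Y = frac (fpow n \<otimes> b) (m + n)" "Z = frac (fpow m \<otimes> c) (m + n)"
    using e c frac_cancel[of a n m] frac_cancel[of b n m] frac_cancel[of c m n] by (simp_all add: add.commute)
  show thesis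
    using that[OF _ _ _ XYZ] e(1,2) c(1) by simp
qed

lemma L_abelian_group: "abelian_group L"
proof (rule abelian_groupI)
  fix X Y assume "X \<in> carrier L" "Y \<in> carrier L"
  then obtain a b m where "a \<in> carrier R" "b \<in> carrier R" "X = frac a m" "Y = frac b m" by (rule L_common_denominator2)
  then show "X \<oplus>\<^bsub>L\<^esub> Y \<in> carrier L" "X \<oplus>\<^bsub>L\<^esub> Y = Y \<oplus>\<^bsub>L\<^esub> X" by (auto simp: L_add_same R.a_comm)
next
  show "\<zero>\<^bsub>L\<^esub> \<in> carrier L" by (simp add: L_zero)
next
  fix X Y Z assume "X \<in> carrier L" "Y \<in> carrier L" "Z \<in> carrier L"
  then obtain a b c m where "a \<in> carrier R" "b \<in> carrier R" "c \<in> carrier R" "X = frac a m" "Y = frac b m" "Z = frac c m"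
    by (rule L_common_denominator3)
  then show "X \<oplus>\<^bsub>L\<^esub> Y \<oplus>\<^bsub>L\<^esub> Z = X \<oplus>\<^bsub>L\<^esub> (Y \<oplus>\<^bsub>L\<^esub> Z)" by (simp add: L_add_same R.a_assoc)
next
  fix X assume "X \<in> carrier L"
  then obtain a m where a: "a \<in> carrier R" "X = frac a m" by (rule L_cases)
  then show "\<zero>\<^bsub>L\<^esub> \<oplus>\<^bsub>L\<^esub> X = X" unfolding frac_zero[symmetric, of m] by (simp add: L_add_same)
  show "\<exists>Y\<in>carrier L. Y \<oplus>\<^bsub>L\<^esub> X = \<zero>\<^bsub>L\<^esub>"
    using a by (intro bexI[of _ "frac (\<ominus> a) m"]) (auto simp: L_add_same R.l_neg frac_zero)
qed

lemma L_cring: "cring L"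
proof (rule cringI)
  show "abelian_group L" by (rule L_abelian_group)
  show "comm_monoid L"
  proof (rule comm_monoidI)
    fix X Y assume "X \<in> carrier L" "Y \<in> carrier L"
    then obtain a b m where "a \<in> carrier R" "b \<in> carrier R" "X = frac a m" "Y = frac b m" by (rule L_common_denominator2)
    then show "X \<otimes>\<^bsub>L\<^esub> Y \<in> carrier L" "X \<otimes>\<^bsub>L\<^esub> Y = Y \<otimes>\<^bsub>L\<^esub> X" by (auto simp: L_mult R.m_comm)
  next
    fix X Y Z assume "X \<in> carrier L" "Y \<in> carrier L" "Z \<in> carrier L"
    then obtain a b c m where "a \<in> carrier R" "b \<in> carrier R" "c \<in> carrier R" "X = frac a m" "Y = frac b m" "Z = frac c m"
      by (rule L_common_denominator3)
    then show "X \<otimes>\<^bsub>L\<^esub> Y \<otimes>\<^bsub>L\<^esub> Z = X \<otimes>\<^bsub>L\<^esub> (Y \<otimes>\<^bsub>L\<^esub> Z)" by (simp add: L_mult R.m_assoc add.assoc)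
  next
    fix X assume "X \<in> carrier L"
    then obtain a m where a: "a \<in> carrier R" "X = frac a m" by (rule L_cases)
    then show "\<one>\<^bsub>L\<^esub> \<otimes>\<^bsub>L\<^esub> X = X" by (simp add: L_one L_mult)
  qed (simp add: L_one)
  fix X Y Z assume "X \<in> carrier L" "Y \<in> carrier L" "Z \<in> carrier L"
  then obtain a b c m where "a \<in> carrier R" "b \<in> carrier R" "c \<in> carrier R" "X = frac a m" "Y = frac b m" "Z = frac c m"
    by (rule L_common_denominator3)
  then show "(X \<oplus>\<^bsub>L\<^esub> Y) \<otimes>\<^bsub>L\<^esub> Z = X \<otimes>\<^bsub>L\<^esub> Z \<oplus>\<^bsub>L\<^esub> Y \<otimes>\<^bsub>L\<^esub> Z"
    by (simp add: L_add_same L_mult R.l_distr)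
qed

lemma L_algebra: "algebra K L"
proof (rule algebraI)
  show "cring K" "cring L" by (rule K.is_cring L_cring)+
  fix c X Y assume c: "c \<in> carrier K" and X: "X \<in> carrier L" and Y: "Y \<in> carrier L"
  from X Y obtain a b m where a: "a \<in> carrier R" "b \<in> carrier R" "X = frac a m" "Y = frac b m"
    by (rule L_common_denominator2)
  show "c \<odot>\<^bsub>L\<^esub> (X \<oplus>\<^bsub>L\<^esub> Y) = c \<odot>\<^bsub>L\<^esub> X \<oplus>\<^bsub>L\<^esub> c \<odot>\<^bsub>L\<^esub> Y"
    unfolding a(3,4) using c a(1,2) by (simp add: L_add_same L_smult V.smult_r_distr)
  show "(c \<odot>\<^bsub>L\<^esub> X) \<otimes>\<^bsub>L\<^esub> Y = c \<odot>\<^bsub>L\<^esub> (X \<otimes>\<^bsub>L\<^esub> Y)"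
    unfolding a(3,4) using c a(1,2) by (simp add: L_mult L_smult smult_assoc2)
next
  fix c X assume c: "c \<in> carrier K" "X \<in> carrier L"
  from c(2) obtain a m where a: "a \<in> carrier R" "X = frac a m" by (rule L_cases)
  then show "c \<odot>\<^bsub>L\<^esub> X \<in> carrier L" using c by (simp add: L_smult)
  fix d assume "d \<in> carrier K"
  then show "(c \<oplus>\<^bsub>K\<^esub> d) \<odot>\<^bsub>L\<^esub> X = c \<odot>\<^bsub>L\<^esub> X \<oplus>\<^bsub>L\<^esub> d \<odot>\<^bsub>L\<^esub> X" "(c \<otimes>\<^bsub>K\<^esub> d) \<odot>\<^bsub>L\<^esub> X = c \<odot>\<^bsub>L\<^esub> (d \<odot>\<^bsub>L\<^esub> X)"
    using c a by (simp_all add: L_smult L_add_same V.smult_l_distr V.smult_assoc1)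
next
  fix X assume "X \<in> carrier L"
  then obtain a m where a: "a \<in> carrier R" "X = frac a m" by (rule L_cases)
  then show "\<one>\<^bsub>K\<^esub> \<odot>\<^bsub>L\<^esub> X = X" by (simp add: L_smult)
qed

sublocale L: k_algebra K L
  by (rule k_algebra.intro) (rule L_algebra)

lemma frac_minus: "a \<in> carrier R \<Longrightarrow> b \<in> carrier R \<Longrightarrow> frac (a \<ominus> b) m = frac a m \<ominus>\<^bsub>L\<^esub> frac b m"
proof -
  assume a: "a \<in> carrier R" "b \<in> carrier R"
  have "frac (\<ominus> b) m \<oplus>\<^bsub>L\<^esub> frac b m = \<zero>\<^bsub>L\<^esub>" using a by (simp add: L_add_same R.l_neg frac_zero)
  then have "\<ominus>\<^bsub>L\<^esub> frac b m = frac (\<ominus> b) m" using a by (intro L.R.minus_equality) auto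
  then show ?thesis using a by (simp add: a_minus_def L_add_same)
qed

lemma fpow_inverse: "frac (fpow m) 0 \<otimes>\<^bsub>L\<^esub> frac \<one> m = \<one>\<^bsub>L\<^esub>"
  using frac_cancel[of "\<one>" m 0] by (simp add: L_mult L_one)

lemma fpow_frac: "a \<in> carrier R \<Longrightarrow> frac (fpow m) 0 \<otimes>\<^bsub>L\<^esub> frac a m = frac a 0"
  using frac_cancel[of a m 0] by (simp add: L_mult)

lemma fpow_cancel: "X \<in> carrier L \<Longrightarrow> Y \<in> carrier L \<Longrightarrow> frac (fpow m) 0 \<otimes>\<^bsub>L\<^esub> X = frac (fpow m) 0 \<otimes>\<^bsub>L\<^esub> Y \<Longrightarrow> X = Y"
proof -
  assume X: "X \<in> carrier L" "Y \<in> carrier L" and e: "frac (fpow m) 0 \<otimes>\<^bsub>L\<^esub> X = frac (fpow m) 0 \<otimes>\<^bsub>L\<^esub> Y"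
  have "Z = frac \<one> m \<otimes>\<^bsub>L\<^esub> (frac (fpow m) 0 \<otimes>\<^bsub>L\<^esub> Z)" if "Z \<in> carrier L" for Z
  proof -
    have "frac \<one> m \<otimes>\<^bsub>L\<^esub> frac (fpow m) 0 = \<one>\<^bsub>L\<^esub>"
      using fpow_inverse[of m] by (metis L.R.m_comm R.nat_pow_closed R.one_closed f frac_in_L)
    then show ?thesis using that L.R.m_assoc[of "frac \<one> m" "frac (fpow m) 0" Z] by simp
  qed
  then show ?thesis using X e by metis
qed

end

section \<open>Extension of differential operators to the localization\<close>

context localized_algebra
begin

definition extends :: "(('r \<times> nat) set \<Rightarrow> ('r \<times> nat) set) \<Rightarrow> ('r \<Rightarrow> 'r) \<Rightarrow> bool" where
  "extends \<eta> \<delta> \<longleftrightarrow> (\<forall>r\<in>carrier R. \<eta> (frac r 0) = frac (\<delta> r) 0)"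

text \<open>By induction on the order. If \<open>y = f\<^sup>m\<close> is the denominator of \<open>X = a / f\<^sup>m\<close>, the commutator of \<open>\<eta>\<close> with \<open>y\<close>
vanishes on \<open>R\<close> too and has smaller order, so that \<open>y \<eta>(X) = \<eta>(y X) = \<eta>(a) = 0\<close>, and \<open>y\<close> is a unit.\<close>

lemma vanishing_on_R:
  "\<eta> \<in> L.Dn n \<Longrightarrow> (\<And>r. r \<in> carrier R \<Longrightarrow> \<eta> (frac r 0) = \<zero>\<^bsub>L\<^esub>) \<Longrightarrow> X \<in> carrier L \<Longrightarrow> \<eta> X = \<zero>\<^bsub>L\<^esub>"
proof (induction n arbitrary: \<eta> X)
  case 0
  then obtain A where A: "A \<in> carrier L" "\<eta> = L.lm A" by auto
  have "\<eta> (frac \<one> 0) = A" using A by (simp add: L_one[symmetric])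
  then have "A = \<zero>\<^bsub>L\<^esub>" using 0(2)[of "\<one>"] by simp
  then show ?case using A 0 by simp
next
  case (Suc n)
  have E: "\<eta> \<in> carrier L.E" using Suc.prems(1) L.Dn_E by blast
  obtain a m where a: "a \<in> carrier R" "X = frac a m" using Suc.prems(3) by (rule L_cases)
  define y where "y = frac (fpow m) 0"
  have y: "y \<in> carrier L" by (simp add: y_def)
  have "L.ad y \<eta> \<in> L.Dn n" using Suc.prems(1) y by (simp add: L.Dn_Suc_iff)
  moreover have "L.ad y \<eta> (frac r 0) = \<zero>\<^bsub>L\<^esub>" if r: "r \<in> carrier R" for r
  proof -
    have "y \<otimes>\<^bsub>L\<^esub> frac r 0 = frac (fpow m \<otimes> r) 0" using r by (simp add: y_def L_mult)
    then show ?thesis using r y E Suc.prems(2)[of r] Suc.prems(2)[of "fpow m \<otimes> r"] by simp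
  qed
  ultimately have "L.ad y \<eta> X = \<zero>\<^bsub>L\<^esub>" using Suc.IH Suc.prems(3) by blast
  then have "\<eta> (y \<otimes>\<^bsub>L\<^esub> X) = y \<otimes>\<^bsub>L\<^esub> \<eta> X" using E y Suc.prems(3) by simp
  moreover have "y \<otimes>\<^bsub>L\<^esub> X = frac a 0" using a by (simp add: y_def fpow_frac)
  ultimately have "y \<otimes>\<^bsub>L\<^esub> \<eta> X = y \<otimes>\<^bsub>L\<^esub> \<zero>\<^bsub>L\<^esub>"
    using Suc.prems(2)[OF a(1)] L.R.r_null[OF y] by simp
  then show ?case unfolding y_def using fpow_cancel E Suc.prems(3) by simp
qed

lemma extension_unique:
  assumes "\<eta> \<in> L.Dn n" "\<eta>' \<in> L.Dn n" "extends \<eta> \<delta>" "extends \<eta>' \<delta>" "\<delta> \<in> carrier E"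
  shows "\<eta> = \<eta>'"
proof (rule L.E_eqI)
  show E: "\<eta> \<in> carrier L.E" "\<eta>' \<in> carrier L.E" using assms L.Dn_E by blast+
  fix X assume X: "X \<in> carrier L"
  have "(\<eta> \<ominus>\<^bsub>L.E\<^esub> \<eta>') X = \<zero>\<^bsub>L\<^esub>"
    by (rule vanishing_on_R[OF L.Dn_minus[OF assms(1,2)] _ X])
       (use assms(3-5) E in \<open>auto simp: extends_def\<close>)
  then show "\<eta> X = \<eta>' X" using E X by simp
qed

text \<open>By induction on the order. An extension \<open>\<eta>\<close> of \<open>\<delta>\<close> has to satisfy
$f^m \eta(a / f^m) = \delta(a) - [\eta, f^m](a / f^m)$, where $[\eta, f^m]$ has to be the extension of $[\delta, f^m]$, an
operator of smaller order. This is taken as the definition of \<open>\<eta>\<close>. All the properties of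
extensions of lower order that are needed to verify it follow from their uniqueness: an operator of
order \<open>n\<close> on \<open>L\<close> that extends \<open>\<epsilon>\<close> is \<open>e \<epsilon>\<close>.\<close>

lemma extension_exists:
  "\<delta> \<in> Dn n \<Longrightarrow> \<exists>\<eta>\<in>L.Dn n. extends \<eta> \<delta>"
proof (induction n arbitrary: \<delta>)
  case 0
  then obtain a where a: "a \<in> carrier R" "\<delta> = lm a" by auto
  show ?case by (rule bexI[of _ "L.lm (frac a 0)"]) (use a in \<open>auto simp: extends_def L_mult\<close>)
next
  case (Suc n)
  define e where "e \<epsilon> = (SOME \<eta>. \<eta> \<in> L.Dn n \<and> extends \<eta> \<epsilon>)" for \<epsilon>
  have e: "e \<epsilon> \<in> L.Dn n" "extends (e \<epsilon>) \<epsilon>" if "\<epsilon> \<in> Dn n" for \<epsilon>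
    using someI_ex[of "\<lambda>\<eta>. \<eta> \<in> L.Dn n \<and> extends \<eta> \<epsilon>"] Suc.IH[OF that] unfolding e_def by blast+
  have eE: "e \<epsilon> \<in> carrier L.E" if "\<epsilon> \<in> Dn n" for \<epsilon> using e(1)[OF that] L.Dn_E by blast
  have e_frac: "e \<epsilon> (frac a 0) = frac (\<epsilon> a) 0" if "\<epsilon> \<in> Dn n" "a \<in> carrier R" for \<epsilon> a
    using e(2)[OF that(1)] that by (simp add: extends_def)
  have e_eq: "\<eta> = e \<epsilon>" if "\<epsilon> \<in> Dn n" "\<eta> \<in> L.Dn n" "extends \<eta> \<epsilon>" for \<eta> \<epsilon>
    using extension_unique[OF that(2) e(1)[OF that(1)] that(3) e(2)[OF that(1)] Dn_E[OF that(1)]] .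
  have e_ad: "e (ad r \<epsilon>) = L.ad (frac r 0) (e \<epsilon>)" if d: "\<epsilon> \<in> Dn n" and r: "r \<in> carrier R" for \<epsilon> r
  proof (rule e_eq[symmetric])
    show "ad r \<epsilon> \<in> Dn n" using Dn_mono[OF ad_Dn[OF d r]] by simp
    show "L.ad (frac r 0) (e \<epsilon>) \<in> L.Dn n" using L.Dn_mono[OF L.ad_Dn[OF e(1)[OF d]]] r by simp
    show "extends (L.ad (frac r 0) (e \<epsilon>)) (ad r \<epsilon>)"
      using r d eE[OF d] Dn_E[OF d] by (auto simp: extends_def e_frac L_mult frac_minus)
  qed
  have dE: "\<delta> \<in> carrier E" using Suc.prems Dn_E by blast
  have adn: "ad r \<delta> \<in> Dn n" if "r \<in> carrier R" for r using Suc.prems that by (simp add: Dn_Suc_iff)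
  define \<beta> where "\<beta> m = e (ad (fpow m) \<delta>)" for m
  have \<beta>E: "\<beta> m \<in> carrier L.E" for m unfolding \<beta>_def using eE adn by simp
  define val where "val a m = frac \<one> m \<otimes>\<^bsub>L\<^esub> (frac (\<delta> a) 0 \<ominus>\<^bsub>L\<^esub> \<beta> m (frac a m))" for a m
  have val_closed: "val a m \<in> carrier L" if "a \<in> carrier R" for a m
    unfolding val_def using that dE \<beta>E by simp
  \<comment> \<open>Enlarging the fraction by \<open>f\<^sup>l\<close> does not change the value, because $[\delta, uv] = [\delta, u] v + u [\delta, v]$.
    Two representatives of the same element have a common enlargement, whence \<open>val_wd\<close>.\<close>
  have val_shift: "val (fpow l \<otimes> a) (m + l) = val a m" if a: "a \<in> carrier R" for a l m
  proof -
    define u v where "u = fpow l" and "v = fpow m"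
    have uv: "u \<in> carrier R" "v \<in> carrier R" by (auto simp: u_def v_def)
    define X where "X = frac a m"
    have X: "X \<in> carrier L" using a by (simp add: X_def)
    have adsum: "ad (fpow (m + l)) \<delta> = ad u \<delta> \<otimes>\<^bsub>E\<^esub> lm v \<oplus>\<^bsub>E\<^esub> lm u \<otimes>\<^bsub>E\<^esub> ad v \<delta>"
    proof (rule E_eqI)
      fix x assume x: "x \<in> carrier R"
      have p: "fpow (m + l) = u \<otimes> v" by (simp add: u_def v_def fpow_add R.m_comm)
      define p q s where "p = \<delta> (u \<otimes> (v \<otimes> x))" and "q = \<delta> (v \<otimes> x)" and "s = \<delta> x"
      have c: "p \<in> carrier R" "q \<in> carrier R" "s \<in> carrier R" using uv x dE by (auto simp: p_def q_def s_def)
      have "p \<ominus> (u \<otimes> v) \<otimes> s = (p \<ominus> u \<otimes> q) \<oplus> u \<otimes> (q \<ominus> v \<otimes> s)"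
        using c uv by algebra
      then show "ad (fpow (m + l)) \<delta> x = (ad u \<delta> \<otimes>\<^bsub>E\<^esub> lm v \<oplus>\<^bsub>E\<^esub> lm u \<otimes>\<^bsub>E\<^esub> ad v \<delta>) x"
        unfolding p using uv x dE by (simp add: p_def q_def s_def R.m_assoc)
    qed (use uv dE in \<open>auto intro!: ad_in_E lm_in_E E.a_closed E.m_closed\<close>)
    have LD: "L.lm (frac u 0) \<otimes>\<^bsub>L.E\<^esub> e (ad v \<delta>) \<in> L.Dn n" "e (ad u \<delta>) \<otimes>\<^bsub>L.E\<^esub> L.lm (frac v 0) \<in> L.Dn n"
      using L.Dn_mult[OF L.lm_Dn[of _ 0] e(1)[OF adn[OF uv(2)]]] L.Dn_mult[OF e(1)[OF adn[OF uv(1)]] L.lm_Dn[of _ 0]] uv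
      by auto
    have RD: "lm u \<otimes>\<^bsub>E\<^esub> ad v \<delta> \<in> Dn n" "ad u \<delta> \<otimes>\<^bsub>E\<^esub> lm v \<in> Dn n"
      using Dn_mult[OF lm_Dn[of _ 0] adn[OF uv(2)]] Dn_mult[OF adn[OF uv(1)] lm_Dn[of _ 0]] uv by auto
    have ext: "extends (e (ad u \<delta>) \<otimes>\<^bsub>L.E\<^esub> L.lm (frac v 0) \<oplus>\<^bsub>L.E\<^esub> L.lm (frac u 0) \<otimes>\<^bsub>L.E\<^esub> e (ad v \<delta>))
       (ad u \<delta> \<otimes>\<^bsub>E\<^esub> lm v \<oplus>\<^bsub>E\<^esub> lm u \<otimes>\<^bsub>E\<^esub> ad v \<delta>)"
      unfolding extends_def
    proof
      fix r assume r: "r \<in> carrier R"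
      have c: "ad u \<delta> (v \<otimes> r) \<in> carrier R" "ad v \<delta> r \<in> carrier R"
        using E_closed[OF ad_in_E[OF dE uv(1)], of "v \<otimes> r"] E_closed[OF ad_in_E[OF dE uv(2)] r] uv r
        by (simp_all del: app_ad)
      then show "(e (ad u \<delta>) \<otimes>\<^bsub>L.E\<^esub> L.lm (frac v 0) \<oplus>\<^bsub>L.E\<^esub> L.lm (frac u 0) \<otimes>\<^bsub>L.E\<^esub> e (ad v \<delta>)) (frac r 0) =
          frac ((ad u \<delta> \<otimes>\<^bsub>E\<^esub> lm v \<oplus>\<^bsub>E\<^esub> lm u \<otimes>\<^bsub>E\<^esub> ad v \<delta>) r) 0"
        using uv r e_frac[OF adn[OF uv(1)], of "v \<otimes> r"] e_frac[OF adn[OF uv(2)], of r]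
        by (simp add: L_mult L_add_same[symmetric] del: app_ad)
    qed
    have "\<beta> (m + l) = e (ad u \<delta>) \<otimes>\<^bsub>L.E\<^esub> L.lm (frac v 0) \<oplus>\<^bsub>L.E\<^esub> L.lm (frac u 0) \<otimes>\<^bsub>L.E\<^esub> e (ad v \<delta>)"
      unfolding \<beta>_def adsum using e_eq[OF Dn_add[OF RD(2,1)] L.Dn_add[OF LD(2,1)] ext] by (rule sym)
    then have "\<beta> (m + l) X = e (ad u \<delta>) (frac v 0 \<otimes>\<^bsub>L\<^esub> X) \<oplus>\<^bsub>L\<^esub> frac u 0 \<otimes>\<^bsub>L\<^esub> \<beta> m X"
      using X L.E_closed[OF \<beta>E X, of m] by (simp add: \<beta>_def v_def)
    also have "frac v 0 \<otimes>\<^bsub>L\<^esub> X = frac a 0" using a by (simp add: X_def v_def fpow_frac)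
    also have "e (ad u \<delta>) (frac a 0) = frac (\<delta> (u \<otimes> a)) 0 \<ominus>\<^bsub>L\<^esub> frac u 0 \<otimes>\<^bsub>L\<^esub> frac (\<delta> a) 0"
      using a uv dE by (simp add: e_frac adn frac_minus L_mult)
    finally have b: "\<beta> (m + l) X = (frac (\<delta> (u \<otimes> a)) 0 \<ominus>\<^bsub>L\<^esub> frac u 0 \<otimes>\<^bsub>L\<^esub> frac (\<delta> a) 0) \<oplus>\<^bsub>L\<^esub> frac u 0 \<otimes>\<^bsub>L\<^esub> \<beta> m X" .
    define p q s z where "p = frac (\<delta> (u \<otimes> a)) 0" and "q = frac u 0" and "s = frac (\<delta> a) 0" and "z = \<beta> m X"
    have c: "p \<in> carrier L" "q \<in> carrier L" "s \<in> carrier L" "z \<in> carrier L"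
      using uv a dE \<beta>E X by (auto simp: p_def q_def s_def z_def)
    have "p \<ominus>\<^bsub>L\<^esub> ((p \<ominus>\<^bsub>L\<^esub> q \<otimes>\<^bsub>L\<^esub> s) \<oplus>\<^bsub>L\<^esub> q \<otimes>\<^bsub>L\<^esub> z) = q \<otimes>\<^bsub>L\<^esub> (s \<ominus>\<^bsub>L\<^esub> z)" using c by algebra
    then have "frac (\<delta> (u \<otimes> a)) 0 \<ominus>\<^bsub>L\<^esub> \<beta> (m + l) X = frac u 0 \<otimes>\<^bsub>L\<^esub> (frac (\<delta> a) 0 \<ominus>\<^bsub>L\<^esub> \<beta> m X)"
      unfolding b by (simp add: p_def q_def s_def z_def)
    moreover have "frac (u \<otimes> a) (m + l) = X" using a by (simp add: X_def u_def frac_cancel)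
    ultimately have "val (u \<otimes> a) (m + l) = frac \<one> (m + l) \<otimes>\<^bsub>L\<^esub> (frac u 0 \<otimes>\<^bsub>L\<^esub> (s \<ominus>\<^bsub>L\<^esub> z))"
      by (simp add: val_def s_def z_def)
    also have "\<dots> = (frac \<one> (m + l) \<otimes>\<^bsub>L\<^esub> frac u 0) \<otimes>\<^bsub>L\<^esub> (s \<ominus>\<^bsub>L\<^esub> z)"
      using c uv by (intro L.R.m_assoc[symmetric]) auto
    also have "frac \<one> (m + l) \<otimes>\<^bsub>L\<^esub> frac u 0 = frac \<one> m"
      using frac_cancel[of "\<one>" l m] by (simp add: L_mult u_def)
    finally show ?thesis by (simp add: val_def u_def s_def z_def X_def)
  qed
  have val_wd: "val a m = val b k" if ab: "a \<in> carrier R" "b \<in> carrier R" "frac a m = frac b k" for a b m k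
  proof -
    obtain l where l: "fpow l \<otimes> (fpow k \<otimes> a) = fpow l \<otimes> (fpow m \<otimes> b)"
      using ab by (auto simp: frac_eq_iff)
    have "val a m = val (fpow (l + k) \<otimes> a) (m + (l + k))" using val_shift[OF ab(1)] by simp
    also have "\<dots> = val (fpow (l + m) \<otimes> b) (k + (l + m))"
    proof -
      have "fpow (l + k) \<otimes> a = fpow (l + m) \<otimes> b" using l ab by (simp add: fpow_add R.m_assoc)
      moreover have "m + (l + k) = k + (l + m)" by simp
      ultimately show ?thesis by (simp only:)
    qed
    also have "\<dots> = val b k" using val_shift[OF ab(2)] by simp
    finally show ?thesis .
  qed
  define \<eta> where "\<eta> = (\<lambda>X\<in>carrier L. let p = (SOME p. fst p \<in> carrier R \<and> X = frac (fst p) (snd p)) in val (fst p) (snd p))"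
  have \<eta>_frac: "\<eta> (frac a m) = val a m" if a: "a \<in> carrier R" for a m
  proof -
    define p where "p = (SOME p. fst p \<in> carrier R \<and> frac a m = frac (fst p) (snd p))"
    have "fst p \<in> carrier R \<and> frac a m = frac (fst p) (snd p)"
      unfolding p_def by (rule someI[of _ "(a, m)"]) (use a in auto)
    then have "val (fst p) (snd p) = val a m" using val_wd[OF a, of "fst p" m "snd p"] by simp
    then show ?thesis using a by (simp add: \<eta>_def p_def Let_def)
  qed
  have \<eta>E: "\<eta> \<in> carrier L.E"
    unfolding L.E_iff
  proof (intro conjI ballI)
    show "\<eta> \<in> extensional (carrier L)" by (simp add: \<eta>_def)
    fix X assume X: "X \<in> carrier L"
    then obtain a m where a: "a \<in> carrier R" "X = frac a m" by (rule L_cases)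
    then show "\<eta> X \<in> carrier L" by (simp add: \<eta>_frac val_closed)
  next
    fix X Y assume X: "X \<in> carrier L" and Y: "Y \<in> carrier L"
    from X Y obtain a b m where a: "a \<in> carrier R" "b \<in> carrier R" "X = frac a m" "Y = frac b m"
      by (rule L_common_denominator2)
    define p q s t z where "p = frac (\<delta> a) 0" and "q = frac (\<delta> b) 0" and "s = \<beta> m X" and "t = \<beta> m Y" and "z = frac \<one> m"
    have c: "p \<in> carrier L" "q \<in> carrier L" "s \<in> carrier L" "t \<in> carrier L" "z \<in> carrier L"
      using a dE \<beta>E X Y by (auto simp: p_def q_def s_def z_def t_def)
    have "z \<otimes>\<^bsub>L\<^esub> ((p \<oplus>\<^bsub>L\<^esub> q) \<ominus>\<^bsub>L\<^esub> (s \<oplus>\<^bsub>L\<^esub> t)) = z \<otimes>\<^bsub>L\<^esub> (p \<ominus>\<^bsub>L\<^esub> s) \<oplus>\<^bsub>L\<^esub> z \<otimes>\<^bsub>L\<^esub> (q \<ominus>\<^bsub>L\<^esub> t)"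
      using c by algebra
    moreover have "\<beta> m (frac (a \<oplus> b) m) = s \<oplus>\<^bsub>L\<^esub> t"
      using L.E_add[OF \<beta>E X Y, of m] a by (simp add: L_add_same s_def t_def)
    moreover have "frac (\<delta> (a \<oplus> b)) 0 = p \<oplus>\<^bsub>L\<^esub> q" using a dE by (simp add: E_add L_add_same p_def q_def)
    ultimately have "val (a \<oplus> b) m = val a m \<oplus>\<^bsub>L\<^esub> val b m"
      using a by (simp add: val_def p_def q_def s_def t_def z_def)
    then show "\<eta> (X \<oplus>\<^bsub>L\<^esub> Y) = \<eta> X \<oplus>\<^bsub>L\<^esub> \<eta> Y" using a by (simp add: L_add_same \<eta>_frac)
  next
    fix c X assume k: "c \<in> carrier K" and X: "X \<in> carrier L"
    from X obtain a m where a: "a \<in> carrier R" "X = frac a m" by (rule L_cases)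
    define p s z where "p = frac (\<delta> a) 0" and "s = \<beta> m X" and "z = frac \<one> m"
    have c: "p \<in> carrier L" "s \<in> carrier L" "z \<in> carrier L"
      using a dE \<beta>E X by (auto simp: p_def s_def z_def)
    have "c \<odot>\<^bsub>L\<^esub> (z \<otimes>\<^bsub>L\<^esub> (p \<ominus>\<^bsub>L\<^esub> s)) = z \<otimes>\<^bsub>L\<^esub> (c \<odot>\<^bsub>L\<^esub> p \<ominus>\<^bsub>L\<^esub> c \<odot>\<^bsub>L\<^esub> s)"
      using c k by (simp add: L.smult_assoc3[symmetric] a_minus_def L.V.smult_r_distr L.V.smult_r_minus)
    moreover have "\<beta> m (frac (c \<odot> a) m) = c \<odot>\<^bsub>L\<^esub> s"
      using L.E_smult[OF \<beta>E k X, of m] a k by (simp add: L_smult s_def)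
    moreover have "frac (\<delta> (c \<odot> a)) 0 = c \<odot>\<^bsub>L\<^esub> p" using a k dE by (simp add: E_smult L_smult p_def)
    ultimately have "val (c \<odot> a) m = c \<odot>\<^bsub>L\<^esub> val a m"
      using a by (simp add: val_def p_def s_def z_def)
    then show "\<eta> (c \<odot>\<^bsub>L\<^esub> X) = c \<odot>\<^bsub>L\<^esub> \<eta> X" using a k by (simp add: L_smult \<eta>_frac)
  qed
  \<comment> \<open>The commutator with an element of \<open>R\<close> is the extension of \<open>ad r \<delta>\<close>. This uses that \<open>ad r\<close> commutes
    with \<open>ad (f\<^sup>m)\<close>.\<close>
  have ad_num: "L.ad (frac r 0) \<eta> = e (ad r \<delta>)" if r: "r \<in> carrier R" for r
  proof (rule L.E_eqI)
    define \<gamma> where "\<gamma> = ad r \<delta>"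
    have g: "\<gamma> \<in> Dn n" unfolding \<gamma>_def using adn r by blast
    fix X assume X: "X \<in> carrier L"
    then obtain a m where a: "a \<in> carrier R" "X = frac a m" by (rule L_cases)
    have "L.ad (frac r 0) (\<beta> m) = e (ad r (ad (fpow m) \<delta>))" unfolding \<beta>_def using e_ad adn r by simp
    also have "ad r (ad (fpow m) \<delta>) = ad (fpow m) \<gamma>" unfolding \<gamma>_def using dE r by (intro ad_commute) auto
    also have "e (ad (fpow m) \<gamma>) = L.ad (frac (fpow m) 0) (e \<gamma>)" using e_ad g by simp
    finally have "L.ad (frac r 0) (\<beta> m) X = L.ad (frac (fpow m) 0) (e \<gamma>) X" by simp
    then have "\<beta> m (frac r 0 \<otimes>\<^bsub>L\<^esub> X) \<ominus>\<^bsub>L\<^esub> frac r 0 \<otimes>\<^bsub>L\<^esub> \<beta> m X = e \<gamma> (frac a 0) \<ominus>\<^bsub>L\<^esub> frac (fpow m) 0 \<otimes>\<^bsub>L\<^esub> e \<gamma> X"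
      using X r \<beta>E eE[OF g] a by (simp add: fpow_frac)
    also have "e \<gamma> (frac a 0) = frac (\<delta> (r \<otimes> a)) 0 \<ominus>\<^bsub>L\<^esub> frac r 0 \<otimes>\<^bsub>L\<^esub> frac (\<delta> a) 0"
      using e_frac[OF g a(1)] r a dE by (simp add: \<gamma>_def frac_minus L_mult)
    finally have k: "\<beta> m (frac r 0 \<otimes>\<^bsub>L\<^esub> X) \<ominus>\<^bsub>L\<^esub> frac r 0 \<otimes>\<^bsub>L\<^esub> \<beta> m X =
      (frac (\<delta> (r \<otimes> a)) 0 \<ominus>\<^bsub>L\<^esub> frac r 0 \<otimes>\<^bsub>L\<^esub> frac (\<delta> a) 0) \<ominus>\<^bsub>L\<^esub> frac (fpow m) 0 \<otimes>\<^bsub>L\<^esub> e \<gamma> X" .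
    define p q s t z w g' where "p = \<beta> m (frac r 0 \<otimes>\<^bsub>L\<^esub> X)" and "q = frac r 0" and "s = \<beta> m X"
      and "t = frac (\<delta> (r \<otimes> a)) 0" and "z = frac (\<delta> a) 0" and "w = frac (fpow m) 0" and "g' = e \<gamma> X"
    define y where "y = frac \<one> m"
    have c: "p \<in> carrier L" "q \<in> carrier L" "s \<in> carrier L" "t \<in> carrier L" "z \<in> carrier L" "w \<in> carrier L" "g' \<in> carrier L" "y \<in> carrier L"
      using X r \<beta>E eE[OF g] a dE by (auto simp: p_def q_def s_def t_def z_def w_def g'_def y_def)
    have k': "p \<ominus>\<^bsub>L\<^esub> q \<otimes>\<^bsub>L\<^esub> s = (t \<ominus>\<^bsub>L\<^esub> q \<otimes>\<^bsub>L\<^esub> z) \<ominus>\<^bsub>L\<^esub> w \<otimes>\<^bsub>L\<^esub> g'"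
      using k by (simp add: p_def q_def s_def t_def z_def w_def g'_def)
    have wy: "w \<otimes>\<^bsub>L\<^esub> y = \<one>\<^bsub>L\<^esub>" by (simp add: w_def y_def fpow_inverse)
    have "frac r 0 \<otimes>\<^bsub>L\<^esub> X = frac (r \<otimes> a) m" using r a by (simp add: L_mult)
    then have "L.ad (frac r 0) \<eta> X = y \<otimes>\<^bsub>L\<^esub> (t \<ominus>\<^bsub>L\<^esub> p) \<ominus>\<^bsub>L\<^esub> q \<otimes>\<^bsub>L\<^esub> (y \<otimes>\<^bsub>L\<^esub> (z \<ominus>\<^bsub>L\<^esub> s))"
      using \<eta>E r a X by (simp add: \<eta>_frac val_def p_def q_def s_def t_def z_def y_def)
    also have "\<dots> = y \<otimes>\<^bsub>L\<^esub> ((t \<ominus>\<^bsub>L\<^esub> q \<otimes>\<^bsub>L\<^esub> z) \<ominus>\<^bsub>L\<^esub> (p \<ominus>\<^bsub>L\<^esub> q \<otimes>\<^bsub>L\<^esub> s))" using c by algebra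
    also have "\<dots> = (w \<otimes>\<^bsub>L\<^esub> y) \<otimes>\<^bsub>L\<^esub> g'" unfolding k' using c by algebra
    finally show "L.ad (frac r 0) \<eta> X = e (ad r \<delta>) X" using c wy by (simp add: g'_def \<gamma>_def)
  qed (use r adn eE \<eta>E in \<open>auto intro!: L.ad_in_E\<close>)
  have "L.ad Y \<eta> \<in> L.Dn n" if Y: "Y \<in> carrier L" for Y
  proof -
    obtain r m where r: "r \<in> carrier R" "Y = frac r m" using Y by (rule L_cases)
    define y z w where "y = frac r 0" and "z = frac \<one> m" and "w = frac (fpow m) 0"
    have c: "y \<in> carrier L" "z \<in> carrier L" "w \<in> carrier L" using r by (auto simp: y_def z_def w_def)
    have wz: "w \<otimes>\<^bsub>L\<^esub> z = \<one>\<^bsub>L\<^esub>" by (simp add: w_def z_def fpow_inverse)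
    have Y: "Y = y \<otimes>\<^bsub>L\<^esub> z" using r by (simp add: y_def z_def L_mult)
    have ay: "L.ad y \<eta> \<in> L.Dn n" unfolding y_def using ad_num[OF r(1)] e(1) adn r by simp
    have aw: "L.ad w \<eta> \<in> L.Dn n" unfolding w_def using ad_num[of "fpow m"] e(1) adn by simp
    have "L.ad y \<eta> \<otimes>\<^bsub>L.E\<^esub> L.lm z \<in> L.Dn n" "L.ad w \<eta> \<otimes>\<^bsub>L.E\<^esub> L.lm z \<in> L.Dn n"
      using L.Dn_mult[OF ay L.lm_Dn[OF c(2), of 0]] L.Dn_mult[OF aw L.lm_Dn[OF c(2), of 0]] by simp_all
    moreover from this(2) have "L.lm Y \<otimes>\<^bsub>L.E\<^esub> (L.ad w \<eta> \<otimes>\<^bsub>L.E\<^esub> L.lm z) \<in> L.Dn n"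
      using L.Dn_mult[OF L.lm_Dn[OF that, of 0]] by simp
    \<comment> \<open>For a denominator, \<open>w z = 1\<close> gives $[\eta, z] = - z [\eta, w] z$.\<close>
    moreover have "L.ad Y \<eta> = (L.ad y \<eta> \<otimes>\<^bsub>L.E\<^esub> L.lm z) \<ominus>\<^bsub>L.E\<^esub> L.lm Y \<otimes>\<^bsub>L.E\<^esub> (L.ad w \<eta> \<otimes>\<^bsub>L.E\<^esub> L.lm z)"
    proof (rule L.E_eqI)
      fix X assume X: "X \<in> carrier L"
      define p q s where "p = \<eta> (y \<otimes>\<^bsub>L\<^esub> (z \<otimes>\<^bsub>L\<^esub> X))" and "q = \<eta> (z \<otimes>\<^bsub>L\<^esub> X)" and "s = \<eta> X"
      have c': "p \<in> carrier L" "q \<in> carrier L" "s \<in> carrier L" using X c \<eta>E by (auto simp: p_def q_def s_def)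
      have "w \<otimes>\<^bsub>L\<^esub> (z \<otimes>\<^bsub>L\<^esub> X) = X" using wz X c by (simp add: L.R.m_assoc[symmetric])
      then have "((L.ad y \<eta> \<otimes>\<^bsub>L.E\<^esub> L.lm z) \<ominus>\<^bsub>L.E\<^esub> L.lm Y \<otimes>\<^bsub>L.E\<^esub> (L.ad w \<eta> \<otimes>\<^bsub>L.E\<^esub> L.lm z)) X =
        (p \<ominus>\<^bsub>L\<^esub> y \<otimes>\<^bsub>L\<^esub> q) \<ominus>\<^bsub>L\<^esub> (y \<otimes>\<^bsub>L\<^esub> z) \<otimes>\<^bsub>L\<^esub> (s \<ominus>\<^bsub>L\<^esub> w \<otimes>\<^bsub>L\<^esub> q)"
        using X c \<eta>E Y by (simp add: L.ad_in_E L.lm_in_E p_def q_def s_def)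
      also have "\<dots> = (p \<ominus>\<^bsub>L\<^esub> y \<otimes>\<^bsub>L\<^esub> q) \<ominus>\<^bsub>L\<^esub> (y \<otimes>\<^bsub>L\<^esub> z) \<otimes>\<^bsub>L\<^esub> s \<oplus>\<^bsub>L\<^esub> y \<otimes>\<^bsub>L\<^esub> (w \<otimes>\<^bsub>L\<^esub> z) \<otimes>\<^bsub>L\<^esub> q"
        using c c' by algebra
      also have "\<dots> = p \<ominus>\<^bsub>L\<^esub> (y \<otimes>\<^bsub>L\<^esub> z) \<otimes>\<^bsub>L\<^esub> s"
        unfolding wz L.R.r_one[OF c(1)] using c c' by algebra
      also have "\<dots> = L.ad Y \<eta> X" using X c \<eta>E Y by (simp add: p_def s_def L.R.m_assoc)
      finally show "L.ad Y \<eta> X = ((L.ad y \<eta> \<otimes>\<^bsub>L.E\<^esub> L.lm z) \<ominus>\<^bsub>L.E\<^esub> L.lm Y \<otimes>\<^bsub>L.E\<^esub> (L.ad w \<eta> \<otimes>\<^bsub>L.E\<^esub> L.lm z)) X" by simp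
    qed (use c \<eta>E that in \<open>auto intro!: L.ad_in_E L.lm_in_E L.E.minus_closed L.E.m_closed\<close>)
    ultimately show ?thesis using L.Dn_minus by simp
  qed
  then have "\<eta> \<in> L.Dn (Suc n)" using \<eta>E by (simp add: L.Dn_Suc_iff)
  moreover have "extends \<eta> \<delta>"
    unfolding extends_def
  proof
    fix r assume r: "r \<in> carrier R"
    have "ad (fpow 0) \<delta> r = \<zero>" using r dE by simp
    then have "\<beta> 0 (frac r 0) = \<zero>\<^bsub>L\<^esub>"
      using e_frac[OF adn[of "fpow 0"] r] unfolding \<beta>_def L_zero by (simp only: R.nat_pow_closed f)
    then have "val r 0 = frac (\<delta> r) 0" using r dE by (simp add: val_def L_one[symmetric] a_minus_def)
    then show "\<eta> (frac r 0) = frac (\<delta> r) 0" using r by (simp add: \<eta>_frac)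
  qed
  ultimately show ?case by blast
qed

lemma loc_extension_props:
  assumes "\<delta> \<in> carrier D"
  shows "loc_extension K R f \<delta> \<in> carrier L.D" "r \<in> carrier R \<Longrightarrow> loc_extension K R f \<delta> (frac r 0) = frac (\<delta> r) 0"
proof -
  have "\<exists>!\<eta>. \<eta> \<in> carrier L.D \<and> extends \<eta> \<delta>"
  proof (rule ex_ex1I)
    show "\<exists>\<eta>. \<eta> \<in> carrier L.D \<and> extends \<eta> \<delta>"
      using assms extension_exists L.D_iff D_iff by meson
    fix \<eta> \<eta>' assume a: "\<eta> \<in> carrier L.D \<and> extends \<eta> \<delta>" "\<eta>' \<in> carrier L.D \<and> extends \<eta>' \<delta>"
    then obtain n where "\<eta> \<in> L.Dn n" "\<eta>' \<in> L.Dn n" using L.D_common by blast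
    then show "\<eta> = \<eta>'" using extension_unique a D_E[OF assms] by blast
  qed
  then have "loc_extension K R f \<delta> \<in> carrier L.D \<and> extends (loc_extension K R f \<delta>) \<delta>"
    unfolding loc_extension_def extends_def by (rule theI')
  then show "loc_extension K R f \<delta> \<in> carrier L.D" "r \<in> carrier R \<Longrightarrow> loc_extension K R f \<delta> (frac r 0) = frac (\<delta> r) 0"
    by (auto simp: extends_def)
qed

end

section \<open>Filtered rings of differential operators\<close>

locale field_algebra = k_algebra K R for K :: "'k ring" and R :: "('k, 'r) module" (structure) +
  assumes field: "field K"
begin

sublocale VS: vectorspace K R
  by (intro vectorspace.intro V.module_axioms field)

sublocale DV: vectorspace K D
  by (intro vectorspace.intro D_module field)

lemma app_lin_sum_ops:
  assumes "\<And>s. s < r \<Longrightarrow> c s \<in> carrier K" "\<And>s. s < r \<Longrightarrow> \<delta> s \<in> carrier D" "x \<in> carrier R"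
  shows "DV.lin_sum c \<delta> r x = VS.lin_sum c (\<lambda>s. \<delta> s x) r"
  using assms
proof (induction r)
  case (Suc r)
  have "DV.lin_sum c \<delta> (Suc r) = DV.lin_sum c \<delta> r \<oplus>\<^bsub>D\<^esub> c r \<odot>\<^bsub>D\<^esub> \<delta> r" using Suc.prems by (intro DV.lin_sum_Suc) auto
  moreover have "VS.lin_sum c (\<lambda>s. \<delta> s x) (Suc r) = VS.lin_sum c (\<lambda>s. \<delta> s x) r \<oplus> c r \<odot> \<delta> r x"
    using Suc.prems D_E by (intro VS.lin_sum_Suc) auto
  ultimately show ?case using Suc by simp
qed simp

lemma app_lin_sum:
  assumes "\<phi> \<in> carrier E" "\<And>s. s < r \<Longrightarrow> c s \<in> carrier K" "\<And>s. s < r \<Longrightarrow> v s \<in> carrier R"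
  shows "\<phi> (VS.lin_sum c v r) = VS.lin_sum c (\<lambda>s. \<phi> (v s)) r"
  using assms(2,3)
proof (induction r)
  case 0 then show ?case using E_zero[OF assms(1)] by simp
next
  case (Suc r)
  have "VS.lin_sum c v (Suc r) = VS.lin_sum c v r \<oplus> c r \<odot> v r" using Suc.prems by (intro VS.lin_sum_Suc) auto
  moreover have "VS.lin_sum c (\<lambda>s. \<phi> (v s)) (Suc r) = VS.lin_sum c (\<lambda>s. \<phi> (v s)) r \<oplus> c r \<odot> \<phi> (v r)"
    using Suc.prems assms(1) by (intro VS.lin_sum_Suc) auto
  ultimately show ?case using Suc assms(1) by (simp add: E_add E_smult VS.lin_sum_closed)
qed

end

locale filtered_ops = field_algebra K R for K :: "'k ring" and R :: "('k, 'r) module" (structure) +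
  fixes F :: "nat \<Rightarrow> ('r \<Rightarrow> 'r) set"
  assumes filt: "filtration K (diff_ops K R) F"
begin

lemma F_fin_dim: "fin_dim_subspace K D (F i)"
  and F_Suc: "F i \<subseteq> F (Suc i)"
  and F_exhaust: "(\<Union>i. F i) = carrier D"
  and F_mult: "\<phi> \<in> F i \<Longrightarrow> \<psi> \<in> F j \<Longrightarrow> \<phi> \<otimes>\<^bsub>E\<^esub> \<psi> \<in> F (i + j)"
  using filt by (auto simp: filtration_def)

lemma F_sub: "subspace K (F i) D" using F_fin_dim by (simp add: fin_dim_subspace_def)

lemma F_submodule: "submodule K (F i) D" using F_sub by (simp add: subspace_def)

lemma F_add: "\<phi> \<in> F i \<Longrightarrow> \<psi> \<in> F i \<Longrightarrow> \<phi> \<oplus>\<^bsub>E\<^esub> \<psi> \<in> F i"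
  using submodule.m_closed[OF F_submodule] by simp

lemma F_smult: "c \<in> carrier K \<Longrightarrow> \<phi> \<in> F i \<Longrightarrow> c \<odot>\<^bsub>E\<^esub> \<phi> \<in> F i"
  using submodule.smult_closed[OF F_submodule] by simp

lemma F_zero: "\<zero>\<^bsub>E\<^esub> \<in> F i"
  using submodule.zero_closed[OF F_submodule] by simp

lemma F_D: "\<phi> \<in> F i \<Longrightarrow> \<phi> \<in> carrier D" using F_exhaust by blast

lemma F_E: "\<phi> \<in> F i \<Longrightarrow> \<phi> \<in> carrier E" using F_D D_E by blast

lemma F_mono: "i \<le> j \<Longrightarrow> \<phi> \<in> F i \<Longrightarrow> \<phi> \<in> F j"
  by (induction j) (use F_Suc in \<open>auto simp: le_Suc_eq\<close>)

lemma F_minus: "\<phi> \<in> F i \<Longrightarrow> \<psi> \<in> F i \<Longrightarrow> \<phi> \<ominus>\<^bsub>E\<^esub> \<psi> \<in> F i"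
  using DV.subspace_minus[OF F_sub, of \<phi> i \<psi>] by (simp add: D_minus F_D)

text \<open>The subspace \<open>F\<^sup>i x\<close>; for varying \<open>i\<close> these form the filtration of the cyclic module \<open>D x\<close> that is
generated by \<open>x\<close>.\<close>

definition orb :: "nat \<Rightarrow> 'r \<Rightarrow> 'r set" where
  "orb i x = (\<lambda>\<phi>. \<phi> x) ` F i"

lemma orb_sub: "x \<in> carrier R \<Longrightarrow> subspace K (orb i x) R"
proof -
  assume x: "x \<in> carrier R"
  have "submodule K (orb i x) R"
  proof (rule submodule.intro)
    show "module K R" by (rule V.module_axioms)
    show "orb i x \<subseteq> carrier R" using x F_E by (auto simp: orb_def)
    show "\<zero> \<in> orb i x" using x F_zero[of i] app_zero[OF x] unfolding orb_def by (metis image_eqI)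
    fix v w assume "v \<in> orb i x" "w \<in> orb i x"
    then obtain \<phi> \<psi> where "\<phi> \<in> F i" "\<psi> \<in> F i" "v = \<phi> x" "w = \<psi> x" by (auto simp: orb_def)
    then show "v \<oplus> w \<in> orb i x" using F_add[of \<phi> i \<psi>] app_add[OF x, of \<phi> \<psi>] unfolding orb_def by (metis image_eqI)
  next
    fix c v assume c: "c \<in> carrier K" "v \<in> orb i x"
    then obtain \<phi> where "\<phi> \<in> F i" "v = \<phi> x" by (auto simp: orb_def)
    then show "c \<odot> v \<in> orb i x" using F_smult[of c \<phi> i] app_smult[OF x, of c \<phi>] c unfolding orb_def by (metis image_eqI)
  qed
  then show ?thesis by (simp add: subspace_def VS.vectorspace_axioms)
qed

lemma orb_mono: "i \<le> j \<Longrightarrow> orb i x \<subseteq> orb j x"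
  using F_mono by (auto simp: orb_def)

lemma orb_apply: "x \<in> carrier R \<Longrightarrow> \<phi> \<in> F i \<Longrightarrow> u \<in> orb j x \<Longrightarrow> \<phi> u \<in> orb (i + j) x"
proof -
  assume x: "x \<in> carrier R" and p: "\<phi> \<in> F i" and "u \<in> orb j x"
  then obtain \<psi> where "\<psi> \<in> F j" "u = \<psi> x" by (auto simp: orb_def)
  then show "\<phi> u \<in> orb (i + j) x"
    using F_mult[OF p, of \<psi> j] app_mult[OF x, of \<phi> \<psi>] unfolding orb_def by (intro image_eqI[of _ _ "\<phi> \<otimes>\<^bsub>E\<^esub> \<psi>"]) auto
qed

text \<open>Dimension count for Bernstein's inequality. An operator in \<open>F\<^sup>i\<close> induces a linear map from \<open>W0 / W1\<close>, a
space generated by \<open>a\<close> vectors, to \<open>W0' / W1'\<close>, which is generated by \<open>b\<close> vectors. If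
\<open>dim F\<^sup>i\<close> exceeds \<open>a b\<close>, then some nonzero operator induces the zero map.\<close>

lemma operator_into_subspace:
  assumes W0: "subspace K W0 R" and W1: "subspace K W1 R" and W0': "subspace K W0' R" and W1': "subspace K W1' R"
    and W10: "W1 \<subseteq> W0"
    and v: "\<And>l. l < a \<Longrightarrow> v l \<in> W0" "VS.spans_mod W1 W0 v a"
    and y: "\<And>j. j < b \<Longrightarrow> y j \<in> W0'" "VS.spans_mod W1' W0' y b"
    and F0: "\<And>\<delta> u. \<delta> \<in> F i \<Longrightarrow> u \<in> W0 \<Longrightarrow> \<delta> u \<in> W0'"
    and F1: "\<And>\<delta> u. \<delta> \<in> F i \<Longrightarrow> u \<in> W1 \<Longrightarrow> \<delta> u \<in> W1'"
    and dim: "a * b < subspace_dim K D (F i)"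
  shows "\<exists>\<delta>\<in>F i. \<delta> \<noteq> \<zero>\<^bsub>E\<^esub> \<and> (\<forall>u\<in>W0. \<delta> u \<in> W1')"
proof -
  interpret W0: submodule K W0 R using W0 by (simp add: subspace_def)
  interpret W0': submodule K W0' R using W0' by (simp add: subspace_def)
  interpret W1': submodule K W1' R using W1' by (simp add: subspace_def)
  define r where "r = subspace_dim K D (F i)"
  obtain \<delta> where d: "\<forall>s<r. \<delta> s \<in> F i" "DV.indep_mod {\<zero>\<^bsub>D\<^esub>} \<delta> r"
    using exists_indep_dim[OF DV.vectorspace_axioms F_fin_dim[of i]] unfolding r_def by blast
  have vc: "v l \<in> carrier R" if "l < a" for l using v(1)[OF that] W0.subset by blast
  have yc: "y j \<in> carrier R" if "j < b" for j using y(1)[OF that] W0'.subset by blast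
  have "\<exists>m. (\<forall>j<b. m j \<in> carrier K) \<and> \<delta> s (v l) \<ominus> VS.lin_sum m y b \<in> W1'" if "s < r" "l < a" for s l
    using y(2) F0[OF _ v(1)[OF that(2)]] d(1) that(1) unfolding VS.spans_mod_def by blast
  then obtain m where m: "\<And>s l. s < r \<Longrightarrow> l < a \<Longrightarrow> (\<forall>j<b. m s l j \<in> carrier K) \<and> \<delta> s (v l) \<ominus> VS.lin_sum (m s l) y b \<in> W1'"
    by metis
  \<comment> \<open>The \<open>a b\<close> matrix entries of a linear map, numbered by \<open>e = l b + j\<close>.\<close>
  define M where "M e s = m s (e div b) (e mod b)" for e s
  have "M e s \<in> carrier K" if "e < a * b" "s \<in> {..<r}" for e s
  proof -
    have "b > 0" using that by (cases b) auto
    moreover have "e div b < a" using that(1) by (simp add: less_mult_imp_div_less)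
    ultimately show ?thesis unfolding M_def using m[of s "e div b"] that by auto
  qed
  then obtain c where c: "c \<in> {..<r} \<rightarrow> carrier K" "\<exists>s\<in>{..<r}. c s \<noteq> \<zero>\<^bsub>K\<^esub>"
    "\<forall>e<a*b. (\<Oplus>\<^bsub>K\<^esub>s\<in>{..<r}. M e s \<otimes>\<^bsub>K\<^esub> c s) = \<zero>\<^bsub>K\<^esub>"
    using VS.homogeneous_system_nontrivial_solution[of "{..<r}" "a * b" M] dim by (auto simp: r_def)
  have cc: "c s \<in> carrier K" if "s < r" for s using c(1) that by auto
  have dD: "\<delta> s \<in> carrier D" if "s < r" for s using d(1) that F_D by blast
  define \<theta> where "\<theta> = DV.lin_sum c \<delta> r"
  have \<theta>F: "\<theta> \<in> F i" unfolding \<theta>_def using cc d(1) by (intro DV.lin_sum_in_subspace[OF F_sub]) auto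
  have \<theta>E: "\<theta> \<in> carrier E" using \<theta>F F_E by blast
  have "\<theta> \<noteq> \<zero>\<^bsub>E\<^esub>"
  proof
    assume "\<theta> = \<zero>\<^bsub>E\<^esub>"
    then have "\<forall>s<r. c s = \<zero>\<^bsub>K\<^esub>" using DV.indep_modD[OF d(2), of c] cc by (simp add: \<theta>_def)
    then show False using c(2) by auto
  qed
  moreover have \<theta>v: "\<theta> (v l) \<in> W1'" if l: "l < a" for l
  proof -
    have ml: "\<And>s j. s < r \<Longrightarrow> j < b \<Longrightarrow> m s l j \<in> carrier K" using m l by blast
    have "VS.lin_sum c (\<lambda>s. \<delta> s (v l) \<ominus> VS.lin_sum (m s l) y b) r \<in> W1'"
      using m l cc by (intro VS.lin_sum_in_subspace[OF W1']) auto
    also have "VS.lin_sum c (\<lambda>s. \<delta> s (v l) \<ominus> VS.lin_sum (m s l) y b) r =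
       VS.lin_sum c (\<lambda>s. \<delta> s (v l)) r \<ominus> VS.lin_sum c (\<lambda>s. VS.lin_sum (m s l) y b) r"
      using cc dD D_E vc l ml yc by (intro VS.lin_sum_minus_right) (auto intro!: VS.lin_sum_closed)
    also have "VS.lin_sum c (\<lambda>s. VS.lin_sum (m s l) y b) r = VS.lin_sum (\<lambda>j. \<Oplus>\<^bsub>K\<^esub>s\<in>{..<r}. m s l j \<otimes>\<^bsub>K\<^esub> c s) y b"
      using cc ml yc by (intro VS.lin_sum_lin_sum)
    also have "\<dots> = \<zero>"
    proof (intro VS.lin_sum_zero)
      fix j assume j: "j < b"
      have "(l * b + j) div b = l" "(l * b + j) mod b = j" using j by auto
      moreover have "l * b + j < a * b"
      proof -
        have "l * b + j < (l + 1) * b" using j by simp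
        also have "\<dots> \<le> a * b" using l by (intro mult_right_mono) auto
        finally show ?thesis .
      qed
      ultimately show "(\<Oplus>\<^bsub>K\<^esub>s\<in>{..<r}. m s l j \<otimes>\<^bsub>K\<^esub> c s) = \<zero>\<^bsub>K\<^esub>"
        using c(3)[rule_format, of "l * b + j"] by (simp add: M_def)
    qed (use yc in auto)
    also have "VS.lin_sum c (\<lambda>s. \<delta> s (v l)) r = \<theta> (v l)"
      unfolding \<theta>_def using app_lin_sum_ops[of r c \<delta> "v l"] cc dD vc l by simp
    finally show ?thesis using \<theta>E vc[OF l] by (simp add: a_minus_def)
  qed
  moreover have "\<theta> u \<in> W1'" if u: "u \<in> W0" for u
  proof -
    obtain e where e: "\<forall>l<a. e l \<in> carrier K" "u \<ominus> VS.lin_sum e v a \<in> W1"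
      using v(2) u unfolding VS.spans_mod_def by blast
    have uc: "u \<in> carrier R" using u W0.subset by blast
    have lc: "VS.lin_sum e v a \<in> carrier R" using e vc by (intro VS.lin_sum_closed) auto
    have "\<theta> (VS.lin_sum e v a) = VS.lin_sum e (\<lambda>l. \<theta> (v l)) a" using e vc by (intro app_lin_sum[OF \<theta>E]) auto
    also have "\<dots> \<in> W1'" using e \<theta>v by (intro VS.lin_sum_in_subspace[OF W1']) auto
    finally have "\<theta> (VS.lin_sum e v a) \<oplus> \<theta> (u \<ominus> VS.lin_sum e v a) \<in> W1'"
      using F1[OF \<theta>F e(2)] by simp
    moreover have "\<theta> (VS.lin_sum e v a) \<oplus> \<theta> (u \<ominus> VS.lin_sum e v a) = \<theta> u"
    proof -
      have "\<And>p q. p \<in> carrier R \<Longrightarrow> q \<in> carrier R \<Longrightarrow> q \<oplus> (p \<ominus> q) = p" by algebra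
      then show ?thesis using uc lc \<theta>E by (simp add: E_minus)
    qed
    ultimately show ?thesis by simp
  qed
  ultimately show ?thesis using \<theta>F by blast
qed

text \<open>Applied to \<open>x\<close>, the expression of \<open>1\<close> as a combination of products \<open>u \<delta> v\<close> exhibits \<open>x\<close> as a combination of vectors
\<open>u (\<delta> (v x))\<close>, and \<open>\<delta>\<close> maps \<open>v x\<close> into \<open>F\<^sup>q z\<close>.\<close>

lemma simple_recovers_vector:
  assumes x: "x \<in> carrier R" and z: "z \<in> carrier R"
    and simple: "\<one>\<^bsub>D\<^esub> \<in> DV.span {u \<otimes>\<^bsub>D\<^esub> \<delta> \<otimes>\<^bsub>D\<^esub> v | u v. u \<in> F p \<and> v \<in> F p}"
    and d: "\<delta> \<in> carrier D" and "\<And>u. u \<in> orb p x \<Longrightarrow> \<delta> u \<in> orb q z"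
  shows "x \<in> orb (p + q) z"
proof -
  interpret O: submodule K "orb (p + q) z" R using orb_sub[OF z] by (simp add: subspace_def)
  define N where "N = {\<psi> \<in> carrier D. \<psi> x \<in> orb (p + q) z}"
  have "submodule K N D"
    by (rule submodule.intro) (use x D_add_closed D_smult_closed D.zero_closed in \<open>auto simp: N_def D_module\<close>)
  moreover have "{u \<otimes>\<^bsub>D\<^esub> \<delta> \<otimes>\<^bsub>D\<^esub> v | u v. u \<in> F p \<and> v \<in> F p} \<subseteq> N"
  proof clarify
    fix u v assume uv: "u \<in> F p" "v \<in> F p"
    have "v x \<in> orb p x" using uv by (auto simp: orb_def)
    then have "u (\<delta> (v x)) \<in> orb (p + q) z" using assms(5) orb_apply[OF z uv(1)] by blast
    moreover have "(u \<otimes>\<^bsub>E\<^esub> \<delta> \<otimes>\<^bsub>E\<^esub> v) x = u (\<delta> (v x))" using x F_E[OF uv(2)] by simp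
    ultimately show "u \<otimes>\<^bsub>D\<^esub> \<delta> \<otimes>\<^bsub>D\<^esub> v \<in> N"
      using uv d F_D by (auto simp: N_def D_mult_closed)
  qed
  ultimately have "\<one>\<^bsub>D\<^esub> \<in> N" using simple DV.span_is_subset by blast
  then show ?thesis using x by (simp add: N_def)
qed

end

section \<open>Descent of powers\<close>

text \<open>By the inequality of arithmetic and geometric means, \<open>2 \<surd>d \<le> a k + b k\<close> for each \<open>k\<close>.\<close>

lemma card_bound_of_products:
  fixes a b :: "nat \<Rightarrow> nat"
  assumes "\<And>k. k < n \<Longrightarrow> d \<le> a k * b k" "(\<Sum>k<n. a k) \<le> N" "(\<Sum>k<n. b k) \<le> N"
  shows "real n * sqrt (real d) \<le> real N"
proof -
  have amgm: "sqrt (real d) \<le> (real (a k) + real (b k)) / 2" if "k < n" for k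
  proof -
    have "sqrt (real d) \<le> sqrt (real (a k) * real (b k))"
      using assms(1)[OF that] by (metis of_nat_le_iff of_nat_mult real_sqrt_le_iff)
    also have "\<dots> \<le> (real (a k) + real (b k)) / 2" by (intro arith_geo_mean_sqrt) auto
    finally show ?thesis .
  qed
  have "real n * sqrt (real d) = (\<Sum>k<n. sqrt (real d))" by simp
  also have "\<dots> \<le> (\<Sum>k<n. (real (a k) + real (b k)) / 2)" by (intro sum_mono) (use amgm in auto)
  also have "\<dots> = (real (\<Sum>k<n. a k) + real (\<Sum>k<n. b k)) / 2"
    by (simp add: sum.distrib sum_divide_distrib[symmetric])
  also have "\<dots> \<le> real N" using assms(2,3)[THEN of_nat_mono, where ?'a = real] by argo
  finally show ?thesis .
qed

context filtered_ops begin

lemma orb_closed: "x \<in> carrier R \<Longrightarrow> u \<in> orb i x \<Longrightarrow> u \<in> carrier R"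
  using F_E by (auto simp: orb_def)

lemma orb_nat_multiple: "x \<in> carrier R \<Longrightarrow> u \<in> orb i x \<Longrightarrow> [(n::nat)] \<cdot> u \<in> orb i x"
proof -
  assume x: "x \<in> carrier R" and u: "u \<in> orb i x"
  interpret O: submodule K "orb i x" R using orb_sub[OF x] by (simp add: subspace_def)
  show ?thesis by (induction n) (use u in auto)
qed

lemma orb_mult_power:
  assumes f: "f \<in> carrier R" "lm f \<in> F c" and x: "x \<in> carrier R" and u: "u \<in> orb p x"
  shows "f [^] (n::nat) \<otimes> u \<in> orb (n * c + p) x"
proof (induction n)
  case 0 then show ?case using u orb_closed[OF x u] by simp
next
  case (Suc n)
  have uc: "u \<in> carrier R" using orb_closed[OF x u] .
  have "lm f (f [^] n \<otimes> u) \<in> orb (c + (n * c + p)) x" using orb_apply[OF x f(2) Suc] .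
  then show ?case using f uc by (simp add: R.m_ac add.assoc)
qed

lemma ad_F: "f \<in> carrier R \<Longrightarrow> lm f \<in> F c \<Longrightarrow> \<phi> \<in> F p \<Longrightarrow> ad f \<phi> \<in> F (p + c)"
  unfolding commutator_def using F_mult[of \<phi> p "lm f" c] F_mult[of "lm f" c \<phi> p] F_minus
  by (simp add: add.commute)

lemma ad_iter_F: "f \<in> carrier R \<Longrightarrow> lm f \<in> F c \<Longrightarrow> \<phi> \<in> F p \<Longrightarrow> (ad f ^^ i) \<phi> \<in> F (p + i * c)"
proof (induction i)
  case (Suc i)
  then have "ad f ((ad f ^^ i) \<phi>) \<in> F ((p + i * c) + c)" by (intro ad_F) auto
  then show ?case by (simp add: algebra_simps)
qed simp

text \<open>In the Leibniz rule for \<open>\<phi>\<close> and \<open>f\<^sup>t\<close> all exponents are at least \<open>t - N\<close>, so that $f^{t-N}$ can be factored out. The \<open>i\<close>-th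
iterated commutator raises the level by \<open>i c\<close> and the remaining factor $f^{N-i}$ by \<open>(N - i) c\<close>, so the sum
\<open>p + N c\<close> does not depend on \<open>i\<close>, nor on \<open>t\<close>.\<close>

lemma operator_on_power:
  assumes f: "f \<in> carrier R" "lm f \<in> F c" and p: "\<phi> \<in> F p" "\<phi> \<in> Dn N" and t: "N \<le> t"
  shows "\<exists>g \<in> orb (p + N * c) \<one>. \<phi> (f [^] t) = f [^] (t - N) \<otimes> g"
proof -
  define h where "h i = (ad f ^^ i) \<phi> \<one>" for i
  have h: "h i \<in> orb (p + i * c) \<one>" for i using ad_iter_F[OF f p(1)] by (auto simp: h_def orb_def)
  have hc: "h i \<in> carrier R" for i using orb_closed[OF _ h] by simp
  define g where "g i = [(t choose i)] \<cdot> (f [^] (N - i) \<otimes> h i)" for i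
  have g: "g i \<in> orb (p + N * c) \<one>" if "i \<le> N" for i
  proof -
    have "f [^] (N - i) \<otimes> h i \<in> orb ((N - i) * c + (p + i * c)) \<one>"
      by (rule orb_mult_power[OF f _ h]) simp
    moreover have "(N - i) * c + (p + i * c) = p + N * c"
      using that by (metis add.commute add.left_commute add_mult_distrib le_add_diff_inverse)
    ultimately show ?thesis unfolding g_def by (intro orb_nat_multiple) auto
  qed
  have gc: "g i \<in> carrier R" for i using f hc by (simp add: g_def)
  interpret O: submodule K "orb (p + N * c) \<one>" R using orb_sub by (simp add: subspace_def)
  have "\<phi> (f [^] t) = \<phi> (f [^] t \<otimes> \<one>)" using f by simp
  also have "\<dots> = (\<Oplus>i\<in>{..N}. [(t choose i)] \<cdot> (f [^] (t - i) \<otimes> h i))"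
    unfolding h_def by (rule leibniz_pow) (use f p in auto)
  also have "\<dots> = (\<Oplus>i\<in>{..N}. f [^] (t - N) \<otimes> g i)"
  proof (intro R.finsum_cong')
    fix i assume i: "i \<in> {..N}"
    have "f [^] (t - i) = f [^] (t - N) \<otimes> f [^] (N - i)"
      using i t f by (simp add: R.nat_pow_mult)
    then show "[(t choose i)] \<cdot> (f [^] (t - i) \<otimes> h i) = f [^] (t - N) \<otimes> g i"
      using f hc[of i] by (simp add: g_def R.add_pow_rdistr R.m_assoc)
  qed (use gc f in auto)
  also have "\<dots> = f [^] (t - N) \<otimes> (\<Oplus>i\<in>{..N}. g i)"
    using f gc by (intro R.finsum_rdistr[symmetric]) auto
  finally show ?thesis
    using R.finsum_in_closed[of "{..N}" "orb (p + N * c) \<one>" g] g O.subset by (intro bexI) auto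
qed

end

text \<open>The filtration \<open>G\<close> consists of subspaces of the module obtained from \<open>R\<close> by restriction of scalars along
\<open>K \<rightarrow> D\<close>. Its scalar multiplication agrees with the one of \<open>R\<close> on the carrier, but the two records are
different.\<close>

locale holonomic_ops = filtered_ops K R F for K :: "'k ring" and R :: "('k, 'r) module" (structure) and F +
  fixes G :: "nat \<Rightarrow> 'r set"
  assumes compat: "compatible_filtration K (diff_ops K R) F (diff_ops_module R) G"
begin

abbreviation RD where "RD \<equiv> restrict_scalars K D (diff_ops_module R)"

lemma G_fin_dim: "fin_dim_subspace K RD (G i)"
  and G_Suc: "G i \<subseteq> G (Suc i)"
  and G_exhaust: "(\<Union>i. G i) = carrier R"
  and G_act: "\<phi> \<in> F i \<Longrightarrow> u \<in> G j \<Longrightarrow> \<phi> u \<in> G (i + j)"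
  using compat by (auto simp: compatible_filtration_def diff_ops_module_def)

lemma G_mono: "i \<le> j \<Longrightarrow> G i \<subseteq> G j"
  by (induction j) (use G_Suc in \<open>auto simp: le_Suc_eq\<close>)

sublocale RV: vectorspace K RD
  using G_fin_dim[of 0] by (simp add: fin_dim_subspace_def subspace_def)

lemma RD_ops: "carrier RD = carrier R" "zero RD = zero R" "add RD = add R"
  by (simp_all add: restrict_scalars_def diff_ops_module_def)

lemma RD_smult: "c \<in> carrier K \<Longrightarrow> x \<in> carrier R \<Longrightarrow> c \<odot>\<^bsub>RD\<^esub> x = c \<odot> x"
  by (simp add: restrict_scalars_def diff_ops_module_def)

lemma RD_lin_sum:
  assumes "\<And>i. i < n \<Longrightarrow> c i \<in> carrier K" "\<And>i. i < n \<Longrightarrow> v i \<in> carrier R"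
  shows "RV.lin_sum c v n = VS.lin_sum c v n"
proof -
  have "RV.lin_sum c v n = (\<Oplus>\<^bsub>RD\<^esub>i\<in>{..<n}. c i \<odot> v i)"
    unfolding RV.lin_sum_def using assms
    by (intro RV.M.finsum_cong') (auto simp: RD_smult RD_ops)
  also have "\<dots> = VS.lin_sum c v n" by (simp add: VS.lin_sum_def finsum_def RD_ops)
  finally show ?thesis .
qed

lemma indep_le_dim_G:
  assumes "VS.indep_mod {\<zero>} v n" "\<And>i. i < n \<Longrightarrow> v i \<in> G q"
  shows "n \<le> subspace_dim K RD (G q)"
proof (rule indep_card_le_dim[OF RV.vectorspace_axioms G_fin_dim assms(2)])
  show "RV.indep_mod {\<zero>\<^bsub>RD\<^esub>} v n"
    using assms(1) RD_lin_sum[of n _ v] unfolding VS.indep_mod_def RV.indep_mod_def by (simp add: RD_ops)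
qed

lemma dim_G_mono: "i \<le> j \<Longrightarrow> subspace_dim K RD (G i) \<le> subspace_dim K RD (G j)"
proof -
  assume ij: "i \<le> j"
  obtain v where "\<forall>k<subspace_dim K RD (G i). v k \<in> G i" "RV.indep_mod {\<zero>\<^bsub>RD\<^esub>} v (subspace_dim K RD (G i))"
    using exists_indep_dim[OF RV.vectorspace_axioms G_fin_dim[of i]] by blast
  then show ?thesis
    using G_mono[OF ij] by (intro indep_card_le_dim[OF RV.vectorspace_axioms G_fin_dim]) auto
qed

text \<open>\<open>F\<^sup>p f\<^sup>t\<close> is contained in the image of $F^{p+Nc} 1 \subseteq G^{p+Nc+j_0}$ under multiplication by $f^{t-N}$. This bounds its
dimension uniformly in \<open>t\<close>.\<close>

lemma indep_orb_power_bound: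
  assumes f: "f \<in> carrier R" "lm f \<in> F c" and one: "\<one> \<in> G j0"
    and dom: "F p \<subseteq> Dn N" and t: "N \<le> t"
    and v: "VS.indep_mod {\<zero>} v r" "\<And>i. i < r \<Longrightarrow> v i \<in> orb p (f [^] t)"
  shows "r \<le> subspace_dim K RD (G (p + N * c + j0))"
proof -
  define h where "h = f [^] (t - N)"
  have h: "h \<in> carrier R" using f by (simp add: h_def)
  have "\<exists>g \<in> orb (p + N * c) \<one>. v i = h \<otimes> g" if i: "i < r" for i
  proof -
    obtain \<phi> where p: "\<phi> \<in> F p" "v i = \<phi> (f [^] t)" using v(2)[OF i] by (auto simp: orb_def)
    then show ?thesis using operator_on_power[OF f p(1) _ t] dom unfolding h_def by auto
  qed
  then obtain g where g: "\<And>i. i < r \<Longrightarrow> g i \<in> orb (p + N * c) \<one>" "\<And>i. i < r \<Longrightarrow> v i = h \<otimes> g i"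
    by metis
  have gc: "g i \<in> carrier R" if "i < r" for i using orb_closed[OF _ g(1)[OF that]] by simp
  have "VS.indep_mod {\<zero>} g r"
    unfolding VS.indep_mod_def
  proof (intro conjI allI impI)
    fix c i assume c: "\<forall>i<r. c i \<in> carrier K" "VS.lin_sum c g r \<in> {\<zero>}" "i < r"
    have "lm h (VS.lin_sum c g r) = VS.lin_sum c (\<lambda>i. lm h (g i)) r"
      using c gc lm_in_E[OF h] by (intro app_lin_sum) auto
    also have "\<dots> = VS.lin_sum c v r" using c gc g h by (intro VS.lin_sum_cong) auto
    finally have "VS.lin_sum c v r = \<zero>" using c h by simp
    then show "c i = \<zero>\<^bsub>K\<^esub>" using VS.indep_modD[OF v(1), of c i] c by simp
  qed (use gc in auto)
  moreover have "g i \<in> G (p + N * c + j0)" if "i < r" for i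
    using g(1)[OF that] G_act[OF _ one] by (auto simp: orb_def)
  ultimately show ?thesis by (rule indep_le_dim_G)
qed

text \<open>Suppose that no $f^{t+k}$ with \<open>k < n\<close> lies in $F^{Ci+P} f^{t+k+1}$. The spaces \<open>W e k\<close> of the proof, which are
$F^p f^{t+k}$ at level \<open>p = C i + (n - k) c + e\<close>, form two descending chains, for \<open>e = 0\<close> and \<open>e = i\<close>; the summand
\<open>(n - k) c\<close> makes them descend, because multiplication by \<open>f\<close> has level \<open>c\<close>. An operator in \<open>F\<^sup>i\<close>
maps \<open>W 0 k\<close> to \<open>W i k\<close>. If a nonzero one mapped it into \<open>W i (k + 1)\<close>, then $f^{t+k}$ would be recovered from
\<open>W i (k + 1)\<close>, because $F^{Ci} f^{t+k}$ is contained in \<open>W 0 k\<close>. So \<open>dim F\<^sup>i\<close> is at most the product of the dimensions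
of the \<open>k\<close>-th layers, and the dimensions of the layers of each chain add up to at most \<open>dim (W e 0)\<close>.\<close>

lemma descent:
  assumes f: "f \<in> carrier R" "lm f \<in> F c" and one: "\<one> \<in> G j0"
    and dom: "\<And>i. F i \<subseteq> Dn (C' * i)"
    and simple: "\<And>\<delta>. \<delta> \<in> F i \<Longrightarrow> \<delta> \<noteq> \<zero>\<^bsub>E\<^esub> \<Longrightarrow>
        \<one>\<^bsub>D\<^esub> \<in> DV.span {u \<otimes>\<^bsub>D\<^esub> \<delta> \<otimes>\<^bsub>D\<^esub> v | u v. u \<in> F (C * i) \<and> v \<in> F (C * i)}"
    and P: "P = C * i + n * c + i" and t: "C' * P \<le> t"
    and big: "real (subspace_dim K RD (G (P + C' * P * c + j0))) < real n * sqrt (real (subspace_dim K D (F i)))"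
  shows "\<exists>k<n. f [^] (t + k) \<in> orb (C * i + P) (f [^] (t + Suc k))"
proof (rule ccontr)
  assume neg: "\<not> ?thesis"
  define X where "X k = f [^] (t + k)" for k
  have Xc: "X k \<in> carrier R" for k using f by (simp add: X_def)
  define W where "W e k = orb (C * i + (n - k) * c + e) (X k)" for e k
  define N where "N = subspace_dim K RD (G (P + C' * P * c + j0))"
  have Wsub: "subspace K (W e k) R" for e k unfolding W_def by (rule orb_sub[OF Xc])
  have Wdec: "W e (Suc k) \<subseteq> W e k" if k: "k < n" for e k
  proof
    fix u assume "u \<in> W e (Suc k)"
    then obtain \<phi> where p: "\<phi> \<in> F (C * i + (n - Suc k) * c + e)" "u = \<phi> (X (Suc k))" by (auto simp: W_def orb_def)
    have "X (Suc k) = lm f (X k)" using f Xc[of k] by (simp add: X_def R.m_comm)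
    moreover have "lm f (X k) \<in> orb c (X k)" using f by (auto simp: orb_def)
    ultimately have "u \<in> orb ((C * i + (n - Suc k) * c + e) + c) (X k)" using orb_apply[OF Xc p(1)] p(2) by simp
    moreover have "(C * i + (n - Suc k) * c + e) + c = C * i + (n - k) * c + e"
      using k by (simp add: Suc_diff_Suc[symmetric])
    ultimately show "u \<in> W e k" by (simp add: W_def)
  qed
  have bound: "\<forall>v r. VS.indep_mod {\<zero>} v r \<longrightarrow> (\<forall>i<r. v i \<in> W e 0) \<longrightarrow> r \<le> N" if e: "e \<le> i" for e
  proof (intro allI impI)
    fix v r assume v: "VS.indep_mod {\<zero>} v r" "\<forall>i<r. v i \<in> W e 0"
    have "W e 0 \<subseteq> orb P (f [^] t)"
      using orb_mono[of "C * i + n * c + e" P] e P by (simp add: W_def X_def)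
    then have "\<And>i. i < r \<Longrightarrow> v i \<in> orb P (f [^] t)" using v by blast
    then show "r \<le> N" unfolding N_def using indep_orb_power_bound[OF f one dom t v(1)] by blast
  qed
  have "\<exists>a v. (\<forall>k<n. (\<forall>i<a k. v k i \<in> W 0 k) \<and> VS.spans_mod (W 0 (Suc k)) (W 0 k) (v k) (a k)) \<and> (\<Sum>k<n. a k) \<le> N"
    using VS.chain_families[of n "W 0" N] Wsub Wdec bound[of 0] by blast
  then obtain a v where av: "\<And>k i. k < n \<Longrightarrow> i < a k \<Longrightarrow> v k i \<in> W 0 k"
    "\<And>k. k < n \<Longrightarrow> VS.spans_mod (W 0 (Suc k)) (W 0 k) (v k) (a k)" "(\<Sum>k<n. a k) \<le> N" by blast
  have "\<exists>a v. (\<forall>k<n. (\<forall>j<a k. v k j \<in> W i k) \<and> VS.spans_mod (W i (Suc k)) (W i k) (v k) (a k)) \<and> (\<Sum>k<n. a k) \<le> N"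
    using VS.chain_families[of n "W i" N] Wsub Wdec bound[of i] by blast
  then obtain b y where bw: "\<And>k j. k < n \<Longrightarrow> j < b k \<Longrightarrow> y k j \<in> W i k"
    "\<And>k. k < n \<Longrightarrow> VS.spans_mod (W i (Suc k)) (W i k) (y k) (b k)" "(\<Sum>k<n. b k) \<le> N" by blast
  have Fact: "\<delta> u \<in> W i k" if "\<delta> \<in> F i" "u \<in> W 0 k" for \<delta> u k
    using orb_apply[OF Xc that(1), of u "C * i + (n - k) * c" k] that(2) by (simp add: W_def add.commute add.left_commute)
  have "subspace_dim K D (F i) \<le> a k * b k" if k: "k < n" for k
  proof (rule ccontr)
    assume "\<not> ?thesis"
    then have "a k * b k < subspace_dim K D (F i)" by simp
    then have "\<exists>\<delta>\<in>F i. \<delta> \<noteq> \<zero>\<^bsub>E\<^esub> \<and> (\<forall>u\<in>W 0 k. \<delta> u \<in> W i (Suc k))"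
      by (intro operator_into_subspace[of "W 0 k" "W 0 (Suc k)" "W i k" "W i (Suc k)" "a k" "v k" "b k" "y k" i])
         (use Wsub Wdec[OF k] av(1,2)[OF k] bw(1,2)[OF k] Fact in blast)+
    then obtain \<delta> where d: "\<delta> \<in> F i" "\<delta> \<noteq> \<zero>\<^bsub>E\<^esub>" "\<forall>u\<in>W 0 k. \<delta> u \<in> W i (Suc k)"
      by blast
    have "\<delta> u \<in> orb (C * i + (n - Suc k) * c + i) (X (Suc k))" if u: "u \<in> orb (C * i) (X k)" for u
    proof -
      have "u \<in> W 0 k" using u orb_mono[of "C * i" "C * i + (n - k) * c + 0" "X k"] by (auto simp: W_def)
      then show ?thesis using d(3) by (simp add: W_def)
    qed
    then have "X k \<in> orb (C * i + (C * i + (n - Suc k) * c + i)) (X (Suc k))"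
      using simple_recovers_vector[OF Xc Xc simple[OF d(1,2)] F_D[OF d(1)]] by blast
    moreover have "C * i + (C * i + (n - Suc k) * c + i) \<le> C * i + P" using P by simp
    ultimately have "X k \<in> orb (C * i + P) (X (Suc k))" using orb_mono by blast
    then show False using neg k by (auto simp: X_def)
  qed
  then have "real n * sqrt (real (subspace_dim K D (F i))) \<le> real N"
    using card_bound_of_products[of n "subspace_dim K D (F i)" a b N] av(3) bw(3) by blast
  then show False using big by (simp add: N_def)
qed

end

section \<open>Growth of the filtrations\<close>

lemma limsup_growth_below:
  fixes h :: "nat \<Rightarrow> nat"
  assumes "0 < limsup (\<lambda>i. ereal (real (h i) / real i powr d))"
  obtains \<epsilon> where "\<epsilon> > 0" "\<exists>\<^sub>F i in sequentially. real (h i) > \<epsilon> * real i powr d"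
proof -
  obtain \<epsilon> where e: "0 < ereal \<epsilon>" "ereal \<epsilon> < limsup (\<lambda>i. ereal (real (h i) / real i powr d))"
    using ereal_dense2[OF assms] by blast
  have "\<exists>\<^sub>F i in sequentially. ereal \<epsilon> < ereal (real (h i) / real i powr d)"
  proof (rule ccontr)
    assume "\<not> ?thesis"
    then have "\<forall>\<^sub>F i in sequentially. ereal (real (h i) / real i powr d) \<le> ereal \<epsilon>"
      by (simp add: not_frequently not_less)
    then have "limsup (\<lambda>i. ereal (real (h i) / real i powr d)) \<le> ereal \<epsilon>" by (rule Limsup_bounded)
    then show False using e(2) by simp
  qed
  then have "\<exists>\<^sub>F i in sequentially. 0 < i \<and> ereal \<epsilon> < ereal (real (h i) / real i powr d)"
    using frequently_eventually_conj[OF _ eventually_gt_at_top[of "0::nat"]] by blast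
  then have "\<exists>\<^sub>F i in sequentially. real (h i) > \<epsilon> * real i powr d"
    by (rule frequently_elim1) (auto simp: field_simps)
  then show thesis using that e by simp
qed

lemma limsup_growth_above:
  fixes h :: "nat \<Rightarrow> nat"
  assumes "limsup (\<lambda>i. ereal (real (h i) / real i powr d)) < \<infinity>"
  obtains B where "B > 0" "\<forall>\<^sub>F i in sequentially. real (h i) < B * real i powr d"
proof -
  obtain B where B: "limsup (\<lambda>i. ereal (real (h i) / real i powr d)) < ereal B"
    using ereal_dense2[OF assms] by blast
  have "\<forall>\<^sub>F i in sequentially. ereal (real (h i) / real i powr d) < ereal B" using B by (rule Limsup_lessD)
  then have "\<forall>\<^sub>F i in sequentially. real (h i) < max B 1 * real i powr d"
    using eventually_gt_at_top[of "0::nat"]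
  proof eventually_elim
    case (elim i)
    then have "real (h i) < B * real i powr d" by (simp add: field_simps)
    also have "\<dots> \<le> max B 1 * real i powr d" by (intro mult_right_mono) auto
    finally show ?case .
  qed
  then show thesis using that[of "max B 1"] by simp
qed

context holonomic_ops begin

text \<open>The number \<open>n\<close> of powers is chosen first, so large that \<open>n \<surd>\<epsilon>\<close> exceeds the growth constant of \<open>G\<close> after
rescaling the level by \<open>A\<close>, and the level \<open>i\<close> afterwards, so large that it dominates \<open>n c\<close>. For this
order of choices it matters that \<open>A\<close> does not depend on \<open>n\<close>. Then \<open>descent\<close> applies to every large \<open>t\<close>, with
one bound for the level of the operators.\<close>

proposition infinitely_many_descents:
  assumes dom: "linearly_dominated K R F" and simple: "linearly_simple K D F"
    and posF: "0 < filt_mult K D F"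
    and dimG: "filt_dim K RD G = filt_dim K D F / 2" and multG: "filt_mult K RD G < \<infinity>"
    and f: "f \<in> carrier R"
  shows "\<exists>M. infinite {t. f [^] (t::nat) \<in> orb M (f [^] Suc t)}"
proof -
  define dF where "dF i = subspace_dim K D (F i)" for i
  define dG where "dG i = subspace_dim K RD (G i)" for i
  define d where "d = real_of_ereal (filt_dim K D F)"
  have d2: "real_of_ereal (filt_dim K RD G) = d / 2"
    unfolding dimG d_def by (cases "filt_dim K D F") auto
  obtain \<epsilon> where eps: "\<epsilon> > 0" "\<exists>\<^sub>F i in sequentially. real (dF i) > \<epsilon> * real i powr d"
    using limsup_growth_below[of dF d] posF unfolding filt_mult_def d_def dF_def by blast
  obtain B where B: "B > 0" "\<forall>\<^sub>F i in sequentially. real (dG i) < B * real i powr (d / 2)"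
    using limsup_growth_above[of dG "d / 2"] multG unfolding filt_mult_def d2 dG_def by blast
  obtain i0 where i0: "\<And>i. i \<ge> i0 \<Longrightarrow> real (dG i) < B * real i powr (d / 2)"
    using B(2) unfolding eventually_sequentially by blast
  obtain C where C: "C > 0" "\<And>i \<delta>. \<delta> \<in> F i \<Longrightarrow> \<delta> \<noteq> \<zero>\<^bsub>E\<^esub> \<Longrightarrow>
      \<one>\<^bsub>D\<^esub> \<in> DV.span {u \<otimes>\<^bsub>D\<^esub> \<delta> \<otimes>\<^bsub>D\<^esub> v | u v. u \<in> F (C * i) \<and> v \<in> F (C * i)}"
    using simple unfolding linearly_simple_def by auto
  obtain C' where C': "\<And>i. F i \<subseteq> Dn (C' * i)" using dom unfolding linearly_dominated_def by blast
  obtain c where c: "lm f \<in> F c" using lm_D[OF f] F_exhaust by blast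
  obtain j0 where j0: "\<one> \<in> G j0" using G_exhaust by blast
  \<comment> \<open>\<open>P \<le> (C + 2) i\<close> as soon as \<open>n c \<le> i\<close>, and the last summand \<open>1\<close> absorbs \<open>j0 \<le> i\<close>.\<close>
  define A where "A = (C + 2) * (1 + C' * c) + 1"
  have A: "A \<ge> 1" by (simp add: A_def)
  obtain n :: nat where n: "real n > B * real A powr (d / 2) / sqrt \<epsilon>" using reals_Archimedean2 by blast
  obtain i where i: "real (dF i) > \<epsilon> * real i powr d" "i \<ge> max (max 1 i0) (max (n * c) j0)"
    using eps(2) unfolding frequently_sequentially by blast
  define P where "P = C * i + n * c + i"
  have "P \<le> (C + 2) * i" using i(2) by (simp add: P_def algebra_simps)
  then have "P * (1 + C' * c) \<le> (C + 2) * i * (1 + C' * c)" by (rule mult_right_mono) simp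
  then have "P + C' * P * c + j0 \<le> (C + 2) * i * (1 + C' * c) + i" using i(2) by (simp add: algebra_simps)
  also have "\<dots> = A * i" by (simp add: A_def algebra_simps)
  finally have "dG (P + C' * P * c + j0) \<le> dG (A * i)" unfolding dG_def by (rule dim_G_mono)
  then have "real (dG (P + C' * P * c + j0)) \<le> real (dG (A * i))" by simp
  also have "\<dots> < B * real (A * i) powr (d / 2)"
  proof (rule i0)
    have "1 * i \<le> A * i" using A by (intro mult_right_mono) auto
    then show "i0 \<le> A * i" using i(2) by linarith
  qed
  also have "\<dots> = (B * real A powr (d / 2)) * real i powr (d / 2)" by (simp add: powr_mult)
  also have "\<dots> \<le> (real n * sqrt \<epsilon>) * real i powr (d / 2)"
    using n eps(1) by (intro mult_right_mono) (auto simp: field_simps)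
  also have "\<dots> = real n * sqrt (\<epsilon> * real i powr d)"
  proof -
    have "sqrt (real i powr d) = real i powr (d / 2)"
      using i(2) by (intro real_sqrt_unique) (auto simp: powr_power power2_eq_square powr_add[symmetric])
    then show ?thesis by (simp add: real_sqrt_mult)
  qed
  also have "\<dots> \<le> real n * sqrt (real (dF i))" using i(1) by (intro mult_left_mono) auto
  finally have big: "real (dG (P + C' * P * c + j0)) < real n * sqrt (real (dF i))" .
  have "\<exists>k<n. f [^] (t + k) \<in> orb (C * i + P) (f [^] (t + Suc k))" if "C' * P \<le> t" for t
    using descent[OF f c j0 C' C(2) P_def that] big unfolding dF_def dG_def by blast
  then have "\<exists>t'\<ge>t. f [^] t' \<in> orb (C * i + P) (f [^] Suc t')" for t
    by (metis add_Suc_right le_add1 le_add2 le_trans)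
  then have "infinite {t. f [^] t \<in> orb (C * i + P) (f [^] Suc t)}"
    unfolding infinite_nat_iff_unbounded_le by blast
  then show ?thesis by blast
qed

end

section \<open>Evaluation of polynomials at natural numbers\<close>

lemma (in cring) nat_mult_one: "[m] \<cdot> \<one> \<otimes> [n] \<cdot> \<one> = [(m * n :: nat)] \<cdot> \<one>"
  by (simp add: add_pow_ldistr add.nat_pow_pow mult.commute)

lemma (in cring) nat_diff_one: "n \<le> m \<Longrightarrow> [m] \<cdot> \<one> \<ominus> [n] \<cdot> \<one> = [(m - n :: nat)] \<cdot> \<one>"
proof -
  assume "n \<le> m"
  then have "[m] \<cdot> \<one> = [(m - n)] \<cdot> \<one> \<oplus> [n] \<cdot> \<one>" by (simp add: add.nat_pow_mult)
  then show ?thesis by (simp add: a_minus_def a_assoc r_neg)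
qed

lemma falling_product: "i \<le> t \<Longrightarrow> (\<Prod>j<i. t - j) = fact i * (t choose i :: nat)"
proof -
  assume i: "i \<le> t"
  have "(\<Prod>j<i. t - j) * fact (t - i) = (fact t :: nat)"
    using i
  proof (induction i)
    case (Suc i)
    then have "fact (t - i) = (t - i) * (fact (t - Suc i) :: nat)"
      by (metis Suc_diff_Suc Suc_le_lessD fact_Suc of_nat_id)
    then show ?case using Suc by (simp add: mult.assoc)
  qed simp
  also have "\<dots> = (fact i * (t choose i)) * fact (t - i)"
    using binomial_fact_lemma[OF i] by (simp add: mult.assoc mult.left_commute mult.commute)
  finally show ?thesis by simp
qed

lemma (in abelian_monoid) finsum_swap:
  assumes "finite A" "finite B" "\<And>a b. a \<in> A \<Longrightarrow> b \<in> B \<Longrightarrow> g a b \<in> carrier G"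
  shows "(\<Oplus>a\<in>A. \<Oplus>b\<in>B. g a b) = (\<Oplus>b\<in>B. \<Oplus>a\<in>A. g a b)"
  using assms(1,3)
proof (induction A rule: finite_induct)
  case empty then show ?case by simp
next
  case (insert x A)
  have c: "\<And>a. a \<in> insert x A \<Longrightarrow> (\<Oplus>b\<in>B. g a b) \<in> carrier G" "\<And>b. b \<in> B \<Longrightarrow> (\<Oplus>a\<in>A. g a b) \<in> carrier G"
    using insert by (auto intro!: finsum_closed)
  have "(\<Oplus>a\<in>insert x A. \<Oplus>b\<in>B. g a b) = (\<Oplus>b\<in>B. g x b) \<oplus> (\<Oplus>b\<in>B. \<Oplus>a\<in>A. g a b)"
    using insert c by (subst finsum_insert) auto
  also have "\<dots> = (\<Oplus>b\<in>B. g x b \<oplus> (\<Oplus>a\<in>A. g a b))" using insert c by (intro finsum_addf[symmetric]) auto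
  also have "\<dots> = (\<Oplus>b\<in>B. \<Oplus>a\<in>insert x A. g a b)"
    using insert c by (intro finsum_cong') (auto simp: finsum_insert)
  finally show ?case .
qed

definition at_nat :: "'k ring \<Rightarrow> nat \<Rightarrow> (nat \<Rightarrow> 'k) \<Rightarrow> 'k" where
  "at_nat K t = eval K K id ([t] \<cdot>\<^bsub>K\<^esub> \<one>\<^bsub>K\<^esub>)"

context
  fixes K :: "'k ring" (structure)
  assumes K: "field K" and char0: "has_char_zero K"
begin

interpretation K: field K by (rule K)

interpretation PK: UP_domain K "UP K"
  by (simp_all add: UP_domain_def K.domain_axioms)

lemma pre_univ: "UP_pre_univ_prop K K id"
  by (intro UP_pre_univ_propI K.is_cring id_ring_hom)

lemma at_nat_hom: "at_nat K t \<in> ring_hom (UP K) K"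
  unfolding at_nat_def using UP_pre_univ_prop.eval_ring_hom[OF pre_univ] by blast

lemma at_nat_const: "c \<in> carrier K \<Longrightarrow> at_nat K t (monom (UP K) c 0) = c"
  unfolding at_nat_def using UP_pre_univ_prop.eval_const[OF pre_univ, of "[t] \<cdot> \<one>" c] by simp

lemma at_nat_X: "at_nat K t (monom (UP K) \<one> 1) = [t] \<cdot> \<one>"
  unfolding at_nat_def using UP_pre_univ_prop.eval_monom1[OF pre_univ] by simp

lemma nat_multiple_nonzero: "n > 0 \<Longrightarrow> [(n::nat)] \<cdot> \<one> \<noteq> \<zero>"
  using char0 by (simp add: has_char_zero_def)

lemma inj_nat_multiple: "inj (\<lambda>n::nat. [n] \<cdot> \<one>)"
proof (rule linorder_inj_onI)
  fix m n :: nat assume "m < n"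
  then show "[m] \<cdot> \<one> \<noteq> [n] \<cdot> \<one>"
    using K.nat_diff_one[of m n] nat_multiple_nonzero[of "n - m"] K.r_right_minus_eq[of "[n] \<cdot> \<one>" "[m] \<cdot> \<one>"] by auto
qed auto

lemma finite_nat_roots:
  assumes "p \<in> carrier (UP K)" "p \<noteq> \<zero>\<^bsub>UP K\<^esub>"
  shows "finite {t \<in> S. at_nat K t p = \<zero>}"
proof -
  have "(\<lambda>n::nat. [n] \<cdot> \<one>) ` {t \<in> S. at_nat K t p = \<zero>} \<subseteq> {a \<in> carrier K. eval K K id a p = \<zero>}"
    unfolding at_nat_def by auto
  then have "finite ((\<lambda>n::nat. [n] \<cdot> \<one>) ` {t \<in> S. at_nat K t p = \<zero>})"
    using PK.finite_roots[OF assms] finite_subset by blast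
  then show ?thesis using finite_imageD inj_nat_multiple inj_on_subset by blast
qed

lemma fact_unit: "inv ([(fact i :: nat)] \<cdot> \<one>) \<in> carrier K"
  "inv ([(fact i :: nat)] \<cdot> \<one>) \<otimes> [(fact i :: nat)] \<cdot> \<one> = \<one>"
proof -
  have "[(fact i :: nat)] \<cdot> \<one> \<in> Units K"
    using nat_multiple_nonzero[of "fact i"] by (simp add: K.field_Units)
  then show "inv ([(fact i :: nat)] \<cdot> \<one>) \<in> carrier K"
    "inv ([(fact i :: nat)] \<cdot> \<one>) \<otimes> [(fact i :: nat)] \<cdot> \<one> = \<one>" by auto
qed

lemma linear_factor_closed: "monom (UP K) \<one> 1 \<ominus>\<^bsub>UP K\<^esub> [(j::nat)] \<cdot>\<^bsub>UP K\<^esub> \<one>\<^bsub>UP K\<^esub> \<in> carrier (UP K)"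
  by simp

lemma binom_poly_closed: "binom_poly K i \<in> carrier (UP K)"
  unfolding binom_poly_def using fact_unit(1) by (auto intro!: PK.UP_smult_closed PK.finprod_closed)

lemma at_nat_nat_multiple: "at_nat K t ([(j::nat)] \<cdot>\<^bsub>UP K\<^esub> \<one>\<^bsub>UP K\<^esub>) = [j] \<cdot> \<one>"
proof -
  interpret H: ring_hom_ring "UP K" K "at_nat K t"
    using at_nat_hom PK.ring_axioms K.ring_axioms by (simp add: ring_hom_ringI2)
  show ?thesis by (induction j) auto
qed

text \<open>The assumption \<open>i \<le> t\<close> keeps the factors \<open>t - j\<close> of the falling factorial inside the natural numbers.\<close>

lemma at_nat_binom_poly:
  assumes "i \<le> t"
  shows "at_nat K t (binom_poly K i) = [(t choose i)] \<cdot> \<one>"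
proof -
  interpret H: ring_hom_ring "UP K" K "at_nat K t"
    using at_nat_hom PK.ring_axioms K.ring_axioms by (simp add: ring_hom_ringI2)
  let ?l = "\<lambda>j::nat. monom (UP K) \<one> 1 \<ominus>\<^bsub>UP K\<^esub> [j] \<cdot>\<^bsub>UP K\<^esub> \<one>\<^bsub>UP K\<^esub>"
  have lc: "?l j \<in> carrier (UP K)" for j by (rule linear_factor_closed)
  have l: "at_nat K t (?l j) = [t] \<cdot> \<one> \<ominus> [j] \<cdot> \<one>" for j
    using at_nat_X[of t] at_nat_nat_multiple[of t j] by (simp add: a_minus_def)
  have "at_nat K t (\<Otimes>\<^bsub>UP K\<^esub>j\<in>{..<i}. ?l j) = [(\<Prod>j<i. t - j)] \<cdot> \<one>"
    using assms
  proof (induction i)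
    case 0 then show ?case by simp
  next
    case (Suc i)
    have "(\<Otimes>\<^bsub>UP K\<^esub>j\<in>{..<Suc i}. ?l j) = ?l i \<otimes>\<^bsub>UP K\<^esub> (\<Otimes>\<^bsub>UP K\<^esub>j\<in>{..<i}. ?l j)"
      unfolding lessThan_Suc using lc by (intro PK.finprod_insert) auto
    then have "at_nat K t (\<Otimes>\<^bsub>UP K\<^esub>j\<in>{..<Suc i}. ?l j) = at_nat K t (?l i) \<otimes> at_nat K t (\<Otimes>\<^bsub>UP K\<^esub>j\<in>{..<i}. ?l j)"
      using H.hom_mult[OF lc[of i] PK.finprod_closed[of ?l "{..<i}"]] lc by auto
    also have "\<dots> = [(t - i)] \<cdot> \<one> \<otimes> [(\<Prod>j<i. t - j)] \<cdot> \<one>"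
      unfolding l using Suc K.nat_diff_one[of i t] by simp
    finally show ?case by (simp add: K.nat_mult_one mult.commute)
  qed
  then have f: "at_nat K t (\<Otimes>\<^bsub>UP K\<^esub>j\<in>{..<i}. ?l j) = [(fact i * (t choose i))] \<cdot> \<one>"
    using falling_product[OF assms] by simp
  have fc: "(\<Otimes>\<^bsub>UP K\<^esub>j\<in>{..<i}. ?l j) \<in> carrier (UP K)" using lc by (intro PK.finprod_closed) auto
  define u where "u = inv ([(fact i :: nat)] \<cdot> \<one>)"
  have u: "u \<in> carrier K" "u \<otimes> [(fact i :: nat)] \<cdot> \<one> = \<one>" using fact_unit by (auto simp: u_def)
  have "binom_poly K i = monom (UP K) u 0 \<otimes>\<^bsub>UP K\<^esub> (\<Otimes>\<^bsub>UP K\<^esub>j\<in>{..<i}. ?l j)"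
    unfolding binom_poly_def u_def[symmetric] by (rule PK.monom_mult_is_smult[OF u(1) fc, symmetric])
  then have "at_nat K t (binom_poly K i) = u \<otimes> [(fact i * (t choose i))] \<cdot> \<one>"
    using fc u(1) f H.hom_mult[of "monom (UP K) u 0" "\<Otimes>\<^bsub>UP K\<^esub>j\<in>{..<i}. ?l j"] at_nat_const[OF u(1), of t] by simp
  also have "\<dots> = (u \<otimes> [(fact i :: nat)] \<cdot> \<one>) \<otimes> [(t choose i)] \<cdot> \<one>"
    unfolding K.nat_mult_one[symmetric] using u(1) by (simp add: K.m_assoc)
  finally show ?thesis using u(2) by simp
qed

end

context k_algebra begin

interpretation PD: UP_ring D "UP D"
  by (simp_all add: UP_ring_def D_ring)

lemma UP_D_eval: "\<Phi> \<in> carrier (UP D) \<Longrightarrow> \<Phi> n \<in> carrier D"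
  by (auto simp: UP_def up_def)

text \<open>The indeterminate is central, so that commutators in \<open>D[s]\<close> with an element of \<open>R\<close> are computed
coefficientwise.\<close>

lemma commutator_UP:
  assumes P: "\<Phi> \<in> carrier (UP D)" and f: "f \<in> carrier R"
  shows "commutator (UP D) \<Phi> (monom (UP D) (lm f) 0) \<in> carrier (UP D)"
    "commutator (UP D) \<Phi> (monom (UP D) (lm f) 0) n = ad f (\<Phi> n)"
proof -
  let ?m = "monom (UP D) (lm f) 0"
  have m: "?m \<in> carrier (UP D)" using lm_D[OF f] by simp
  show c: "commutator (UP D) \<Phi> ?m \<in> carrier (UP D)"
    unfolding commutator_def using P m by simp
  have cf: "coeff (UP D) \<Psi> k = \<Psi> k" if "\<Psi> \<in> carrier (UP D)" for \<Psi> k using that by (simp add: UP_def)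
  have "coeff (UP D) (\<Phi> \<otimes>\<^bsub>UP D\<^esub> ?m) n = (\<Oplus>\<^bsub>D\<^esub>i\<in>{..n}. coeff (UP D) \<Phi> i \<otimes>\<^bsub>D\<^esub> coeff (UP D) ?m (n - i))"
    by (rule PD.coeff_mult[OF P m])
  also have "\<dots> = (\<Oplus>\<^bsub>D\<^esub>i\<in>{..n}. if n = i then \<Phi> i \<otimes>\<^bsub>D\<^esub> lm f else \<zero>\<^bsub>D\<^esub>)"
    using P lm_D[OF f] UP_D_eval[OF P] D_mult_closed D.zero_closed by (intro D.finsum_cong') (auto simp: cf[OF P] D_E)
  also have "\<dots> = \<Phi> n \<otimes>\<^bsub>D\<^esub> lm f"
    using D.finsum_singleton[of n "{..n}" "\<lambda>i. \<Phi> i \<otimes>\<^bsub>D\<^esub> lm f"] UP_D_eval[OF P] lm_D[OF f] D_mult_closed by simp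
  finally have 1: "coeff (UP D) (\<Phi> \<otimes>\<^bsub>UP D\<^esub> ?m) n = \<Phi> n \<otimes>\<^bsub>D\<^esub> lm f" .
  have 2: "coeff (UP D) (?m \<otimes>\<^bsub>UP D\<^esub> \<Phi>) n = lm f \<otimes>\<^bsub>D\<^esub> \<Phi> n"
    using PD.monom_mult_is_smult[OF lm_D[OF f] P] PD.coeff_smult[OF lm_D[OF f] P] cf[OF P] by simp
  have "coeff (UP D) (commutator (UP D) \<Phi> ?m) n = \<Phi> n \<otimes>\<^bsub>D\<^esub> lm f \<ominus>\<^bsub>D\<^esub> lm f \<otimes>\<^bsub>D\<^esub> \<Phi> n"
    unfolding commutator_def using P m 1 2
    by (simp add: a_minus_def del: PD.coeff_mult)
  then show "commutator (UP D) \<Phi> ?m n = ad f (\<Phi> n)"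
    using cf[OF c] D_commutator[OF UP_D_eval[OF P] f] by (simp add: commutator_def)
qed

lemma iter_commutator_UP:
  assumes "\<Phi> \<in> carrier (UP D)" "f \<in> carrier R"
  shows "iter_commutator K R f \<Phi> i \<in> carrier (UP D) \<and> (\<forall>n. iter_commutator K R f \<Phi> i n = (ad f ^^ i) (\<Phi> n))"
proof (induction i)
  case (Suc i)
  let ?\<Psi> = "iter_commutator K R f \<Phi> i"
  have "?\<Psi> \<in> carrier (UP D)" using Suc by blast
  note c = commutator_UP[OF this assms(2)]
  have "iter_commutator K R f \<Phi> (Suc i) n = (ad f ^^ Suc i) (\<Phi> n)" for n
    using c(2)[of n] Suc by simp
  then show ?case using c(1) by (metis iter_commutator.simps(2))
qed (use assms in simp)

end

section \<open>From infinitely many integers to a functional equation\<close>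

context field_algebra begin

lemma ad_iter_add:
  "\<phi> \<in> carrier E \<Longrightarrow> \<psi> \<in> carrier E \<Longrightarrow> r \<in> carrier R \<Longrightarrow>
    (ad r ^^ i) (\<phi> \<oplus>\<^bsub>E\<^esub> \<psi>) = (ad r ^^ i) \<phi> \<oplus>\<^bsub>E\<^esub> (ad r ^^ i) \<psi>"
  by (induction i) (auto simp: ad_add ad_iter_E)

lemma ad_iter_smult:
  "\<phi> \<in> carrier E \<Longrightarrow> c \<in> carrier K \<Longrightarrow> r \<in> carrier R \<Longrightarrow>
    (ad r ^^ i) (c \<odot>\<^bsub>E\<^esub> \<phi>) = c \<odot>\<^bsub>E\<^esub> (ad r ^^ i) \<phi>"
  by (induction i) (auto simp: ad_smult ad_iter_E)

lemma ad_iter_of_zero: "r \<in> carrier R \<Longrightarrow> (ad r ^^ i) \<zero>\<^bsub>E\<^esub> = \<zero>\<^bsub>E\<^esub>"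
  using ad_iter_smult[of "\<zero>\<^bsub>E\<^esub>" "\<zero>\<^bsub>K\<^esub>" r i] ad_iter_E[of "\<zero>\<^bsub>E\<^esub>" r i] by simp

lemma ad_iter_lin_sum:
  assumes "\<And>a. a < r \<Longrightarrow> c a \<in> carrier K" "\<And>a. a < r \<Longrightarrow> \<delta> a \<in> carrier D" "f \<in> carrier R"
  shows "(ad f ^^ i) (DV.lin_sum c \<delta> r) = DV.lin_sum c (\<lambda>a. (ad f ^^ i) (\<delta> a)) r"
  using assms(1,2)
proof (induction r)
  case 0 then show ?case using ad_iter_of_zero[OF assms(3)] by simp
next
  case (Suc r)
  have "DV.lin_sum c \<delta> (Suc r) = DV.lin_sum c \<delta> r \<oplus>\<^bsub>D\<^esub> c r \<odot>\<^bsub>D\<^esub> \<delta> r" using Suc.prems by (intro DV.lin_sum_Suc) auto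
  moreover have "DV.lin_sum c (\<lambda>a. (ad f ^^ i) (\<delta> a)) (Suc r) =
      DV.lin_sum c (\<lambda>a. (ad f ^^ i) (\<delta> a)) r \<oplus>\<^bsub>D\<^esub> c r \<odot>\<^bsub>D\<^esub> (ad f ^^ i) (\<delta> r)"
    using Suc.prems ad_iter_D assms(3) by (intro DV.lin_sum_Suc) auto
  moreover have "DV.lin_sum c \<delta> r \<in> carrier D" using Suc.prems by (intro DV.lin_sum_closed) auto
  ultimately show ?case using Suc assms(3) by (simp add: ad_iter_add ad_iter_smult D_E E_smult_closed)
qed

lemma nat_multiple_eq_smult: "x \<in> carrier R \<Longrightarrow> [(n::nat)] \<cdot> x = ([n] \<cdot>\<^bsub>K\<^esub> \<one>\<^bsub>K\<^esub>) \<odot> x"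
  by (induction n) (auto simp: V.smult_l_distr)

lemma leibniz_pow_lin_sum:
  assumes f: "f \<in> carrier R" and x: "x \<in> carrier R" and p: "\<phi> \<in> Dn N"
  shows "\<phi> (f [^] t \<otimes> x) =
    VS.lin_sum (\<lambda>i. [(t choose i)] \<cdot>\<^bsub>K\<^esub> \<one>\<^bsub>K\<^esub>) (\<lambda>i. f [^] (t - i) \<otimes> (ad f ^^ i) \<phi> x) (Suc N)"
  unfolding leibniz_pow[OF assms] VS.lin_sum_def lessThan_Suc_atMost
  using f x ad_iter_E[OF Dn_E[OF p] f] by (intro R.finsum_cong') (auto simp: nat_multiple_eq_smult)

end

locale localized_field_algebra = localized_algebra K R f + field_algebra K R
  for K :: "'k ring" and R :: "('k, 'r) module" (structure) and f :: 'r +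
  assumes char0: "has_char_zero K"
begin

sublocale L: field_algebra K L
  by (intro field_algebra.intro L.k_algebra_axioms field_algebra_axioms.intro field)

interpretation PK: UP_domain K "UP K"
  by (simp_all add: UP_domain_def VS.domain_axioms)

interpretation PL: UP_cring L "UP L"
  by (simp_all add: UP_cring_def L_cring)

lemma coeff_UP: "p \<in> carrier (UP A) \<Longrightarrow> coeff (UP A) p n = p n"
  by (simp add: UP_def)

lemma UP_K_closed: "p \<in> carrier (UP K) \<Longrightarrow> p n \<in> carrier K"
  by (auto simp: UP_def up_def)

lemma UP_memI: "(\<And>n. p n \<in> carrier A) \<Longrightarrow> (\<And>n. m < n \<Longrightarrow> p n = \<zero>\<^bsub>A\<^esub>) \<Longrightarrow> p \<in> carrier (UP A)"
  by (auto simp: UP_def intro!: mem_upI)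

lemma UP_bound: "p \<in> carrier (UP A) \<Longrightarrow> \<exists>m. \<forall>n>m. p n = \<zero>\<^bsub>A\<^esub>"
  by (auto simp: UP_def up_def bound_def)

lemma UP_common_bound:
  assumes "\<And>j. j < (h::nat) \<Longrightarrow> q j \<in> carrier (UP A)"
  shows "\<exists>m. \<forall>j<h. \<forall>n>m. q j n = \<zero>\<^bsub>A\<^esub>"
proof -
  have "\<forall>j. \<exists>m. j < h \<longrightarrow> (\<forall>n>m. q j n = \<zero>\<^bsub>A\<^esub>)" using UP_bound assms by metis
  then obtain B where B: "\<And>j. j < h \<Longrightarrow> \<forall>n>B j. q j n = \<zero>\<^bsub>A\<^esub>" by metis
  have "B j \<le> (\<Sum>j<h. B j)" if "j < h" for j using that by (intro member_le_sum) auto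
  then show ?thesis using B by (meson le_less_trans)
qed

lemma scalar_poly_closed: "b \<in> carrier (UP K) \<Longrightarrow> scalar_poly L b \<in> carrier (UP L)"
  using UP_bound[of b K] UP_K_closed[of b] L.R.one_closed
  by (auto simp: scalar_poly_def intro!: UP_memI)

lemma frac_lin_sum:
  assumes "\<And>i. i < n \<Longrightarrow> c i \<in> carrier K" "\<And>i. i < n \<Longrightarrow> v i \<in> carrier R"
  shows "frac (VS.lin_sum c v n) m = L.VS.lin_sum c (\<lambda>i. frac (v i) m) n"
  using assms
proof (induction n)
  case 0 then show ?case by (simp add: frac_zero)
next
  case (Suc n)
  have "VS.lin_sum c v (Suc n) = VS.lin_sum c v n \<oplus> c n \<odot> v n" using Suc.prems by (intro VS.lin_sum_Suc) auto
  moreover have "L.VS.lin_sum c (\<lambda>i. frac (v i) m) (Suc n) = L.VS.lin_sum c (\<lambda>i. frac (v i) m) n \<oplus>\<^bsub>L\<^esub> c n \<odot>\<^bsub>L\<^esub> frac (v n) m"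
    using Suc.prems by (intro L.VS.lin_sum_Suc) auto
  moreover have "VS.lin_sum c v n \<in> carrier R" using Suc.prems by (intro VS.lin_sum_closed) auto
  ultimately show ?case using Suc by (simp add: L_add_same[symmetric] L_smult)
qed

text \<open>The element \<open>\<Sum>\<^sub>j q\<^sub>j(s) e\<^sub>j\<close> of \<open>L[s]\<close> with polynomial coordinates \<open>q\<^sub>j\<close>.\<close>

definition poly_comb :: "(nat \<Rightarrow> ('r \<times> nat) set) \<Rightarrow> nat \<Rightarrow> (nat \<Rightarrow> nat \<Rightarrow> 'k) \<Rightarrow> nat \<Rightarrow> ('r \<times> nat) set" where
  "poly_comb e h q n = L.VS.lin_sum (\<lambda>j. q j n) e h"

context
  fixes e :: "nat \<Rightarrow> ('r \<times> nat) set" and h :: nat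
  assumes e: "\<And>j. j < h \<Longrightarrow> e j \<in> carrier L"
begin

lemma comb_closed:
  assumes "\<And>j. j < h \<Longrightarrow> q j \<in> carrier (UP K)"
  shows "poly_comb e h q \<in> carrier (UP L)"
proof -
  obtain m where m: "\<forall>j<h. \<forall>n>m. q j n = \<zero>\<^bsub>K\<^esub>" using UP_common_bound assms by blast
  show ?thesis
  proof (rule UP_memI)
    show "poly_comb e h q n \<in> carrier L" for n
      unfolding poly_comb_def using assms e UP_K_closed by (intro L.VS.lin_sum_closed) auto
    show "poly_comb e h q n = \<zero>\<^bsub>L\<^esub>" if "m < n" for n
      unfolding poly_comb_def using that m e by (intro L.VS.lin_sum_zero) auto
  qed
qed

lemma scalar_times_comb:
  assumes b: "\<beta> \<in> carrier (UP K)" and q: "\<And>j. j < h \<Longrightarrow> q j \<in> carrier (UP K)"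
  shows "scalar_poly L \<beta> \<otimes>\<^bsub>UP L\<^esub> poly_comb e h q = poly_comb e h (\<lambda>j. \<beta> \<otimes>\<^bsub>UP K\<^esub> q j)"
proof (rule PL.up_eqI)
  have qc: "q j n \<in> carrier K" if "j < h" for j n using q[OF that] UP_K_closed by blast
  have bc: "\<beta> n \<in> carrier K" for n using b UP_K_closed by blast
  have cc: "poly_comb e h q n \<in> carrier L" for n
    unfolding poly_comb_def using qc e by (intro L.VS.lin_sum_closed) auto
  fix n
  have "coeff (UP L) (scalar_poly L \<beta> \<otimes>\<^bsub>UP L\<^esub> poly_comb e h q) n =
     (\<Oplus>\<^bsub>L\<^esub>k\<in>{..n}. scalar_poly L \<beta> k \<otimes>\<^bsub>L\<^esub> poly_comb e h q (n - k))"
    using PL.coeff_mult[OF scalar_poly_closed[OF b] comb_closed[OF q]] scalar_poly_closed[OF b] comb_closed[OF q]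
    by (simp add: coeff_UP)
  also have "\<dots> = L.VS.lin_sum \<beta> (\<lambda>k. poly_comb e h q (n - k)) (Suc n)"
    unfolding L.VS.lin_sum_def lessThan_Suc_atMost
    using bc cc by (intro L.R.finsum_cong') (auto simp: scalar_poly_def L.smult_assoc2)
  also have "\<dots> = L.VS.lin_sum (\<lambda>j. \<Oplus>\<^bsub>K\<^esub>k\<in>{..<Suc n}. q j (n - k) \<otimes>\<^bsub>K\<^esub> \<beta> k) e h"
    unfolding poly_comb_def using bc qc e by (intro L.VS.lin_sum_lin_sum) auto
  also have "\<dots> = L.VS.lin_sum (\<lambda>j. (\<beta> \<otimes>\<^bsub>UP K\<^esub> q j) n) e h"
  proof (rule L.VS.lin_sum_cong)
    fix j assume j: "j < h"
    have "(\<beta> \<otimes>\<^bsub>UP K\<^esub> q j) n = coeff (UP K) (\<beta> \<otimes>\<^bsub>UP K\<^esub> q j) n" using b q[OF j] by (simp add: coeff_UP)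
    also have "\<dots> = (\<Oplus>\<^bsub>K\<^esub>k\<in>{..n}. \<beta> k \<otimes>\<^bsub>K\<^esub> q j (n - k))"
      using PK.coeff_mult[OF b q[OF j]] b q[OF j] by (simp add: coeff_UP)
    also have "\<dots> = (\<Oplus>\<^bsub>K\<^esub>k\<in>{..<Suc n}. q j (n - k) \<otimes>\<^bsub>K\<^esub> \<beta> k)"
      unfolding lessThan_Suc_atMost using bc qc[OF j] by (intro K.finsum_cong') (auto simp: K.m_comm)
    finally show "(\<Oplus>\<^bsub>K\<^esub>k\<in>{..<Suc n}. q j (n - k) \<otimes>\<^bsub>K\<^esub> \<beta> k) = (\<beta> \<otimes>\<^bsub>UP K\<^esub> q j) n" by simp
    show "(\<beta> \<otimes>\<^bsub>UP K\<^esub> q j) n \<in> carrier K" using b q[OF j] by (intro UP_K_closed) auto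
  qed (use e in auto)
  also have "\<dots> = coeff (UP L) (poly_comb e h (\<lambda>j. \<beta> \<otimes>\<^bsub>UP K\<^esub> q j)) n"
    using comb_closed[of "\<lambda>j. \<beta> \<otimes>\<^bsub>UP K\<^esub> q j"] b q by (simp add: coeff_UP poly_comb_def)
  finally show "coeff (UP L) (scalar_poly L \<beta> \<otimes>\<^bsub>UP L\<^esub> poly_comb e h q) n = coeff (UP L) (poly_comb e h (\<lambda>j. \<beta> \<otimes>\<^bsub>UP K\<^esub> q j)) n" .
qed (use b q scalar_poly_closed comb_closed in auto)

lemma sum_comb:
  assumes p: "\<And>i j. i < (M::nat) \<Longrightarrow> j < h \<Longrightarrow> p i j \<in> carrier (UP K)"
  shows "(\<Oplus>\<^bsub>UP L\<^esub>i\<in>{..<M}. poly_comb e h (p i)) = poly_comb e h (\<lambda>j. \<Oplus>\<^bsub>UP K\<^esub>i\<in>{..<M}. p i j)"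
proof (rule PL.up_eqI)
  have pc: "p i j n \<in> carrier K" if "i < M" "j < h" for i j n using p[OF that] UP_K_closed by blast
  have cc: "poly_comb e h (p i) \<in> carrier (UP L)" if "i < M" for i using comb_closed p that by blast
  have sc: "(\<Oplus>\<^bsub>UP K\<^esub>i\<in>{..<M}. p i j) \<in> carrier (UP K)" if "j < h" for j
    using p that by (auto intro!: PK.finsum_closed)
  have cl: "poly_comb e h (p i) n \<in> carrier L" if "i < M" for i n
    unfolding poly_comb_def using pc that e by (intro L.VS.lin_sum_closed) auto
  show "(\<Oplus>\<^bsub>UP L\<^esub>i\<in>{..<M}. poly_comb e h (p i)) \<in> carrier (UP L)" using cc by (auto intro!: PL.finsum_closed)
  show C: "poly_comb e h (\<lambda>j. \<Oplus>\<^bsub>UP K\<^esub>i\<in>{..<M}. p i j) \<in> carrier (UP L)" using sc by (rule comb_closed)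
  fix n
  have "coeff (UP L) (\<Oplus>\<^bsub>UP L\<^esub>i\<in>{..<M}. poly_comb e h (p i)) n = (\<Oplus>\<^bsub>L\<^esub>i\<in>{..<M}. coeff (UP L) (poly_comb e h (p i)) n)"
    using cc by (intro PL.coeff_finsum) auto
  also have "\<dots> = L.VS.lin_sum (\<lambda>_. \<one>\<^bsub>K\<^esub>) (\<lambda>i. L.VS.lin_sum (\<lambda>j. p i j n) e h) M"
    unfolding L.VS.lin_sum_def[of _ _ M] using cc cl by (intro L.R.finsum_cong') (auto simp: coeff_UP poly_comb_def)
  also have "\<dots> = L.VS.lin_sum (\<lambda>j. \<Oplus>\<^bsub>K\<^esub>i\<in>{..<M}. p i j n \<otimes>\<^bsub>K\<^esub> \<one>\<^bsub>K\<^esub>) e h"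
    using pc e by (intro L.VS.lin_sum_lin_sum) auto
  also have "\<dots> = poly_comb e h (\<lambda>j. \<Oplus>\<^bsub>UP K\<^esub>i\<in>{..<M}. p i j) n"
    unfolding poly_comb_def
  proof (rule L.VS.lin_sum_cong)
    fix j assume j: "j < h"
    have "(\<Oplus>\<^bsub>UP K\<^esub>i\<in>{..<M}. p i j) n = (\<Oplus>\<^bsub>K\<^esub>i\<in>{..<M}. coeff (UP K) (p i j) n)"
      using PK.coeff_finsum[of "{..<M}" "\<lambda>i. p i j" n] p j sc[OF j] by (simp add: coeff_UP)
    also have "\<dots> = (\<Oplus>\<^bsub>K\<^esub>i\<in>{..<M}. p i j n \<otimes>\<^bsub>K\<^esub> \<one>\<^bsub>K\<^esub>)"
      using p pc j by (intro K.finsum_cong') (auto simp: coeff_UP)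
    finally show "(\<Oplus>\<^bsub>K\<^esub>i\<in>{..<M}. p i j n \<otimes>\<^bsub>K\<^esub> \<one>\<^bsub>K\<^esub>) = (\<Oplus>\<^bsub>UP K\<^esub>i\<in>{..<M}. p i j) n" by simp
    show "(\<Oplus>\<^bsub>UP K\<^esub>i\<in>{..<M}. p i j) n \<in> carrier K" using sc[OF j] UP_K_closed by blast
  qed (use e in auto)
  finally show "coeff (UP L) (\<Oplus>\<^bsub>UP L\<^esub>i\<in>{..<M}. poly_comb e h (p i)) n = coeff (UP L) (poly_comb e h (\<lambda>j. \<Oplus>\<^bsub>UP K\<^esub>i\<in>{..<M}. p i j)) n"
    using C by (simp add: coeff_UP)
qed

end

lemma poly_apply_const:
  assumes P: "\<Phi> \<in> carrier (UP D)" and x: "x \<in> carrier R"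
  shows "poly_apply K R f \<Phi> (monom (UP L) (frac x 0) 0) = (\<lambda>n. frac (\<Phi> n x) 0)"
proof
  fix n
  have D: "\<Phi> j \<in> carrier D" for j using UP_D_eval[OF P] .
  have m: "monom (UP L) (frac x 0) 0 k = (if k = 0 then frac x 0 else \<zero>\<^bsub>L\<^esub>)" for k
    using x by (simp add: UP_def)
  have "poly_apply K R f \<Phi> (monom (UP L) (frac x 0) 0) n =
      (\<Oplus>\<^bsub>L\<^esub>j\<in>{..n}. if n = j then frac (\<Phi> j x) 0 else \<zero>\<^bsub>L\<^esub>)"
    unfolding poly_apply_def m
  proof (intro L.R.finsum_cong')
    fix j assume j: "j \<in> {..n}"
    show "loc_extension K R f (\<Phi> j) (if n - j = 0 then frac x 0 else \<zero>\<^bsub>L\<^esub>) = (if n = j then frac (\<Phi> j x) 0 else \<zero>\<^bsub>L\<^esub>)"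
      using j loc_extension_props[OF D] L.E_zero[OF L.D_E[OF loc_extension_props(1)[OF D]]] x by auto
  qed (use D D_E x in auto)
  also have "\<dots> = frac (\<Phi> n x) 0"
    using L.R.finsum_singleton[of n "{..n}" "\<lambda>j. frac (\<Phi> j x) 0"] D D_E x by simp
  finally show "poly_apply K R f \<Phi> (monom (UP L) (frac x 0) 0) n = frac (\<Phi> n x) 0" .
qed

text \<open>In \<open>L\<close> the element $\delta_a(f^{t+1}) / f^t$ equals $v_a(t) = \sum_i \binom t i y_{a,i}$ with
$y_{a,i} = f^{-i} \delta_a^{(i)}(f)$. Let \<open>e\<close> be an independent family in terms of which all the $y_{a,i}$ and \<open>1\<close> can
be written. The coordinates of $v_a$ are then polynomials in \<open>t\<close>, named \<open>v a j\<close> in the proof, and the hypothesis says that the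
linear system $\sum_a x_a v_a = 1$ is solvable at every \<open>t \<in> S\<close> with \<open>t \<ge> N\<close>. A solution \<open>c\<close> of it over $\Bbbk[s]$, up to the factor
\<open>b\<close>, provides the operator $\Delta = \sum_a c_a(s) \delta_a$, since $\Delta \cdot f \boldsymbol{f^s}$ has the coordinates
$\sum_a c_a v_a$.\<close>

proposition functional_equation_from_infinitely_many_integers:
  assumes d: "\<And>a. a < r \<Longrightarrow> \<delta> a \<in> Dn N"
    and inf: "infinite S"
    and sol: "\<And>t. t \<in> S \<Longrightarrow> \<exists>x. (\<forall>a<r. x a \<in> carrier K) \<and>
      fpow t = VS.lin_sum x (\<lambda>a. \<delta> a (fpow (Suc t))) r"
  shows "\<exists>\<Delta> \<in> carrier (UP D). \<exists>b \<in> carrier (UP K). b \<noteq> \<zero>\<^bsub>UP K\<^esub> \<and>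
    fs_action K R f \<Delta> (monom (UP L) (frac f 0) 0) = scalar_poly L b"
proof -
  define g where "g a i = (ad f ^^ i) (\<delta> a) f" for a i
  have dE: "\<delta> a \<in> carrier E" if "a < r" for a using d[OF that] Dn_E by blast
  have dD: "\<delta> a \<in> carrier D" if "a < r" for a using d[OF that] D_iff by blast
  have g: "g a i \<in> carrier R" if "a < r" for a i using dE[OF that] by (simp add: g_def ad_iter_E)
  define y where "y a i = frac (g a i) i" for a i
  have y: "y a i \<in> carrier L" if "a < r" for a i using g[OF that] by (simp add: y_def)
  define Y where "Y = insert \<one>\<^bsub>L\<^esub> ((\<lambda>(a, i). y a i) ` ({..<r} \<times> {..N}))"
  have Y: "finite Y" "Y \<subseteq> carrier L" using y by (auto simp: Y_def)
  obtain e h where e: "\<forall>j<h. e j \<in> carrier L" "L.VS.indep_mod {\<zero>\<^bsub>L\<^esub>} e h"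
    and coord: "\<forall>u\<in>Y. \<exists>c. (\<forall>j<h. c j \<in> carrier K) \<and> u = L.VS.lin_sum c e h"
    using L.VS.finite_set_coordinates[OF Y] by blast
  have ec: "e j \<in> carrier L" if "j < h" for j using e that by blast
  have "\<forall>a i. \<exists>c. a < r \<and> i \<le> N \<longrightarrow> (\<forall>j<h. c j \<in> carrier K) \<and> y a i = L.VS.lin_sum c e h"
    using coord unfolding Y_def by blast
  then obtain z where z: "\<And>a i. a < r \<Longrightarrow> i \<le> N \<Longrightarrow> (\<forall>j<h. z a i j \<in> carrier K) \<and> y a i = L.VS.lin_sum (z a i) e h"
    by metis
  have zc: "z a i j \<in> carrier K" if "a < r" "i \<le> N" "j < h" for a i j using z that by blast
  obtain w where w: "\<forall>j<h. w j \<in> carrier K" "\<one>\<^bsub>L\<^esub> = L.VS.lin_sum w e h"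
    using coord unfolding Y_def by blast
  define \<beta> where "\<beta> = binom_poly K"
  have \<beta>: "\<beta> i \<in> carrier (UP K)" for i unfolding \<beta>_def by (rule binom_poly_closed[OF field char0])
  define v where "v a j = (\<Oplus>\<^bsub>UP K\<^esub>i\<in>{..<Suc N}. z a i j \<odot>\<^bsub>UP K\<^esub> \<beta> i)" for a j
  have v: "v a j \<in> carrier (UP K)" if "a < r" "j < h" for a j
    unfolding v_def using zc that \<beta> by (auto intro!: PK.finsum_closed)
  have ev_v: "at_nat K t (v a j) = (\<Oplus>\<^bsub>K\<^esub>i\<in>{..<Suc N}. z a i j \<otimes>\<^bsub>K\<^esub> [(t choose i)] \<cdot>\<^bsub>K\<^esub> \<one>\<^bsub>K\<^esub>)"
    if a: "a < r" "j < h" "N \<le> t" for a j t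
  proof -
    interpret H: ring_hom_ring "UP K" K "at_nat K t"
      using at_nat_hom[OF field char0] PK.ring_axioms K.ring_axioms by (simp add: ring_hom_ringI2)
    have "at_nat K t (v a j) = (\<Oplus>\<^bsub>K\<^esub>i\<in>{..<Suc N}. at_nat K t (z a i j \<odot>\<^bsub>UP K\<^esub> \<beta> i))"
      unfolding v_def using zc a \<beta> by (subst H.hom_finsum) (auto simp: o_def)
    also have "\<dots> = (\<Oplus>\<^bsub>K\<^esub>i\<in>{..<Suc N}. z a i j \<otimes>\<^bsub>K\<^esub> [(t choose i)] \<cdot>\<^bsub>K\<^esub> \<one>\<^bsub>K\<^esub>)"
    proof (intro K.finsum_cong')
      fix i assume i: "i \<in> {..<Suc N}"
      have zi: "z a i j \<in> carrier K" using zc a i by auto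
      have "z a i j \<odot>\<^bsub>UP K\<^esub> \<beta> i = monom (UP K) (z a i j) 0 \<otimes>\<^bsub>UP K\<^esub> \<beta> i"
        using PK.monom_mult_is_smult[OF zi \<beta>] by simp
      then show "at_nat K t (z a i j \<odot>\<^bsub>UP K\<^esub> \<beta> i) = z a i j \<otimes>\<^bsub>K\<^esub> [(t choose i)] \<cdot>\<^bsub>K\<^esub> \<one>\<^bsub>K\<^esub>"
        using H.hom_mult[OF PK.monom_closed[OF zi] \<beta>] at_nat_const[OF field char0 zi]
          at_nat_binom_poly[OF field char0, of i t] i a by (simp add: \<beta>_def)
    qed (use zc a in auto)
    finally show ?thesis .
  qed
  \<comment> \<open>Only \<open>t \<ge> N\<close> are used: then \<open>f\<^sup>t\<close> has all the denominators \<open>f\<^sup>i\<close> with \<open>i \<le> N\<close> as factors.\<close>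
  define S' where "S' = {t \<in> S. N \<le> t}"
  have "S \<subseteq> S' \<union> {..<N}" by (auto simp: S'_def)
  then have S': "infinite S'" using inf finite_subset by blast
  have pointwise: "\<exists>x. (\<forall>a<r. x a \<in> carrier K) \<and>
      (\<forall>j<h. (\<Oplus>\<^bsub>K\<^esub>a\<in>{..<r}. x a \<otimes>\<^bsub>K\<^esub> at_nat K t (v a j)) = at_nat K t (monom (UP K) (w j) 0))"
    if t: "t \<in> S'" for t
  proof -
    have tN: "N \<le> t" "t \<in> S" using t by (auto simp: S'_def)
    obtain x where x: "\<forall>a<r. x a \<in> carrier K" "fpow t = VS.lin_sum x (\<lambda>a. \<delta> a (fpow (Suc t))) r"
      using sol[OF tN(2)] by blast
    define B where "B i = [(t choose i)] \<cdot>\<^bsub>K\<^esub> \<one>\<^bsub>K\<^esub>" for i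
    have Bc: "B i \<in> carrier K" for i by (simp add: B_def)
    define F where "F = frac (fpow t) 0"
    have Fc: "F \<in> carrier L" by (simp add: F_def)
    define V where "V a = L.VS.lin_sum B (y a) (Suc N)" for a
    have Vc: "V a \<in> carrier L" if "a < r" for a
      unfolding V_def using Bc y[OF that] by (intro L.VS.lin_sum_closed) auto
    have FV: "frac (\<delta> a (fpow (Suc t))) 0 = F \<otimes>\<^bsub>L\<^esub> V a" if a: "a < r" for a
    proof -
      have "\<delta> a (fpow (Suc t)) = \<delta> a (fpow t \<otimes> f)" by simp
      also have "\<dots> = VS.lin_sum B (\<lambda>i. fpow (t - i) \<otimes> g a i) (Suc N)"
        unfolding B_def g_def by (rule leibniz_pow_lin_sum[OF f f d[OF a]])
      finally have "frac (\<delta> a (fpow (Suc t))) 0 = L.VS.lin_sum B (\<lambda>i. frac (fpow (t - i) \<otimes> g a i) 0) (Suc N)"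
        using frac_lin_sum[of "Suc N" B] Bc g[OF a] by simp
      also have "\<dots> = L.VS.lin_sum B (\<lambda>i. L.lm F (y a i)) (Suc N)"
      proof (rule L.VS.lin_sum_cong)
        fix i assume i: "i < Suc N"
        have "fpow t = fpow i \<otimes> fpow (t - i)" using i tN by (simp add: fpow_add[symmetric])
        then have "F \<otimes>\<^bsub>L\<^esub> y a i = frac (fpow i \<otimes> (fpow (t - i) \<otimes> g a i)) (0 + i)"
          using g[OF a] by (simp add: F_def y_def L_mult R.m_assoc)
        also have "\<dots> = frac (fpow (t - i) \<otimes> g a i) 0" using g[OF a] by (intro frac_cancel) simp
        finally show "frac (fpow (t - i) \<otimes> g a i) 0 = L.lm F (y a i)" using y[OF a] by simp
      qed (use Bc Fc y[OF a] in auto)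
      also have "\<dots> = L.lm F (V a)"
        unfolding V_def using Bc Fc y[OF a] by (intro L.app_lin_sum[symmetric] L.lm_in_E) auto
      finally show ?thesis using Vc[OF a] by simp
    qed
    have dc: "\<delta> a (fpow (Suc t)) \<in> carrier R" if "a < r" for a using dE[OF that] by simp
    have "F = frac (VS.lin_sum x (\<lambda>a. \<delta> a (fpow (Suc t))) r) 0" using x(2) by (simp add: F_def)
    also have "\<dots> = L.VS.lin_sum x (\<lambda>a. frac (\<delta> a (fpow (Suc t))) 0) r" using x(1) dc by (intro frac_lin_sum) auto
    also have "\<dots> = L.VS.lin_sum x (\<lambda>a. L.lm F (V a)) r"
      using x(1) Vc Fc FV by (intro L.VS.lin_sum_cong) auto
    also have "\<dots> = L.lm F (L.VS.lin_sum x V r)"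
      using x(1) Vc Fc by (intro L.app_lin_sum[symmetric] L.lm_in_E) auto
    finally have "F \<otimes>\<^bsub>L\<^esub> \<one>\<^bsub>L\<^esub> = F \<otimes>\<^bsub>L\<^esub> L.VS.lin_sum x V r"
      using Fc x(1) Vc by (simp add: L.VS.lin_sum_closed)
    then have one: "\<one>\<^bsub>L\<^esub> = L.VS.lin_sum x V r"
      unfolding F_def using x(1) Vc by (intro fpow_cancel[of "\<one>\<^bsub>L\<^esub>" "L.VS.lin_sum x V r" t]) (auto intro!: L.VS.lin_sum_closed)
    define p where "p a j = at_nat K t (v a j)" for a j
    have p: "p a j \<in> carrier K" if "a < r" "j < h" for a j
      unfolding p_def ev_v[OF that tN(1)] using zc that by (auto intro!: K.finsum_closed)
    have Vp: "V a = L.VS.lin_sum (p a) e h" if a: "a < r" for a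
    proof -
      have "V a = L.VS.lin_sum B (\<lambda>i. L.VS.lin_sum (z a i) e h) (Suc N)"
        unfolding V_def using Bc zc a z ec by (intro L.VS.lin_sum_cong) (auto intro!: L.VS.lin_sum_closed)
      also have "\<dots> = L.VS.lin_sum (\<lambda>j. \<Oplus>\<^bsub>K\<^esub>i\<in>{..<Suc N}. z a i j \<otimes>\<^bsub>K\<^esub> B i) e h"
        using Bc zc a ec by (intro L.VS.lin_sum_lin_sum) auto
      also have "\<dots> = L.VS.lin_sum (p a) e h"
      proof (rule L.VS.lin_sum_cong)
        fix j assume j: "j < h"
        show "(\<Oplus>\<^bsub>K\<^esub>i\<in>{..<Suc N}. z a i j \<otimes>\<^bsub>K\<^esub> B i) = p a j"
          unfolding p_def B_def by (rule ev_v[OF a j tN(1), symmetric])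
        show "p a j \<in> carrier K" by (rule p[OF a j])
      qed (use ec in auto)
      finally show ?thesis .
    qed
    have "L.VS.lin_sum x V r = L.VS.lin_sum x (\<lambda>a. L.VS.lin_sum (p a) e h) r"
      using x(1) Vp p ec by (intro L.VS.lin_sum_cong) (auto intro!: L.VS.lin_sum_closed)
    also have "\<dots> = L.VS.lin_sum (\<lambda>j. \<Oplus>\<^bsub>K\<^esub>a\<in>{..<r}. p a j \<otimes>\<^bsub>K\<^esub> x a) e h"
      using x(1) p ec by (intro L.VS.lin_sum_lin_sum) auto
    finally have eq: "L.VS.lin_sum (\<lambda>j. \<Oplus>\<^bsub>K\<^esub>a\<in>{..<r}. p a j \<otimes>\<^bsub>K\<^esub> x a) e h = L.VS.lin_sum w e h"
      using one w(2) by simp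
    have "(\<Oplus>\<^bsub>K\<^esub>a\<in>{..<r}. x a \<otimes>\<^bsub>K\<^esub> at_nat K t (v a j)) = at_nat K t (monom (UP K) (w j) 0)" if j: "j < h" for j
    proof -
      have "(\<Oplus>\<^bsub>K\<^esub>a\<in>{..<r}. p a j \<otimes>\<^bsub>K\<^esub> x a) = w j"
        using w(1) x(1) p j by (intro L.VS.indep_coefficients_unique[OF e(2) _ _ eq]) (auto intro!: K.finsum_closed)
      moreover have "(\<Oplus>\<^bsub>K\<^esub>a\<in>{..<r}. x a \<otimes>\<^bsub>K\<^esub> at_nat K t (v a j)) = (\<Oplus>\<^bsub>K\<^esub>a\<in>{..<r}. p a j \<otimes>\<^bsub>K\<^esub> x a)"
        using x(1) p j by (intro K.finsum_cong') (auto simp: p_def K.m_comm)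
      ultimately show ?thesis using at_nat_const[OF field char0] w(1) j by simp
    qed
    then show ?thesis using x(1) by blast
  qed
  have "\<exists>b c. b \<in> carrier (UP K) \<and> b \<noteq> \<zero>\<^bsub>UP K\<^esub> \<and> (\<forall>a<r. c a \<in> carrier (UP K)) \<and>
      (\<forall>j<h. (\<Oplus>\<^bsub>UP K\<^esub>a\<in>{..<r}. c a \<otimes>\<^bsub>UP K\<^esub> v a j) = b \<otimes>\<^bsub>UP K\<^esub> monom (UP K) (w j) 0)"
    by (rule generic_solution[where S = S' and ev = "at_nat K" and K = K])
       (use PK.domain_axioms K.is_cring at_nat_hom[OF field char0] finite_nat_roots[OF field char0] S' v w(1) pointwise in auto)
  then obtain b c where b: "b \<in> carrier (UP K)" "b \<noteq> \<zero>\<^bsub>UP K\<^esub>" and c: "\<And>a. a < r \<Longrightarrow> c a \<in> carrier (UP K)"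
    and bc: "\<And>j. j < h \<Longrightarrow> (\<Oplus>\<^bsub>UP K\<^esub>a\<in>{..<r}. c a \<otimes>\<^bsub>UP K\<^esub> v a j) = b \<otimes>\<^bsub>UP K\<^esub> monom (UP K) (w j) 0"
    by blast
  have cc: "c a n \<in> carrier K" if "a < r" for a n using c[OF that] UP_K_closed by blast
  define \<Delta> where "\<Delta> n = DV.lin_sum (\<lambda>a. c a n) \<delta> r" for n
  have \<Delta>D: "\<Delta> n \<in> carrier D" for n unfolding \<Delta>_def using cc dD by (intro DV.lin_sum_closed) auto
  have \<Delta>: "\<Delta> \<in> carrier (UP D)"
  proof -
    obtain m where m: "\<forall>a<r. \<forall>n>m. c a n = \<zero>\<^bsub>K\<^esub>" using UP_common_bound c by blast
    show ?thesis
    proof (rule UP_memI)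
      show "\<Delta> n = \<zero>\<^bsub>D\<^esub>" if "m < n" for n unfolding \<Delta>_def using that m dD by (intro DV.lin_sum_zero) auto
    qed (rule \<Delta>D)
  qed
  have \<Delta>N: "\<Delta> n \<in> Dn N" for n
    unfolding \<Delta>_def
  proof -
    have "DV.lin_sum (\<lambda>a. c a n) \<delta> k \<in> Dn N" if "k \<le> r" for k
      using that
    proof (induction k)
      case 0 then show ?case using lm_Dn[of "\<zero>" N] lm_zero by simp
    next
      case (Suc k)
      have "DV.lin_sum (\<lambda>a. c a n) \<delta> (Suc k) = DV.lin_sum (\<lambda>a. c a n) \<delta> k \<oplus>\<^bsub>D\<^esub> c k n \<odot>\<^bsub>D\<^esub> \<delta> k"
        using Suc.prems cc dD by (intro DV.lin_sum_Suc) auto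
      then show ?case using Suc d[of k] cc[of k n] by (simp add: Dn_add Dn_smult)
    qed
    then show "DV.lin_sum (\<lambda>a. c a n) \<delta> r \<in> Dn N" by simp
  qed
  define po where "po = poly_order K R \<Delta>"
  have po: "po \<le> N" "\<And>n. \<Delta> n \<in> Dn po"
    unfolding po_def poly_order_def
    using Least_le[of "\<lambda>n. \<forall>j. \<Delta> j \<in> Dn n" N] LeastI[of "\<lambda>n. \<forall>j. \<Delta> j \<in> Dn n" N] \<Delta>N by auto
  define q where "q i j = (\<Oplus>\<^bsub>UP K\<^esub>a\<in>{..<r}. z a i j \<odot>\<^bsub>UP K\<^esub> c a)" for i j
  have q: "q i j \<in> carrier (UP K)" if "i \<le> N" "j < h" for i j
    unfolding q_def using zc c that by (auto intro!: PK.finsum_closed)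
  \<comment> \<open>The summands of the action of \<open>\<Delta>\<close> on \<open>f f\<^sup>s\<close>; those beyond the order \<open>po\<close> of \<open>\<Delta>\<close> vanish, so that the
    sum can be taken up to \<open>N\<close>.\<close>
  define T where "T i = scalar_poly L (\<beta> i) \<otimes>\<^bsub>UP L\<^esub>
      (frac \<one> i \<odot>\<^bsub>UP L\<^esub> poly_apply K R f (iter_commutator K R f \<Delta> i) (monom (UP L) (frac f 0) 0))" for i
  define Z where "Z i n = frac ((ad f ^^ i) (\<Delta> n) f) i" for i n
  have adc: "(ad f ^^ i) (\<Delta> n) f \<in> carrier R" for i n using ad_iter_E[OF D_E[OF \<Delta>D]] by simp
  have inner: "frac \<one> i \<odot>\<^bsub>UP L\<^esub> poly_apply K R f (iter_commutator K R f \<Delta> i) (monom (UP L) (frac f 0) 0) = Z i" for i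
  proof -
    have I: "iter_commutator K R f \<Delta> i \<in> carrier (UP D)" "\<And>n. iter_commutator K R f \<Delta> i n = (ad f ^^ i) (\<Delta> n)"
      using iter_commutator_UP[OF \<Delta> f, of i] by auto
    have pa: "poly_apply K R f (iter_commutator K R f \<Delta> i) (monom (UP L) (frac f 0) 0) = (\<lambda>n. frac ((ad f ^^ i) (\<Delta> n) f) 0)"
      using poly_apply_const[OF I(1) f] I(2) by simp
    obtain m where m: "\<forall>n>m. \<Delta> n = \<zero>\<^bsub>D\<^esub>" using UP_bound[OF \<Delta>] by blast
    have "(\<lambda>n. frac ((ad f ^^ i) (\<Delta> n) f) 0) \<in> carrier (UP L)"
      by (rule UP_memI[where m = m]) (use adc m ad_iter_of_zero[OF f] in \<open>auto simp: L_zero\<close>)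
    then show ?thesis unfolding pa using adc by (auto simp: UP_def Z_def L_mult)
  qed
  have Zq: "Z i = poly_comb e h (q i)" if i: "i \<le> N" for i
  proof
    fix n
    have "(ad f ^^ i) (\<Delta> n) f = VS.lin_sum (\<lambda>a. c a n) (\<lambda>a. g a i) r"
      unfolding \<Delta>_def g_def using ad_iter_lin_sum[of r "\<lambda>a. c a n" \<delta> f i] cc dD ad_iter_D
      by (simp add: app_lin_sum_ops)
    then have "Z i n = L.VS.lin_sum (\<lambda>a. c a n) (\<lambda>a. y a i) r"
      unfolding Z_def y_def using cc g by (simp add: frac_lin_sum)
    also have "\<dots> = L.VS.lin_sum (\<lambda>a. c a n) (\<lambda>a. L.VS.lin_sum (z a i) e h) r"
      using cc z i zc ec by (intro L.VS.lin_sum_cong) (auto intro!: L.VS.lin_sum_closed)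
    also have "\<dots> = L.VS.lin_sum (\<lambda>j. \<Oplus>\<^bsub>K\<^esub>a\<in>{..<r}. z a i j \<otimes>\<^bsub>K\<^esub> c a n) e h"
      using cc zc i ec by (intro L.VS.lin_sum_lin_sum) auto
    also have "\<dots> = poly_comb e h (q i) n"
      unfolding poly_comb_def
    proof (rule L.VS.lin_sum_cong)
      fix j assume j: "j < h"
      have "q i j n = coeff (UP K) (q i j) n" using q[OF i j] by (simp add: coeff_UP)
      also have "\<dots> = (\<Oplus>\<^bsub>K\<^esub>a\<in>{..<r}. coeff (UP K) (z a i j \<odot>\<^bsub>UP K\<^esub> c a) n)"
        unfolding q_def using zc c i j by (intro PK.coeff_finsum) auto
      also have "\<dots> = (\<Oplus>\<^bsub>K\<^esub>a\<in>{..<r}. z a i j \<otimes>\<^bsub>K\<^esub> c a n)"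
      proof (intro K.finsum_cong')
        fix a assume "a \<in> {..<r}"
        then have a: "a < r" by simp
        show "coeff (UP K) (z a i j \<odot>\<^bsub>UP K\<^esub> c a) n = z a i j \<otimes>\<^bsub>K\<^esub> c a n"
          using PK.coeff_smult[OF zc[OF a i j] c[OF a]] by (simp add: coeff_UP[OF c[OF a]])
      qed (use zc cc i j in auto)
      finally show "(\<Oplus>\<^bsub>K\<^esub>a\<in>{..<r}. z a i j \<otimes>\<^bsub>K\<^esub> c a n) = q i j n" by simp
      show "q i j n \<in> carrier K" using q[OF i j] UP_K_closed by blast
    qed (use ec in auto)
    finally show "Z i n = poly_comb e h (q i) n" .
  qed
  have T: "T i = poly_comb e h (\<lambda>j. \<beta> i \<otimes>\<^bsub>UP K\<^esub> q i j)" if i: "i \<le> N" for i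
    unfolding T_def inner Zq[OF i] using scalar_times_comb[OF ec \<beta> q[OF i]] .
  have Tc: "T i \<in> carrier (UP L)" if i: "i \<le> N" for i
    unfolding T[OF i] using \<beta> q[OF i] by (intro comb_closed[OF ec]) auto
  have T0: "T i = \<zero>\<^bsub>UP L\<^esub>" if i: "po < i" for i
  proof -
    have "Z i = (\<lambda>n. \<zero>\<^bsub>L\<^esub>)" using ad_iter_zero[OF po(2) f i] by (auto simp: Z_def frac_zero)
    then have "Z i = \<zero>\<^bsub>UP L\<^esub>" by (simp add: UP_def)
    then show ?thesis unfolding T_def inner using scalar_poly_closed[OF \<beta>] by simp
  qed
  have "fs_action K R f \<Delta> (monom (UP L) (frac f 0) 0) = (\<Oplus>\<^bsub>UP L\<^esub>i\<in>{..po}. T i)"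
    unfolding fs_action_def po_def T_def \<beta>_def by simp
  also have "\<dots> = (\<Oplus>\<^bsub>UP L\<^esub>i\<in>{..<Suc N}. T i)"
    using po(1) Tc T0 by (intro PL.add.finprod_mono_neutral_cong_left) auto
  also have "\<dots> = (\<Oplus>\<^bsub>UP L\<^esub>i\<in>{..<Suc N}. poly_comb e h (\<lambda>j. \<beta> i \<otimes>\<^bsub>UP K\<^esub> q i j))"
    using T Tc by (intro PL.finsum_cong') auto
  also have "\<dots> = poly_comb e h (\<lambda>j. \<Oplus>\<^bsub>UP K\<^esub>i\<in>{..<Suc N}. \<beta> i \<otimes>\<^bsub>UP K\<^esub> q i j)"
    using \<beta> q by (intro sum_comb[OF ec]) auto
  also have "\<dots> = scalar_poly L b"
  proof
    fix n
    have "(\<Oplus>\<^bsub>UP K\<^esub>i\<in>{..<Suc N}. \<beta> i \<otimes>\<^bsub>UP K\<^esub> q i j) n = w j \<otimes>\<^bsub>K\<^esub> b n" if j: "j < h" for j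
    proof -
      have m: "z a i j \<odot>\<^bsub>UP K\<^esub> c a \<in> carrier (UP K)" "z a i j \<odot>\<^bsub>UP K\<^esub> \<beta> i \<in> carrier (UP K)" if "a < r" "i \<le> N" for a i
        using zc c \<beta> j that by auto
      have "(\<Oplus>\<^bsub>UP K\<^esub>i\<in>{..<Suc N}. \<beta> i \<otimes>\<^bsub>UP K\<^esub> q i j) =
          (\<Oplus>\<^bsub>UP K\<^esub>i\<in>{..<Suc N}. \<Oplus>\<^bsub>UP K\<^esub>a\<in>{..<r}. \<beta> i \<otimes>\<^bsub>UP K\<^esub> (z a i j \<odot>\<^bsub>UP K\<^esub> c a))"
        unfolding q_def using m \<beta> by (intro PK.finsum_cong') (auto intro!: PK.finsum_rdistr PK.finsum_closed)
      also have "\<dots> = (\<Oplus>\<^bsub>UP K\<^esub>a\<in>{..<r}. \<Oplus>\<^bsub>UP K\<^esub>i\<in>{..<Suc N}. \<beta> i \<otimes>\<^bsub>UP K\<^esub> (z a i j \<odot>\<^bsub>UP K\<^esub> c a))"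
        using m \<beta> by (intro PK.finsum_swap) auto
      also have "\<dots> = (\<Oplus>\<^bsub>UP K\<^esub>a\<in>{..<r}. c a \<otimes>\<^bsub>UP K\<^esub> v a j)"
      proof (intro PK.finsum_cong')
        fix a assume "a \<in> {..<r}"
        then have a: "a < r" by simp
        have "c a \<otimes>\<^bsub>UP K\<^esub> v a j = (\<Oplus>\<^bsub>UP K\<^esub>i\<in>{..<Suc N}. c a \<otimes>\<^bsub>UP K\<^esub> (z a i j \<odot>\<^bsub>UP K\<^esub> \<beta> i))"
          unfolding v_def using m c a by (intro PK.finsum_rdistr) auto
        also have "\<dots> = (\<Oplus>\<^bsub>UP K\<^esub>i\<in>{..<Suc N}. \<beta> i \<otimes>\<^bsub>UP K\<^esub> (z a i j \<odot>\<^bsub>UP K\<^esub> c a))"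
        proof (intro PK.finsum_cong')
          fix i assume "i \<in> {..<Suc N}"
          then have zi: "z a i j \<in> carrier K" using zc a j by auto
          have "c a \<otimes>\<^bsub>UP K\<^esub> (z a i j \<odot>\<^bsub>UP K\<^esub> \<beta> i) = c a \<otimes>\<^bsub>UP K\<^esub> (monom (UP K) (z a i j) 0 \<otimes>\<^bsub>UP K\<^esub> \<beta> i)"
            using PK.monom_mult_is_smult[OF zi \<beta>] by simp
          also have "\<dots> = \<beta> i \<otimes>\<^bsub>UP K\<^esub> (monom (UP K) (z a i j) 0 \<otimes>\<^bsub>UP K\<^esub> c a)"
            using c[OF a] \<beta> zi by (simp add: PK.m_ac)
          also have "\<dots> = \<beta> i \<otimes>\<^bsub>UP K\<^esub> (z a i j \<odot>\<^bsub>UP K\<^esub> c a)"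
            using PK.monom_mult_is_smult[OF zi c[OF a]] by simp
          finally show "c a \<otimes>\<^bsub>UP K\<^esub> (z a i j \<odot>\<^bsub>UP K\<^esub> \<beta> i) = \<beta> i \<otimes>\<^bsub>UP K\<^esub> (z a i j \<odot>\<^bsub>UP K\<^esub> c a)" .
        qed (use m a \<beta> in auto)
        finally show "(\<Oplus>\<^bsub>UP K\<^esub>i\<in>{..<Suc N}. \<beta> i \<otimes>\<^bsub>UP K\<^esub> (z a i j \<odot>\<^bsub>UP K\<^esub> c a)) = c a \<otimes>\<^bsub>UP K\<^esub> v a j" by simp
      qed (use c v j in auto)
      also have "\<dots> = w j \<odot>\<^bsub>UP K\<^esub> b"
        using bc[OF j] PK.monom_mult_is_smult[of "w j" b] b(1) w(1) j by (simp add: PK.m_comm)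
      finally have "(\<Oplus>\<^bsub>UP K\<^esub>i\<in>{..<Suc N}. \<beta> i \<otimes>\<^bsub>UP K\<^esub> q i j) = w j \<odot>\<^bsub>UP K\<^esub> b" .
      then show ?thesis using b(1) w(1) j PK.coeff_smult[of "w j" b n] by (simp add: coeff_UP)
    qed
    then have "poly_comb e h (\<lambda>j. \<Oplus>\<^bsub>UP K\<^esub>i\<in>{..<Suc N}. \<beta> i \<otimes>\<^bsub>UP K\<^esub> q i j) n = L.VS.lin_sum (\<lambda>j. b n \<otimes>\<^bsub>K\<^esub> w j) e h"
      unfolding poly_comb_def using w(1) b(1) UP_K_closed ec by (intro L.VS.lin_sum_cong) (auto simp: K.m_comm)
    also have "\<dots> = b n \<odot>\<^bsub>L\<^esub> L.VS.lin_sum w e h"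
      using w(1) b(1) UP_K_closed ec by (intro L.VS.lin_sum_smult) auto
    also have "\<dots> = scalar_poly L b n" using w(2) by (simp add: scalar_poly_def)
    finally show "poly_comb e h (\<lambda>j. \<Oplus>\<^bsub>UP K\<^esub>i\<in>{..<Suc N}. \<beta> i \<otimes>\<^bsub>UP K\<^esub> q i j) n = scalar_poly L b n" .
  qed
  finally show ?thesis using \<Delta> b by blast
qed

end

theorem corollary4p13:
  fixes K :: "'k ring" and R :: "('k, 'r) module" and F :: "nat \<Rightarrow> ('r \<Rightarrow> 'r) set" and f :: 'r
  assumes "field K" and "has_char_zero K"
    and "algebra K R" and "fin_gen_algebra K R"
    and "filtration K (diff_ops K R) F"
    and "linearly_dominated K R F"
    and "linearly_simple K (diff_ops K R) F"
    and "filt_dim K (diff_ops K R) F < \<infinity>"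
    and "0 < filt_mult K (diff_ops K R) F" and "filt_mult K (diff_ops K R) F < \<infinity>"
    and "holonomic K (diff_ops K R) F (diff_ops_module R)"
    and "f \<in> carrier R" and "f \<noteq> \<zero>\<^bsub>R\<^esub>"
  shows "\<exists>\<delta> \<in> carrier (UP (diff_ops K R)). \<exists>b \<in> carrier (UP K). b \<noteq> \<zero>\<^bsub>UP K\<^esub> \<and>
           fs_action K R f \<delta> (monom (UP (localization R f)) (loc_frac R f f 0) 0)
             = scalar_poly (localization R f) b"
proof -
  have "carrier (diff_ops_module R) \<noteq> {\<zero>\<^bsub>diff_ops_module R\<^esub>}"
    using assms(12,13) by (auto simp: diff_ops_module_def)
  then obtain G where G: "compatible_filtration K (diff_ops K R) F (diff_ops_module R) G"
    "filt_dim K (restrict_scalars K (diff_ops K R) (diff_ops_module R)) G = filt_dim K (diff_ops K R) F / 2"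
    "filt_mult K (restrict_scalars K (diff_ops K R) (diff_ops_module R)) G < \<infinity>"
    using assms(11) unfolding holonomic_def by blast
  interpret holonomic_ops K R F G
    by (intro holonomic_ops.intro filtered_ops.intro field_algebra.intro k_algebra.intro
        field_algebra_axioms.intro filtered_ops_axioms.intro holonomic_ops_axioms.intro assms G)
  interpret localized_field_algebra K R f
    by (intro localized_field_algebra.intro localized_algebra.intro field_algebra_axioms
        k_algebra_axioms localized_algebra_axioms.intro localized_field_algebra_axioms.intro assms)
  obtain M where M: "infinite {t. fpow t \<in> orb M (fpow (Suc t))}"
    using infinitely_many_descents[OF assms(6,7,9) G(2,3) assms(12)] by blast
  define r where "r = subspace_dim K D (F M)"
  obtain \<delta> where d: "\<forall>a<r. \<delta> a \<in> F M" "DV.spans_mod {\<zero>\<^bsub>D\<^esub>} (F M) \<delta> r"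
    using exists_indep_dim[OF DV.vectorspace_axioms F_fin_dim[of M]] unfolding r_def by blast
  obtain C where C: "F M \<subseteq> Dn (C * M)" using assms(6) unfolding linearly_dominated_def by blast
  have dD: "\<delta> a \<in> carrier D" if "a < r" for a using d(1) that F_D by blast
  show ?thesis
  proof (rule functional_equation_from_infinitely_many_integers[OF _ M])
    show "\<delta> a \<in> Dn (C * M)" if "a < r" for a using d(1) C that by blast
    fix t assume "t \<in> {t. fpow t \<in> orb M (fpow (Suc t))}"
    then obtain \<phi> where p: "\<phi> \<in> F M" "fpow t = \<phi> (fpow (Suc t))" by (auto simp: orb_def)
    obtain x where x: "\<forall>a<r. x a \<in> carrier K" "\<phi> \<ominus>\<^bsub>D\<^esub> DV.lin_sum x \<delta> r = \<zero>\<^bsub>D\<^esub>"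
      using d(2) p(1) unfolding DV.spans_mod_def by blast
    have "DV.lin_sum x \<delta> r \<in> carrier D" using x(1) dD by (intro DV.lin_sum_closed) auto
    then have "\<phi> = DV.lin_sum x \<delta> r" using x(2) F_D[OF p(1)] D.r_right_minus_eq by blast
    then have "fpow t = VS.lin_sum x (\<lambda>a. \<delta> a (fpow (Suc t))) r"
      using p(2) app_lin_sum_ops[of r x \<delta> "fpow (Suc t)"] x(1) dD assms(12) by simp
    then show "\<exists>x. (\<forall>a<r. x a \<in> carrier K) \<and> fpow t = VS.lin_sum x (\<lambda>a. \<delta> a (fpow (Suc t))) r"
      using x(1) by blast
  qed
qed

end
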